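(* Let $F$ and $F'$ be finite groups. The lamplighter groups $\mathbb Z\wr F$ and $\mathbb Z\wr F'$ are quasi-isometric if and only if there exist positive integers $d,s,r$ such that $|F|=d^s$ and $|F'|=d^r$.
   Context: For a finite group $F$, the lamplighter group $\mathbb Z\wr F$ is the wreath product $F^{\mathbb Z}\rtimes\mathbb Z$, where $F^{\mathbb Z}$ denotes the direct sum of copies of $F$ indexed by $\mathbb Z$ (finitely supported functions $\mathbb Z\to F$) and $\mathbb Z$ acts by shift. It is finitely generated. A map $f:X\to Y$ between metric spaces is a $(K,C)$-quasi-isometry ($K\ge 1$, $C\ge 0$) if $\frac1K d_X(x_1,x_2)-C\le d_Y(f(x_1),f(x_2))\le K d_X(x_1,x_2)+C$ for all $x_1,x_2\in X$, and the $C$-neighborhood of $f(X)$ is all of $Y$. Two finitely generated groups are quasi-isometric if, with word metrics for finite generating sets, there is a $(K,C)$-quasi-isometry between them for some $K,C$. *)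

theory Defs
  imports Complex_Main "HOL-Algebra.Product_Groups"
begin

definition semidirect_product ::
    "('n, 'p) monoid_scheme \<Rightarrow> ('h, 'q) monoid_scheme \<Rightarrow> ('h \<Rightarrow> 'n \<Rightarrow> 'n) \<Rightarrow> ('n \<times> 'h) monoid" where
  "semidirect_product N H \<phi> =
     \<lparr>carrier = carrier N \<times> carrier H,
      monoid.mult = (\<lambda>(a, g) (b, h). (a \<otimes>\<^bsub>N\<^esub> \<phi> g b, g \<otimes>\<^bsub>H\<^esub> h)),
      one = (\<one>\<^bsub>N\<^esub>, \<one>\<^bsub>H\<^esub>)\<rparr>"

definition lamplighter :: "('a, 'b) monoid_scheme \<Rightarrow> ((int \<Rightarrow> 'a) \<times> int) monoid" where
  "lamplighter F =
     semidirect_product (sum_group UNIV (\<lambda>_::int. F)) integer_group (\<lambda>m f i. f (i - m))"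

definition finite_generating_set :: "('a, 'b) monoid_scheme \<Rightarrow> 'a set \<Rightarrow> bool" where
  "finite_generating_set G S \<longleftrightarrow> finite S \<and> S \<subseteq> carrier G \<and> generate G S = carrier G"

definition word_length :: "('a, 'b) monoid_scheme \<Rightarrow> 'a set \<Rightarrow> 'a \<Rightarrow> nat" where
  "word_length G S g =
     (LEAST n. \<exists>w. length w = n \<and> set w \<subseteq> S \<union> (\<lambda>s. inv\<^bsub>G\<^esub> s) ` S \<and>
        foldr (\<lambda>x y. x \<otimes>\<^bsub>G\<^esub> y) w \<one>\<^bsub>G\<^esub> = g)"

definition word_dist :: "('a, 'b) monoid_scheme \<Rightarrow> 'a set \<Rightarrow> 'a \<Rightarrow> 'a \<Rightarrow> real" where
  "word_dist G S g h = real (word_length G S (inv\<^bsub>G\<^esub> g \<otimes>\<^bsub>G\<^esub> h))"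

text \<open>
  A metric space is given by its carrier and its distance function, which is only evaluated on the
  carrier. The neighbourhood of the image is the closed one, so that a surjective isometry is a
  quasi-isometry with constants \<open>K = 1\<close> and \<open>C = 0\<close>.
\<close>

definition quasi_isometry ::
    "real \<Rightarrow> real \<Rightarrow> 'a set \<Rightarrow> ('a \<Rightarrow> 'a \<Rightarrow> real) \<Rightarrow> 'b set \<Rightarrow> ('b \<Rightarrow> 'b \<Rightarrow> real) \<Rightarrow> ('a \<Rightarrow> 'b) \<Rightarrow> bool" where
  "quasi_isometry K C X dX Y dY f \<longleftrightarrow>
     K \<ge> 1 \<and> C \<ge> 0 \<and> f \<in> X \<rightarrow> Y \<and>
     (\<forall>x1\<in>X. \<forall>x2\<in>X. 1 / K * dX x1 x2 - C \<le> dY (f x1) (f x2) \<and>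
                    dY (f x1) (f x2) \<le> K * dX x1 x2 + C) \<and>
     (\<forall>y\<in>Y. \<exists>x\<in>X. dY (f x) y \<le> C)"

definition quasi_isometric_groups ::
    "('a, 'c) monoid_scheme \<Rightarrow> ('b, 'd) monoid_scheme \<Rightarrow> bool" where
  "quasi_isometric_groups G H \<longleftrightarrow>
     (\<exists>S T. finite_generating_set G S \<and> finite_generating_set H T \<and>
        (\<exists>K C f. quasi_isometry K C (carrier G) (word_dist G S) (carrier H) (word_dist H T) f))"

text \<open>Sanity checks: the lamplighter group is a finitely generated group, and the word metric is a metric.\<close>

lemma carrier_lamplighter:
  assumes "group F"
  shows "carrier (lamplighter F) =
    {f. (\<forall>i. f i \<in> carrier F) \<and> finite {i. f i \<noteq> \<one>\<^bsub>F\<^esub>}} \<times> UNIV"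
  using assms by (auto simp: lamplighter_def semidirect_product_def carrier_sum_group)

lemma mult_lamplighter:
  "(f, m) \<otimes>\<^bsub>lamplighter F\<^esub> (g, n) = (\<lambda>i. f i \<otimes>\<^bsub>F\<^esub> g (i - m), m + n)"
  by (simp add: lamplighter_def semidirect_product_def restrict_def)

lemma one_lamplighter: "\<one>\<^bsub>lamplighter F\<^esub> = (\<lambda>_. \<one>\<^bsub>F\<^esub>, 0)"
  by (simp add: lamplighter_def semidirect_product_def restrict_def)

lemma finite_shift:
  fixes m :: int
  assumes "finite {i. P i}"
  shows "finite {i. P (i + m)}"
proof -
  have "{i. P (i + m)} \<subseteq> (\<lambda>i. i - m) ` {i. P i}"
    by (auto simp: image_iff) (metis add_diff_cancel_right')
  then show ?thesis using assms finite_surj by blast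
qed

lemma group_lamplighter:
  assumes "group F"
  shows "group (lamplighter F)"
proof -
  interpret F: group F by fact
  show ?thesis
  proof (rule groupI)
    fix x y assume x: "x \<in> carrier (lamplighter F)" and y: "y \<in> carrier (lamplighter F)"
    obtain f m g n where fg: "x = (f, m)" "y = (g, n)" by fastforce
    have "finite {i. g (i + - m) \<noteq> \<one>\<^bsub>F\<^esub>}"
      using y fg by (intro finite_shift) (simp add: carrier_lamplighter[OF assms])
    then have "finite ({i. f i \<noteq> \<one>\<^bsub>F\<^esub>} \<union> {i. g (i - m) \<noteq> \<one>\<^bsub>F\<^esub>})"
      using x fg by (simp add: carrier_lamplighter[OF assms])
    then have "finite {i. f i \<otimes>\<^bsub>F\<^esub> g (i - m) \<noteq> \<one>\<^bsub>F\<^esub>}"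
      by (rule rev_finite_subset) auto
    then show "x \<otimes>\<^bsub>lamplighter F\<^esub> y \<in> carrier (lamplighter F)"
      using x y fg by (simp add: carrier_lamplighter[OF assms] mult_lamplighter)
  next
    fix x assume x: "x \<in> carrier (lamplighter F)"
    obtain f m where f: "x = (f, m)" by fastforce
    have fc: "f i \<in> carrier F" for i using x f by (simp add: carrier_lamplighter[OF assms])
    let ?y = "(\<lambda>i. inv\<^bsub>F\<^esub> f (i + m), - m)"
    have "finite {i. f (i + m) \<noteq> \<one>\<^bsub>F\<^esub>}"
      using x f by (intro finite_shift) (simp add: carrier_lamplighter[OF assms])
    then have "finite {i. inv\<^bsub>F\<^esub> f (i + m) \<noteq> \<one>\<^bsub>F\<^esub>}"
      by (rule rev_finite_subset) auto
    then have "?y \<in> carrier (lamplighter F)"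
      using fc by (simp add: carrier_lamplighter[OF assms])
    moreover have "?y \<otimes>\<^bsub>lamplighter F\<^esub> x = \<one>\<^bsub>lamplighter F\<^esub>"
      using fc f by (simp add: mult_lamplighter one_lamplighter)
    ultimately show "\<exists>y\<in>carrier (lamplighter F). y \<otimes>\<^bsub>lamplighter F\<^esub> x = \<one>\<^bsub>lamplighter F\<^esub>"
      by blast
  qed (auto simp: carrier_lamplighter[OF assms] mult_lamplighter one_lamplighter
        F.m_assoc algebra_simps)
qed

definition lamp :: "('a, 'b) monoid_scheme \<Rightarrow> int \<Rightarrow> 'a \<Rightarrow> int \<Rightarrow> 'a" where
  "lamp F i a = (\<lambda>_. \<one>\<^bsub>F\<^esub>)(i := a)"

lemma finitely_generated_lamplighter:
  assumes "group F" and "finite (carrier F)"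
  shows "finite_generating_set (lamplighter F)
    (insert (\<lambda>_. \<one>\<^bsub>F\<^esub>, 1) ((\<lambda>a. (lamp F 0 a, 0)) ` carrier F))"
    (is "finite_generating_set ?L ?S")
proof -
  interpret F: group F by fact
  interpret L: group ?L by (rule group_lamplighter) fact
  have S: "?S \<subseteq> carrier ?L"
    by (auto simp: carrier_lamplighter[OF assms(1)] lamp_def)
  let ?G = "generate ?L ?S"
  have GL: "?G \<subseteq> carrier ?L" using L.generate_incl[OF S] .
  have t: "(\<lambda>_. \<one>\<^bsub>F\<^esub>, 1) \<in> ?G" by (intro generate.incl) simp
  have "inv\<^bsub>?L\<^esub> (\<lambda>_. \<one>\<^bsub>F\<^esub>, 1) = (\<lambda>_. \<one>\<^bsub>F\<^esub>, -1)"
    by (rule L.inv_equality)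
      (auto simp: carrier_lamplighter[OF assms(1)] mult_lamplighter one_lamplighter)
  moreover have "inv\<^bsub>?L\<^esub> (\<lambda>_. \<one>\<^bsub>F\<^esub>, 1) \<in> ?G" by (intro generate.inv) simp
  ultimately have t': "(\<lambda>_. \<one>\<^bsub>F\<^esub>, -1) \<in> ?G" by simp
  have T: "(\<lambda>_. \<one>\<^bsub>F\<^esub>, m) \<in> ?G" for m :: int
  proof (induction m rule: int_induct[where k = 0])
    case base
    show ?case using generate.one[of ?L ?S] by (simp add: one_lamplighter)
  next
    case (step1 i)
    show ?case using generate.eng[OF step1(2) t] by (simp add: mult_lamplighter)
  next
    case (step2 i)
    show ?case using generate.eng[OF step2(2) t'] by (simp add: mult_lamplighter)
  qed
  have A: "(lamp F i a, 0) \<in> ?G" if "a \<in> carrier F" for i a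
  proof -
    have "(lamp F 0 a, 0) \<in> ?G" using that by (intro generate.incl) simp
    note generate.eng[OF generate.eng[OF T[of i] this] T[of "- i"]]
    moreover have "(\<lambda>_. \<one>\<^bsub>F\<^esub>, i) \<otimes>\<^bsub>?L\<^esub> (lamp F 0 a, 0) \<otimes>\<^bsub>?L\<^esub> (\<lambda>_. \<one>\<^bsub>F\<^esub>, - i) = (lamp F i a, 0)"
      using that by (auto simp: mult_lamplighter lamp_def fun_eq_iff)
    ultimately show ?thesis by simp
  qed
  have B: "(f, 0) \<in> ?G" if "finite I" "{i. f i \<noteq> \<one>\<^bsub>F\<^esub>} \<subseteq> I" "\<And>i. f i \<in> carrier F" for f I
    using that
  proof (induction I arbitrary: f rule: finite_induct)
    case empty
    then have "f = (\<lambda>_. \<one>\<^bsub>F\<^esub>)" by auto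
    then show ?case using T[of 0] by simp
  next
    case (insert j I)
    have "(f(j := \<one>\<^bsub>F\<^esub>), 0) \<in> ?G"
      using insert.prems by (intro insert.IH) auto
    note generate.eng[OF this A[OF insert.prems(2)[of j], of j]]
    moreover have "(f(j := \<one>\<^bsub>F\<^esub>), 0) \<otimes>\<^bsub>?L\<^esub> (lamp F j (f j), 0) = (f, 0)"
      using insert.prems(2) by (auto simp: mult_lamplighter lamp_def fun_eq_iff)
    ultimately show ?case by simp
  qed
  have "carrier ?L \<subseteq> ?G"
  proof
    fix x assume x: "x \<in> carrier ?L"
    obtain f m where f: "x = (f, m)" by fastforce
    have "(f, 0) \<in> ?G"
      using x f by (intro B[of "{i. f i \<noteq> \<one>\<^bsub>F\<^esub>}"]) (auto simp: carrier_lamplighter[OF assms(1)])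
    from generate.eng[OF this T[of m]] x f
    show "x \<in> ?G" by (simp add: mult_lamplighter carrier_lamplighter[OF assms(1)])
  qed
  then show ?thesis using S GL assms(2) by (auto simp: finite_generating_set_def)
qed

context group
begin

abbreviation "wprod w \<equiv> foldr (\<lambda>x y. x \<otimes> y) w \<one>"
abbreviation "sym_set S \<equiv> S \<union> (\<lambda>s. inv s) ` S"

lemma wprod_closed: "set w \<subseteq> carrier G \<Longrightarrow> wprod w \<in> carrier G"
  by (induction w) auto

lemma wprod_append:
  "set v \<subseteq> carrier G \<Longrightarrow> set w \<subseteq> carrier G \<Longrightarrow> wprod (v @ w) = wprod v \<otimes> wprod w"
  by (induction v) (auto simp: m_assoc wprod_closed)

lemma wprod_inv:
  "set w \<subseteq> carrier G \<Longrightarrow> wprod (rev (map (\<lambda>x. inv x) w)) = inv (wprod w)"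
proof (induction w)
  case (Cons a w)
  then have "set (rev (map (\<lambda>x. inv x) w)) \<subseteq> carrier G" by auto
  from wprod_append[OF this, of "[inv a]"] Cons show ?case
    by (simp add: inv_mult_group wprod_closed)
qed simp

lemma sym_set_carrier: "S \<subseteq> carrier G \<Longrightarrow> sym_set S \<subseteq> carrier G"
  by auto

lemma sym_set_inv: "S \<subseteq> carrier G \<Longrightarrow> x \<in> sym_set S \<Longrightarrow> inv x \<in> sym_set S"
  by auto

lemma word_exists:
  assumes "S \<subseteq> carrier G" "g \<in> generate G S"
  shows "\<exists>w. set w \<subseteq> sym_set S \<and> wprod w = g"
  using assms(2)
proof induction
  case one
  show ?case by (rule exI[of _ "[]"]) simp
next
  case (incl h)
  then show ?case using assms(1) by (intro exI[of _ "[h]"]) auto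
next
  case (inv h)
  then show ?case using assms(1) by (intro exI[of _ "[inv h]"]) auto
next
  case (eng g h)
  then obtain v w where "set v \<subseteq> sym_set S" "wprod v = g" "set w \<subseteq> sym_set S" "wprod w = h"
    by blast
  moreover from this have "wprod (v @ w) = wprod v \<otimes> wprod w"
    using sym_set_carrier[OF assms(1)] by (intro wprod_append) blast+
  ultimately show ?case by (intro exI[of _ "v @ w"]) auto
qed

lemma word_length_le:
  "set w \<subseteq> sym_set S \<Longrightarrow> word_length G S (wprod w) \<le> length w"
  unfolding word_length_def by (rule Least_le) blast

lemma word_length_witness:
  assumes "finite_generating_set G S" "g \<in> carrier G"
  shows "\<exists>w. length w = word_length G S g \<and> set w \<subseteq> sym_set S \<and> wprod w = g"
proof -
  have "\<exists>n w. length w = n \<and> set w \<subseteq> sym_set S \<and> wprod w = g"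
    using word_exists[of S g] assms by (auto simp: finite_generating_set_def)
  from LeastI_ex[OF this] show ?thesis by (simp add: word_length_def)
qed

lemma word_dist_zero_iff:
  assumes "finite_generating_set G S" "g \<in> carrier G" "h \<in> carrier G"
  shows "word_dist G S g h = 0 \<longleftrightarrow> g = h"
proof
  assume "word_dist G S g h = 0"
  with word_length_witness[OF assms(1), of "inv g \<otimes> h"] assms(2,3)
  have "inv g \<otimes> h = \<one>" by (auto simp: word_dist_def)
  then show "g = h" using assms(2,3) by (metis inv_closed inv_equality inv_inv)
next
  assume "g = h"
  then show "word_dist G S g h = 0"
    using assms(2) word_length_le[of "[]" S] by (simp add: word_dist_def)
qed

lemma word_dist_commute:
  assumes "finite_generating_set G S" "g \<in> carrier G" "h \<in> carrier G"
  shows "word_dist G S g h = word_dist G S h g"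
proof -
  have S: "S \<subseteq> carrier G" using assms(1) by (simp add: finite_generating_set_def)
  have le: "word_length G S (inv x) \<le> word_length G S x" if x: "x \<in> carrier G" for x
  proof -
    obtain w where w: "length w = word_length G S x" "set w \<subseteq> sym_set S" "wprod w = x"
      using word_length_witness[OF assms(1) x] by blast
    have "set w \<subseteq> carrier G" using w(2) sym_set_carrier[OF S] by blast
    moreover have "set (rev (map (\<lambda>x. inv x) w)) \<subseteq> sym_set S"
      using w(2) sym_set_inv[OF S] by auto
    ultimately show ?thesis
      using word_length_le[of "rev (map (\<lambda>x. inv x) w)" S] wprod_inv[of w] w by simp
  qed
  have "inv (inv g \<otimes> h) = inv h \<otimes> g" using assms(2,3) by (simp add: inv_mult_group)
  moreover have "inv (inv h \<otimes> g) = inv g \<otimes> h" using assms(2,3) by (simp add: inv_mult_group)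
  ultimately show ?thesis
    using le[of "inv g \<otimes> h"] le[of "inv h \<otimes> g"] assms(2,3) by (simp add: word_dist_def)
qed

lemma word_dist_triangle:
  assumes "finite_generating_set G S" "x \<in> carrier G" "y \<in> carrier G" "z \<in> carrier G"
  shows "word_dist G S x z \<le> word_dist G S x y + word_dist G S y z"
proof -
  have S: "S \<subseteq> carrier G" using assms(1) by (simp add: finite_generating_set_def)
  obtain v where v: "length v = word_length G S (inv x \<otimes> y)" "set v \<subseteq> sym_set S"
      "wprod v = inv x \<otimes> y"
    using word_length_witness[OF assms(1), of "inv x \<otimes> y"] assms by auto
  obtain w where w: "length w = word_length G S (inv y \<otimes> z)" "set w \<subseteq> sym_set S"
      "wprod w = inv y \<otimes> z"
    using word_length_witness[OF assms(1), of "inv y \<otimes> z"] assms by auto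
  have "wprod (v @ w) = wprod v \<otimes> wprod w"
    using v(2) w(2) sym_set_carrier[OF S] by (intro wprod_append) blast+
  also have "\<dots> = inv x \<otimes> (y \<otimes> (inv y \<otimes> z))" using assms(2-4) v(3) w(3) by (simp add: m_assoc)
  also have "\<dots> = inv x \<otimes> z" using assms(2-4) by (simp add: m_assoc[symmetric])
  finally have "wprod (v @ w) = inv x \<otimes> z" .
  then show ?thesis using word_length_le[of "v @ w" S] v(1,2) w(1,2) by (simp add: word_dist_def)
qed

end

end

theory Submission
  imports Defs
begin

text \<open>Elements of the lamplighter group are lamp states; up to a constant factor, the word metric is the
  length of the hull of the two heads and of all lamps that differ. If the orders of both groups are
  powers of the same number, recoding blocks of lamps into blocks of another length is a quasi-isometry.

  Conversely, let \<open>f\<close> be a quasi-isometry and let the head walk upwards, writing random lamps. The images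
  of the walk have an asymptotic speed \<open>e\<close>, and counting balls gives \<open>e \<ge> ln \<bar>F\<bar> / ln \<bar>F'\<bar>\<close>. At a starting
  point where the speed is nearly attained, all blocks of a typical image path have nearly extremal
  length; the geometry of the metric then forces the image head to move monotonically. Other walks
  with the same end points inherit this, so a whole box of states is mapped in a controlled way.
  Rewriting the image lamps in a window of this box gives \<open>e \<le> ln \<bar>F\<bar> / ln \<bar>F'\<bar>\<close> by counting. Hence the
  speed is typical everywhere, and \<open>f\<close> maps every vertical line monotonically, say upwards.

  Then the lamps far to the left of the image head only depend on the lamps to the left of the head,
  which gives a map \<open>T\<close> of boundary configurations. The number of truncated configurations whose image has
  a prescribed initial part is bounded, and the sum of these numbers over the \<open>\<bar>F'\<bar>\<close> continuations of
  an initial part is a power of \<open>\<bar>F\<bar>\<close> times its own number. This forces \<open>\<bar>F'\<bar>\<^sup>i = \<bar>F\<bar>\<^sup>j\<close> for some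
  positive \<open>i\<close> and \<open>j\<close>.\<close>

section \<open>The metric on lamp states\<close>

text \<open>The speed is defined by the supremum, over all starting points, of the second moment of
  the image distance. Means alone would give a rate but no concentration; a second moment bound on
  every block together with a lower bound on the mean of the total leaves no room for variance.
  Counting gives lower bounds at every starting point, but the supremum is at first nearly attained
  only at some of them. This asymmetry is why the upper bound for the speed must come before any
  statement about all starting points. Information passes between starting points because a walk
  overwrites: states that agree outside a window reach the very same state when they write the same
  word, so their image paths share an end. Most words can be traded for all words by reflecting the
  domain: the end points of all walks of one length from one state form a box seen from the other
  side. On the boundary the obstacle is that \<open>T\<close> need not be injective and image
  heights are known only up to a constant. Both defects are bounded, and bounded integer
  multiplicities suffice for an exact relation between powers.\<close>

type_synonym 'a state = "(int \<Rightarrow> 'a) \<times> int"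

text \<open>An alphabet \<open>A\<close> with a default letter \<open>z\<close> stands in for the
  finite group. With \<open>z\<close> the unit, this is the carrier of the lamplighter
  group.\<close>

definition states :: "'a set \<Rightarrow> 'a \<Rightarrow> 'a state set" where
  "states A z = {p. (\<forall>i. fst p i \<in> A) \<and> finite {i. fst p i \<noteq> z}}"

definition fd :: "'a state \<Rightarrow> 'a state \<Rightarrow> bool" where
  "fd p q \<longleftrightarrow> finite {i. fst p i \<noteq> fst q i}"

text \<open>Lamp \<open>i\<close> occupies the interval from \<open>i\<close> to \<open>i + 1\<close>, the heads sit at integer points. The distance
  of two states is the length of the hull of both heads and all lamps that differ.\<close>

definition marks :: "'a state \<Rightarrow> 'a state \<Rightarrow> int set" where
  "marks p q = {snd p, snd q} \<union> {i. fst p i \<noteq> fst q i} \<union> (\<lambda>i. i + 1) ` {i. fst p i \<noteq> fst q i}"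

definition lo :: "'a state \<Rightarrow> 'a state \<Rightarrow> int" where "lo p q = Min (marks p q)"
definition hi :: "'a state \<Rightarrow> 'a state \<Rightarrow> int" where "hi p q = Max (marks p q)"
definition wd :: "'a state \<Rightarrow> 'a state \<Rightarrow> int" where "wd p q = hi p q - lo p q"

lemma states_fd: "p \<in> states A z \<Longrightarrow> q \<in> states A z \<Longrightarrow> fd p q"
  unfolding states_def fd_def
  by (rule finite_subset[of _ "{i. fst p i \<noteq> z} \<union> {i. fst q i \<noteq> z}"]) auto

lemma fd_trans: "fd p q \<Longrightarrow> fd q r \<Longrightarrow> fd p r"
  unfolding fd_def
  by (rule finite_subset[of _ "{i. fst p i \<noteq> fst q i} \<union> {i. fst q i \<noteq> fst r i}"]) auto

lemma marks_commute: "marks p q = marks q p"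
  unfolding marks_def by auto

lemma lo_commute: "lo p q = lo q p" and hi_commute: "hi p q = hi q p"
  and wd_commute: "wd p q = wd q p"
  by (simp_all add: lo_def hi_def wd_def marks_commute)

context
  fixes p q :: "'a state"
  assumes fd: "fd p q"
begin

lemma finite_marks: "finite (marks p q)"
  using fd by (simp add: marks_def fd_def)

lemma marks_bounds: "i \<in> marks p q \<Longrightarrow> lo p q \<le> i" "i \<in> marks p q \<Longrightarrow> i \<le> hi p q"
  using finite_marks by (auto simp: lo_def hi_def)

lemma lo_le: "lo p q \<le> snd p" "lo p q \<le> snd q"
  by (rule marks_bounds(1); simp add: marks_def)+

lemma hi_ge: "snd p \<le> hi p q" "snd q \<le> hi p q"
  by (rule marks_bounds(2); simp add: marks_def)+

lemma diff_bounds: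
  assumes "fst p i \<noteq> fst q i" shows "lo p q \<le> i" "i < hi p q"
  using marks_bounds(1)[of i] marks_bounds(2)[of "i + 1"] assms by (auto simp: marks_def)

lemma agree_below: "i < lo p q \<Longrightarrow> fst p i = fst q i"
  using diff_bounds(1)[of i] by fastforce

lemma agree_above: "hi p q \<le> i \<Longrightarrow> fst p i = fst q i"
  using diff_bounds(2)[of i] by fastforce

lemma lo_greatest:
  assumes "l \<le> snd p" "l \<le> snd q" "\<And>i. i < l \<Longrightarrow> fst p i = fst q i"
  shows "l \<le> lo p q"
proof -
  have "marks p q \<noteq> {}" by (simp add: marks_def)
  then have "lo p q \<in> marks p q" using finite_marks by (simp add: lo_def)
  moreover have "l \<le> i" if "i \<in> marks p q" for i
    using that assms by (force simp: marks_def not_less[symmetric])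
  ultimately show ?thesis by blast
qed

lemma hi_least:
  assumes "snd p \<le> u" "snd q \<le> u" "\<And>i. u \<le> i \<Longrightarrow> fst p i = fst q i"
  shows "hi p q \<le> u"
proof -
  have "marks p q \<noteq> {}" by (simp add: marks_def)
  then have "hi p q \<in> marks p q" using finite_marks by (simp add: hi_def)
  moreover have "i \<le> u" if "i \<in> marks p q" for i
  proof -
    have "j + 1 \<le> u" if "fst p j \<noteq> fst q j" for j
      using that assms(3)[of j] by (cases "u \<le> j") auto
    then show ?thesis using that assms(1,2) by (fastforce simp: marks_def)
  qed
  ultimately show ?thesis by blast
qed

lemma wd_nonneg: "0 \<le> wd p q"
  using lo_le(1) hi_ge(1) by (simp add: wd_def)

lemma head_wd: "\<bar>snd p - snd q\<bar> \<le> wd p q"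
  using lo_le hi_ge by (simp add: wd_def)

end

lemma wd_le:
  assumes "fd p q" "l \<le> snd p" "l \<le> snd q" "snd p \<le> u" "snd q \<le> u"
    "\<And>i. i < l \<Longrightarrow> fst p i = fst q i" "\<And>i. u \<le> i \<Longrightarrow> fst p i = fst q i"
  shows "wd p q \<le> u - l"
  using lo_greatest[OF assms(1-3,6)] hi_least[OF assms(1,4,5,7)] by (simp add: wd_def)

text \<open>A lamp that differs between \<open>p\<close> and \<open>r\<close> already differs in one
  of the two steps. Both hulls on the way contain the head of \<open>q\<close>, so their union is an
  interval, whence \<open>wd_triangle\<close>. The finer information about the two ends drives the
  geometry of efficient paths.\<close>

lemma hull_triangle:
  assumes "fd p q" "fd q r"
  shows "min (lo p q) (lo q r) \<le> lo p r" "hi p r \<le> max (hi p q) (hi q r)"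
proof -
  note pr = fd_trans[OF assms]
  show "min (lo p q) (lo q r) \<le> lo p r"
    using lo_le[OF assms(1)] lo_le[OF assms(2)] agree_below[OF assms(1)] agree_below[OF assms(2)]
    by (intro lo_greatest[OF pr]) auto
  show "hi p r \<le> max (hi p q) (hi q r)"
    using hi_ge[OF assms(1)] hi_ge[OF assms(2)] agree_above[OF assms(1)] agree_above[OF assms(2)]
    by (intro hi_least[OF pr]) auto
qed

lemma wd_triangle:
  assumes "fd p q" "fd q r"
  shows "wd p r \<le> wd p q + wd q r"
  using hull_triangle[OF assms] lo_le[OF assms(1)] lo_le[OF assms(2)]
    hi_ge[OF assms(1)] hi_ge[OF assms(2)] unfolding wd_def by linarith

lemma wd_self [simp]: "wd p p = 0"
  using wd_le[of p p "snd p" "snd p"] wd_nonneg[of p p] by (simp add: fd_def)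

text \<open>Reflection of the line at the origin. Lamp \<open>i\<close> fills the interval from
  \<open>i\<close> to \<open>i + 1\<close>, hence goes to \<open>- 1 - i\<close>, while a head at
  \<open>t\<close> goes to \<open>- t\<close>. Composing \<open>f\<close> with it turns falling
  image paths into rising ones, so one direction suffices throughout.\<close>

definition mirror :: "'a state \<Rightarrow> 'a state" where
  "mirror p = (\<lambda>i. fst p (- 1 - i), - snd p)"

lemma mirror_sel [simp]: "fst (mirror p) i = fst p (- 1 - i)" "snd (mirror p) = - snd p"
  by (simp_all add: mirror_def)

lemma mirror_mirror [simp]: "mirror (mirror p) = p"
  by (simp add: mirror_def)

lemma finite_mirror:
  fixes P :: "int \<Rightarrow> bool"
  shows "finite {i. P (- 1 - i)} \<longleftrightarrow> finite {i. P i}"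
proof -
  have "{i. P (- 1 - i)} = (\<lambda>i. - 1 - i) ` {i. P i}"
  proof (intro equalityI subsetI)
    fix x assume "x \<in> {i. P (- 1 - i)}"
    then show "x \<in> (\<lambda>i. - 1 - i) ` {i. P i}" by (intro image_eqI[of _ _ "- 1 - x"]) auto
  qed auto
  moreover have "inj_on (\<lambda>i. - 1 - i :: int) X" for X by (auto simp: inj_on_def)
  ultimately show ?thesis by (simp add: finite_image_iff)
qed

lemma mirror_fd [simp]: "fd (mirror p) (mirror q) = fd p q"
  using finite_mirror[of "\<lambda>i. fst p i \<noteq> fst q i"] by (simp add: fd_def)

lemma mirror_states [simp]: "mirror p \<in> states A z \<longleftrightarrow> p \<in> states A z"
proof -
  have "mirror p \<in> states A z" if "p \<in> states A z" for p
    using that finite_mirror[of "\<lambda>i. fst p i \<noteq> z"] by (simp add: states_def)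
  from this[of p] this[of "mirror p"] show ?thesis by auto
qed

lemma lo_mirror:
  assumes "fd p q" shows "lo (mirror p) (mirror q) = - hi p q"
proof (rule antisym)
  have *: "- hi p q \<le> lo (mirror p) (mirror q)" if "fd p q" for p q :: "'a state"
    using that hi_ge[OF that] agree_above[OF that] by (intro lo_greatest) auto
  show "- hi p q \<le> lo (mirror p) (mirror q)" by (rule *[OF assms])
  have "hi p q \<le> - lo (mirror p) (mirror q)"
  proof (rule hi_least[OF assms])
    fix i assume "- lo (mirror p) (mirror q) \<le> i"
    then have "fst (mirror p) (- 1 - i) = fst (mirror q) (- 1 - i)"
      using assms by (intro agree_below) auto
    then show "fst p i = fst q i" by simp
  qed (use lo_le[of "mirror p" "mirror q"] assms in auto)
  then show "lo (mirror p) (mirror q) \<le> - hi p q" by simp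
qed

lemma hi_mirror:
  assumes "fd p q" shows "hi (mirror p) (mirror q) = - lo p q"
  using lo_mirror[of "mirror p" "mirror q"] assms by simp

lemma wd_mirror [simp]: "fd p q \<Longrightarrow> wd (mirror p) (mirror q) = wd p q"
  by (simp add: wd_def lo_mirror hi_mirror)

section \<open>Counting states in boxes and balls\<close>

definition box :: "'a set \<Rightarrow> 'a \<Rightarrow> int \<Rightarrow> int \<Rightarrow> (int \<Rightarrow> 'a) \<Rightarrow> (int \<Rightarrow> 'a) \<Rightarrow> 'a state set" where
  "box A z l u \<alpha> \<gamma> = {q \<in> states A z. l \<le> snd q \<and> snd q \<le> u \<and>
     (\<forall>i<l. fst q i = \<alpha> i) \<and> (\<forall>i\<ge>u. fst q i = \<gamma> i)}"

lemma box_card: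
  assumes "finite A" "l \<le> u"
  shows "finite (box A z l u \<alpha> \<gamma>)"
    and "card (box A z l u \<alpha> \<gamma>) \<le> (nat (u - l) + 1) * card A ^ nat (u - l)"
proof -
  let ?f = "\<lambda>q. (restrict (fst q) {l..<u}, snd q)"
  let ?T = "(PiE {l..<u} (\<lambda>_. A)) \<times> {l..u}"
  have inj: "inj_on ?f (box A z l u \<alpha> \<gamma>)"
  proof (rule inj_onI)
    fix p q assume pq: "p \<in> box A z l u \<alpha> \<gamma>" "q \<in> box A z l u \<alpha> \<gamma>" "?f p = ?f q"
    have "fst p i = fst q i" for i
    proof -
      have "restrict (fst p) {l..<u} i = restrict (fst q) {l..<u} i" using pq(3) by simp
      then show ?thesis using pq(1,2) by (cases "i < l"; cases "i < u") (auto simp: box_def)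
    qed
    then show "p = q" using pq(3) by (auto simp: prod_eq_iff)
  qed
  have sub: "?f ` box A z l u \<alpha> \<gamma> \<subseteq> ?T"
    by (auto simp: box_def states_def)
  have fT: "finite ?T" using assms by (auto intro!: finite_PiE)
  show "finite (box A z l u \<alpha> \<gamma>)"
    using inj sub fT by (meson finite_imageD finite_subset)
  have "card (box A z l u \<alpha> \<gamma>) \<le> card ?T" by (rule card_inj_on_le[OF inj sub fT])
  also have "\<dots> = (nat (u - l) + 1) * card A ^ nat (u - l)"
  proof -
    have "card {l..u} = nat (u - l) + 1" using assms(2) by simp
    then show ?thesis by (simp only: card_cartesian_product card_PiE finite_atLeastLessThan_int)
        (simp add: mult.commute)
  qed
  finally show "card (box A z l u \<alpha> \<gamma>) \<le> (nat (u - l) + 1) * card A ^ nat (u - l)" .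
qed

definition ball :: "'a set \<Rightarrow> 'a \<Rightarrow> 'a state \<Rightarrow> nat \<Rightarrow> 'a state set" where
  "ball A z p r = {q \<in> states A z. wd p q \<le> int r}"

text \<open>A state within distance \<open>r\<close> lies in a box of length \<open>r\<close> whose
  lower end is one of the \<open>r + 1\<close> integers from \<open>snd p - r\<close> to
  \<open>snd p\<close>. Only the exponential rate \<open>card A ^ r\<close> matters later; the
  polynomial factor is always absorbed.\<close>

lemma ball_card:
  assumes "finite A" "p \<in> states A z"
  shows "finite (ball A z p r)" "card (ball A z p r) \<le> (r + 1)^2 * card A ^ r"
proof -
  let ?B = "\<lambda>l. box A z l (l + int r) (fst p) (fst p)"
  have "ball A z p r \<subseteq> (\<Union>l\<in>{snd p - int r..snd p}. ?B l)"
  proof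
    fix q assume q: "q \<in> ball A z p r"
    then have fd: "fd p q" using states_fd[OF assms(2)] by (auto simp: ball_def)
    have "hi p q \<le> lo p q + int r" using q by (simp add: ball_def wd_def)
    moreover from this have "q \<in> ?B (lo p q)"
      using q lo_le[OF fd] hi_ge[OF fd] agree_below[OF fd] agree_above[OF fd]
      by (auto simp: box_def ball_def)
    ultimately show "q \<in> (\<Union>l\<in>{snd p - int r..snd p}. ?B l)"
      using lo_le[OF fd] hi_ge[OF fd] by (intro UN_I[of "lo p q"]) auto
  qed
  moreover have fin: "finite (\<Union>l\<in>{snd p - int r..snd p}. ?B l)"
    using box_card(1)[OF assms(1)] by simp
  ultimately show "finite (ball A z p r)" by (rule finite_subset)
  have "card (ball A z p r) \<le> card (\<Union>l\<in>{snd p - int r..snd p}. ?B l)"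
    by (rule card_mono[OF fin]) fact
  also have "\<dots> \<le> (\<Sum>l\<in>{snd p - int r..snd p}. card (?B l))"
    by (rule card_UN_le) simp
  also have "\<dots> \<le> (\<Sum>l\<in>{snd p - int r..snd p}. (r + 1) * card A ^ r)"
  proof (rule sum_mono)
    fix l
    show "card (?B l) \<le> (r + 1) * card A ^ r"
      using box_card(2)[OF assms(1), of l "l + int r" z "fst p" "fst p"] by simp
  qed
  also have "\<dots> = (r + 1)^2 * card A ^ r"
    by (simp add: power2_eq_square algebra_simps nat_add_distrib)
  finally show "card (ball A z p r) \<le> (r + 1)^2 * card A ^ r" .
qed

section \<open>Walks and averages over words\<close>

fun up :: "'a state \<Rightarrow> 'a list \<Rightarrow> 'a state" where
  "up p [] = p"
| "up p (y # ys) = up ((fst p)(snd p := y), snd p + 1) ys"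

lemma snd_up [simp]: "snd (up p ys) = snd p + int (length ys)"
  by (induction p ys rule: up.induct) auto

lemma fst_up: "fst (up p ys) i =
  (if snd p \<le> i \<and> i < snd p + int (length ys) then ys ! nat (i - snd p) else fst p i)"
proof (induction p ys rule: up.induct)
  case (2 p y ys)
  have "nat (i - snd p) = Suc (nat (i - (snd p + 1)))" if "snd p + 1 \<le> i" using that by simp
  then show ?case using 2 by auto
qed auto

lemma up_append: "up p (xs @ ys) = up (up p xs) ys"
  by (induction p xs rule: up.induct) auto

lemma up_fd: "fd p (up p ys)"
proof -
  have "{i. fst p i \<noteq> fst (up p ys) i} \<subseteq> {snd p..<snd p + int (length ys)}"
    by (auto simp: fst_up split: if_splits)
  then show ?thesis unfolding fd_def by (rule finite_subset) simp
qed

lemma up_states: "p \<in> states A z \<Longrightarrow> set ys \<subseteq> A \<Longrightarrow> up p ys \<in> states A z"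
proof (induction p ys rule: up.induct)
  case (2 p y ys)
  have "{i. ((fst p)(snd p := y)) i \<noteq> z} \<subseteq> insert (snd p) {i. fst p i \<noteq> z}" by auto
  then have "finite {i. ((fst p)(snd p := y)) i \<noteq> z}"
    by (rule finite_subset) (use 2(2) in \<open>simp add: states_def\<close>)
  with 2 show ?case by (auto simp: states_def)
qed simp

lemma wd_up: "wd p (up p ys) \<le> int (length ys)"
  using wd_le[OF up_fd, of "snd p" p ys "snd p + int (length ys)"] by (simp add: fst_up)

text \<open>The walk forgets what it overwrites. This is the bridge between starting points that
  differ only inside the window: their walks with the same word have a common end.\<close>

lemma up_cong:
  assumes "snd p = snd p'" "length ys = R"
    "\<And>i. i < snd p \<or> snd p + int R \<le> i \<Longrightarrow> fst p i = fst p' i"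
  shows "up p ys = up p' ys"
  using assms by (intro prod_eqI ext) (auto simp: fst_up)

lemma up_inj:
  assumes "up p xs = up p ys" "length xs = length ys"
  shows "xs = ys"
proof (rule nth_equalityI)
  fix k assume k: "k < length xs"
  have "fst (up p xs) (snd p + int k) = fst (up p ys) (snd p + int k)" using assms by simp
  then show "xs ! k = ys ! k" using k assms(2) by (simp add: fst_up)
qed fact

section \<open>Uniform averages over words of a fixed length\<close>

definition words :: "'a set \<Rightarrow> nat \<Rightarrow> 'a list set" where
  "words A R = {ys. set ys \<subseteq> A \<and> length ys = R}"

definition avg :: "'a set \<Rightarrow> nat \<Rightarrow> ('a list \<Rightarrow> real) \<Rightarrow> real" where
  "avg A R \<phi> = (\<Sum>ys\<in>words A R. \<phi> ys) / real (card A) ^ R"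

definition frac :: "'a set \<Rightarrow> nat \<Rightarrow> ('a list \<Rightarrow> bool) \<Rightarrow> real" where
  "frac A R P = avg A R (\<lambda>ys. of_bool (P ys))"

lemma words_card: "finite A \<Longrightarrow> card (words A R) = card A ^ R" "finite A \<Longrightarrow> finite (words A R)"
  by (simp_all add: words_def card_lists_length_eq finite_lists_length_eq)

lemma words_append: "words A (a + b) = (\<lambda>(us, vs). us @ vs) ` (words A a \<times> words A b)"
proof (intro equalityI subsetI)
  fix ys assume "ys \<in> words A (a + b)"
  then have "take a ys \<in> words A a" "drop a ys \<in> words A b"
    using set_take_subset[of a ys] set_drop_subset[of a ys] by (auto simp: words_def)
  then show "ys \<in> (\<lambda>(us, vs). us @ vs) ` (words A a \<times> words A b)"
    by (intro image_eqI[of _ _ "(take a ys, drop a ys)"]) auto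
qed (auto simp: words_def)

lemma words_take: "ys \<in> words A (a + b) \<Longrightarrow> take a ys \<in> words A a"
  and words_drop: "ys \<in> words A (a + b) \<Longrightarrow> drop a ys \<in> words A b"
  using set_take_subset[of a ys] set_drop_subset[of a ys] by (auto simp: words_def)

text \<open>Conditioning: a random word is a random prefix followed by an independent random
  suffix.\<close>

lemma avg_append: "avg A (a + b) \<phi> = avg A a (\<lambda>us. avg A b (\<lambda>vs. \<phi> (us @ vs)))"
proof -
  have inj: "inj_on (\<lambda>(us, vs). us @ vs) (words A a \<times> words A b)"
    by (auto simp: inj_on_def words_def)
  have "(\<Sum>ys\<in>words A (a + b). \<phi> ys) = (\<Sum>us\<in>words A a. \<Sum>vs\<in>words A b. \<phi> (us @ vs))"
    unfolding words_append sum.reindex[OF inj] sum.cartesian_product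
    by (simp add: case_prod_beta comp_def)
  then show ?thesis by (simp add: avg_def power_add sum_divide_distrib mult.commute)
qed

lemma avg_mono: "(\<And>ys. ys \<in> words A R \<Longrightarrow> \<phi> ys \<le> \<psi> ys) \<Longrightarrow> avg A R \<phi> \<le> avg A R \<psi>"
  unfolding avg_def by (intro divide_right_mono sum_mono) auto

lemma avg_cong: "(\<And>ys. ys \<in> words A R \<Longrightarrow> \<phi> ys = \<psi> ys) \<Longrightarrow> avg A R \<phi> = avg A R \<psi>"
  unfolding avg_def by (intro arg_cong2[of _ _ _ _ "(/)"] sum.cong) auto

lemma avg_add: "avg A R (\<lambda>ys. \<phi> ys + \<psi> ys) = avg A R \<phi> + avg A R \<psi>"
  by (simp add: avg_def sum.distrib add_divide_distrib)

lemma avg_cmult: "avg A R (\<lambda>ys. c * \<phi> ys) = c * avg A R \<phi>"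
  by (simp add: avg_def sum_distrib_left)

lemma avg_sum: "avg A R (\<lambda>ys. \<Sum>i\<in>I. \<phi> i ys) = (\<Sum>i\<in>I. avg A R (\<phi> i))"
  by (simp add: avg_def sum.swap[of _ I] sum_divide_distrib)

lemma frac_card: "frac A R P = real (card {ys \<in> words A R. P ys}) / real (card A) ^ R"
proof (cases "finite (words A R)")
  case True
  then show ?thesis by (simp add: frac_def avg_def Int_def)
next
  case False
  then have "infinite A" using words_card(2) by blast
  moreover have "R \<noteq> 0" using False by (auto simp: words_def)
  ultimately show ?thesis by (simp add: frac_def avg_def)
qed

lemma frac_mono: "(\<And>ys. ys \<in> words A R \<Longrightarrow> P ys \<Longrightarrow> Q ys) \<Longrightarrow> frac A R P \<le> frac A R Q"
  unfolding frac_def by (intro avg_mono) auto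

lemma frac_nonneg: "0 \<le> frac A R P"
  unfolding frac_def avg_def by (intro divide_nonneg_nonneg sum_nonneg) auto

lemma frac_Un: "frac A R (\<lambda>ys. P ys \<or> Q ys) \<le> frac A R P + frac A R Q"
  unfolding frac_def avg_add[symmetric] by (intro avg_mono) auto

lemma frac_pos: "0 < frac A R P \<Longrightarrow> \<exists>ys\<in>words A R. P ys"
proof (rule ccontr)
  assume *: "0 < frac A R P" "\<not> (\<exists>ys\<in>words A R. P ys)"
  then have "frac A R P \<le> frac A R (\<lambda>_. False)" by (intro frac_mono) auto
  with * show False by (simp add: frac_def avg_def)
qed

context
  fixes A :: "'a set"
  assumes A: "finite A" "A \<noteq> {}"
begin

lemma avg_const: "avg A R (\<lambda>_. c) = c"
  using A by (simp add: avg_def words_card)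

lemma avg_take: "avg A (a + b) (\<lambda>ys. \<psi> (take a ys)) = avg A a \<psi>"
proof -
  have "avg A (a + b) (\<lambda>ys. \<psi> (take a ys)) = avg A a (\<lambda>us. avg A b (\<lambda>vs. \<psi> us))"
    unfolding avg_append by (intro avg_cong) (auto simp: words_def)
  then show ?thesis by (simp add: avg_const)
qed

lemma avg_le: "(\<And>ys. ys \<in> words A R \<Longrightarrow> \<phi> ys \<le> c) \<Longrightarrow> avg A R \<phi> \<le> c"
  using avg_mono[of A R \<phi> "\<lambda>_. c"] by (simp add: avg_const)

lemma avg_ge: "(\<And>ys. ys \<in> words A R \<Longrightarrow> c \<le> \<phi> ys) \<Longrightarrow> c \<le> avg A R \<phi>"
  using avg_mono[of A R "\<lambda>_. c" \<phi>] by (simp add: avg_const)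

lemma frac_compl: "frac A R (\<lambda>ys. \<not> P ys) = 1 - frac A R P"
proof -
  have "frac A R (\<lambda>ys. \<not> P ys) + frac A R P = avg A R (\<lambda>_. 1)"
    unfolding frac_def avg_add[symmetric] by (intro avg_cong) auto
  then show ?thesis by (simp add: avg_const)
qed

lemma frac_Int: "frac A R P + frac A R Q - 1 \<le> frac A R (\<lambda>ys. P ys \<and> Q ys)"
proof -
  have "frac A R P + frac A R Q \<le> avg A R (\<lambda>ys. 1 + of_bool (P ys \<and> Q ys))"
    unfolding frac_def avg_add[symmetric] by (intro avg_mono) auto
  then show ?thesis by (simp add: avg_add avg_const frac_def)
qed

lemma markov:
  assumes "0 < c" "\<And>ys. ys \<in> words A R \<Longrightarrow> 0 \<le> \<phi> ys"
  shows "frac A R (\<lambda>ys. c \<le> \<phi> ys) \<le> avg A R \<phi> / c"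
proof -
  have "avg A R (\<lambda>ys. c * of_bool (c \<le> \<phi> ys)) \<le> avg A R \<phi>"
    using assms by (intro avg_mono) auto
  then show ?thesis using assms(1) by (simp add: frac_def avg_cmult field_simps)
qed

lemma avg_ge_frac:
  assumes "0 \<le> c" "\<And>ys. ys \<in> words A R \<Longrightarrow> 0 \<le> \<phi> ys"
  shows "c * frac A R (\<lambda>ys. c \<le> \<phi> ys) \<le> avg A R \<phi>"
  unfolding frac_def avg_cmult[symmetric] using assms by (intro avg_mono) auto

end

text \<open>The common end of all counting arguments below: their error terms are a polynomial in
  the length times a decaying exponential.\<close>

lemma power_exp_decay:
  fixes a b c C :: real
  assumes "0 < c" "0 < \<eta>"
  shows "\<exists>R0. \<forall>R\<ge>R0. C * (a * real R + b) ^ k * exp (- c * real R) \<le> \<eta>"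
proof -
  define g where "g = (\<lambda>R::nat. (c * real R) ^ k / exp (c * real R))"
  have "filterlim (\<lambda>R::nat. c * real R) at_top sequentially"
    by (rule filterlim_tendsto_pos_mult_at_top[OF tendsto_const assms(1) filterlim_real_sequentially])
  from filterlim_compose[OF tendsto_power_div_exp_0 this]
  have lim: "g \<longlonglongrightarrow> 0" unfolding g_def .
  \<comment> \<open>For \<open>R \<ge> 1\<close> the linear polynomial is at most a multiple of
    \<open>c * R\<close>, which reduces the claim to the limit of \<open>x ^ k / exp x\<close>. The
    added 1 keeps \<open>D\<close> positive for the division.\<close>
  define D where "D = \<bar>C\<bar> * ((\<bar>a\<bar> + \<bar>b\<bar>) / c) ^ k + 1"
  have D: "D > 0" unfolding D_def using assms(1)
    by (intro add_nonneg_pos mult_nonneg_nonneg) auto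
  have "\<eta> / D > 0" using D assms(2) by simp
  from order_tendstoD(2)[OF lim this]
  obtain R0 where R0: "\<And>R. R \<ge> R0 \<Longrightarrow> g R < \<eta> / D" unfolding eventually_sequentially by blast
  show ?thesis
  proof (rule exI[of _ "max R0 1"], intro allI impI)
    fix R assume R: "max R0 1 \<le> R"
    have "\<bar>a * real R + b\<bar> \<le> \<bar>a\<bar> * real R + \<bar>b\<bar> * 1"
      using abs_triangle_ineq[of "a * real R" b] by (simp add: abs_mult)
    also have "\<dots> \<le> \<bar>a\<bar> * real R + \<bar>b\<bar> * real R"
      using R by (intro add_left_mono mult_left_mono) auto
    also have "\<dots> = (\<bar>a\<bar> + \<bar>b\<bar>) / c * (c * real R)" using assms(1) by (simp add: field_simps)
    finally have "\<bar>a * real R + b\<bar> ^ k \<le> ((\<bar>a\<bar> + \<bar>b\<bar>) / c * (c * real R)) ^ k"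
      by (rule power_mono) simp
    then have 1: "\<bar>a * real R + b\<bar> ^ k \<le> ((\<bar>a\<bar> + \<bar>b\<bar>) / c) ^ k * (c * real R) ^ k"
      by (simp only: power_mult_distrib)
    have "C * (a * real R + b) ^ k * exp (- c * real R)
        \<le> \<bar>C\<bar> * \<bar>a * real R + b\<bar> ^ k * exp (- c * real R)"
    proof (rule mult_right_mono)
      have "C * (a * real R + b) ^ k \<le> \<bar>C * (a * real R + b) ^ k\<bar>" by simp
      then show "C * (a * real R + b) ^ k \<le> \<bar>C\<bar> * \<bar>a * real R + b\<bar> ^ k"
        by (simp add: abs_mult power_abs)
    qed simp
    also have "\<dots> \<le> \<bar>C\<bar> * (((\<bar>a\<bar> + \<bar>b\<bar>) / c) ^ k * (c * real R) ^ k) * exp (- c * real R)"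
      by (intro mult_right_mono mult_left_mono 1) auto
    also have "\<dots> = \<bar>C\<bar> * ((\<bar>a\<bar> + \<bar>b\<bar>) / c) ^ k * g R"
      by (simp add: g_def exp_minus field_simps)
    also have "\<dots> \<le> D * g R"
      using assms(1) by (intro mult_right_mono) (auto simp: D_def g_def)
    also have "\<dots> \<le> \<eta>" using R0[of R] R D by (simp add: field_simps)
    finally show "C * (a * real R + b) ^ k * exp (- c * real R) \<le> \<eta>" .
  qed
qed

section \<open>Quasi-isometries of lamp states\<close>

text \<open>A single integer \<open>K\<close> is the multiplicative constant, the additive constant
  and the constant of coarse surjectivity. Both sides carry the metric \<open>wd\<close>; word
  metrics enter again only at the very end.\<close>

locale lamp_qi =
  fixes A :: "'a set" and a0 :: 'a and B :: "'b set" and b0 :: 'b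
    and f :: "'a state \<Rightarrow> 'b state" and K :: int
  assumes finA: "finite A" and a0: "a0 \<in> A" and finB: "finite B" and b0: "b0 \<in> B"
    and K: "1 \<le> K"
    and f_in: "p \<in> states A a0 \<Longrightarrow> f p \<in> states B b0"
    and f_le: "p \<in> states A a0 \<Longrightarrow> q \<in> states A a0 \<Longrightarrow> wd (f p) (f q) \<le> K * wd p q + K"
    and f_ge: "p \<in> states A a0 \<Longrightarrow> q \<in> states A a0 \<Longrightarrow> wd p q \<le> K * wd (f p) (f q) + K"
    and f_onto: "s \<in> states B b0 \<Longrightarrow> \<exists>p\<in>states A a0. wd (f p) s \<le> K"
begin

abbreviation "SA \<equiv> states A a0"
abbreviation "SB \<equiv> states B b0"

lemma Ane: "A \<noteq> {}" "card A \<ge> 1" and Bne: "B \<noteq> {}" "card B \<ge> 1"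
  using a0 b0 finA finB by (auto simp: Suc_le_eq card_gt_0_iff)

text \<open>Bounds for balls of radius \<open>K\<close>. States with equal images are at distance at
  most \<open>K\<close>, so \<open>mult_dom\<close> bounds the fibres of \<open>f\<close>, and
  \<open>mult_cod\<close> bounds how many states one image point can cover. With them cardinalities
  can be compared through \<open>f\<close> in both directions.\<close>

definition mult_dom :: nat where "mult_dom = (nat K + 1)^2 * card A ^ nat K"
definition mult_cod :: nat where "mult_cod = (nat K + 1)^2 * card B ^ nat K"

lemma card_preimage:
  assumes "finite S" "Z \<subseteq> SA" "f ` Z \<subseteq> S"
  shows "finite Z" "card Z \<le> mult_dom * card S"
proof -
  have fib: "finite {z\<in>Z. f z = s} \<and> card {z\<in>Z. f z = s} \<le> mult_dom" for s
  proof (cases "{z\<in>Z. f z = s} = {}")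
    case True
    then show ?thesis by (simp only: True) simp
  next
    case False
    then obtain z0 where z0: "z0 \<in> Z" "f z0 = s" by blast
    then have "z0 \<in> SA" using assms by auto
    have "{z\<in>Z. f z = s} \<subseteq> ball A a0 z0 (nat K)"
    proof
      fix z assume "z \<in> {z\<in>Z. f z = s}"
      then have "z \<in> SA" "f z = f z0" using z0 assms(2) by auto
      then show "z \<in> ball A a0 z0 (nat K)"
        using f_ge[OF \<open>z0 \<in> SA\<close> \<open>z \<in> SA\<close>] K by (simp add: ball_def)
    qed
    with ball_card[OF finA \<open>z0 \<in> SA\<close>, of "nat K"] show ?thesis
      unfolding mult_dom_def by (meson card_mono finite_subset le_trans)
  qed
  have Z: "Z = (\<Union>s\<in>S. {z\<in>Z. f z = s})" using assms(3) by auto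
  show "finite Z" by (subst Z) (use assms(1) fib in auto)
  have "card Z \<le> (\<Sum>s\<in>S. card {z\<in>Z. f z = s})"
    by (subst Z) (rule card_UN_le[OF assms(1)])
  also have "\<dots> \<le> (\<Sum>s\<in>S. mult_dom)" using fib by (intro sum_mono) blast
  finally show "card Z \<le> mult_dom * card S" by (simp add: mult.commute)
qed

lemma card_cover:
  assumes "finite Z" "Z \<subseteq> SA" "Q \<subseteq> SB" "\<And>q. q \<in> Q \<Longrightarrow> \<exists>z\<in>Z. wd (f z) q \<le> K"
  shows "finite Q" "card Q \<le> mult_cod * card Z"
proof -
  have sub: "Q \<subseteq> (\<Union>z\<in>Z. ball B b0 (f z) (nat K))"
  proof
    fix q assume q: "q \<in> Q"
    then obtain z where "z \<in> Z" "wd (f z) q \<le> K" using assms(4) by blast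
    then show "q \<in> (\<Union>z\<in>Z. ball B b0 (f z) (nat K))"
      using q assms(3) K by (intro UN_I[of z]) (auto simp: ball_def)
  qed
  have b: "finite (ball B b0 (f z) (nat K))" "card (ball B b0 (f z) (nat K)) \<le> mult_cod"
    if "z \<in> Z" for z
    using ball_card[OF finB f_in, of z "nat K"] assms(2) that unfolding mult_cod_def by auto
  then have fin: "finite (\<Union>z\<in>Z. ball B b0 (f z) (nat K))" using assms(1) by auto
  then show "finite Q" using sub finite_subset by blast
  have "card Q \<le> card (\<Union>z\<in>Z. ball B b0 (f z) (nat K))" by (rule card_mono[OF fin sub])
  also have "\<dots> \<le> (\<Sum>z\<in>Z. card (ball B b0 (f z) (nat K)))" by (rule card_UN_le[OF assms(1)])
  also have "\<dots> \<le> (\<Sum>z\<in>Z. mult_cod)" using b by (intro sum_mono) auto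
  finally show "card Q \<le> mult_cod * card Z" by (simp add: mult.commute)
qed

lemma words_up: "p \<in> SA \<Longrightarrow> ys \<in> words A R \<Longrightarrow> up p ys \<in> SA"
  by (auto simp: words_def intro: up_states)

lemma card_words_preimage:
  assumes "p \<in> SA" "finite S" "Y \<subseteq> words A R" "\<And>ys. ys \<in> Y \<Longrightarrow> f (up p ys) \<in> S"
  shows "card Y \<le> mult_dom * card S"
proof -
  have "inj_on (up p) Y"
  proof (rule inj_onI)
    fix xs ys assume "xs \<in> Y" "ys \<in> Y" "up p xs = up p ys"
    then show "xs = ys" using assms(3) up_inj[of p xs ys] by (auto simp: words_def)
  qed
  then have "card Y = card (up p ` Y)" by (simp add: card_image)
  also have "\<dots> \<le> mult_dom * card S"
    using assms(2,4) words_up[OF assms(1)] assms(3) by (intro card_preimage) blast+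
  finally show ?thesis .
qed

abbreviation wdf :: "'a state \<Rightarrow> 'a state \<Rightarrow> real" where
  "wdf p q \<equiv> real_of_int (wd (f p) (f q))"

lemma ffd: "p \<in> SA \<Longrightarrow> q \<in> SA \<Longrightarrow> fd (f p) (f q)"
  by (rule states_fd[OF f_in f_in])

text \<open>Different words lead to different states and \<open>f\<close> is boundedly many to one,
  but a ball of radius \<open>s * R\<close> around \<open>f p\<close> has only about
  \<open>card B ^ (s * R)\<close> elements, an exponentially small part of
  \<open>card A ^ R\<close>. The bound does not depend on \<open>p\<close>, which becomes decisive
  in \<open>heads\<close>.\<close>

lemma typical_lower:
  assumes "0 \<le> s" "s * ln (real (card B)) < ln (real (card A))" "0 < \<eta>"
  shows "\<exists>R0. \<forall>R\<ge>R0. \<forall>p\<in>SA. frac A R (\<lambda>ys. wdf p (up p ys) < s * real R) \<le> \<eta>"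
proof -
  define c where "c = ln (real (card A)) - s * ln (real (card B))"
  have c: "c > 0" using assms(2) by (simp add: c_def)
  obtain R0 where R0: "\<And>R. R \<ge> R0 \<Longrightarrow> real mult_dom * (s * real R + 1) ^ 2 * exp (- c * real R) \<le> \<eta>"
    using power_exp_decay[OF c assms(3)] by blast
  have "frac A R (\<lambda>ys. wdf p (up p ys) < s * real R) \<le> \<eta>" if R: "R \<ge> R0" and p: "p \<in> SA" for R p
  proof -
    define \<rho> where "\<rho> = nat \<lfloor>s * real R\<rfloor>"
    have \<rho>: "real \<rho> \<le> s * real R" using assms(1) by (simp add: \<rho>_def)
    let ?Y = "{ys \<in> words A R. wdf p (up p ys) < s * real R}"
    have "card ?Y \<le> mult_dom * card (ball B b0 (f p) \<rho>)"
    proof (rule card_words_preimage[OF p, of _ _ R])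
      show "finite (ball B b0 (f p) \<rho>)" using ball_card(1)[OF finB f_in[OF p]] .
      fix ys assume "ys \<in> ?Y"
      then have "wd (f p) (f (up p ys)) \<le> \<lfloor>s * real R\<rfloor>" "up p ys \<in> SA"
        using words_up[OF p] by (auto simp: le_floor_iff)
      then show "f (up p ys) \<in> ball B b0 (f p) \<rho>"
        using f_in[of "up p ys"] wd_nonneg[OF ffd[OF p, of "up p ys"]] assms(1) by (auto simp: ball_def \<rho>_def)
    qed auto
    also have "\<dots> \<le> mult_dom * ((\<rho> + 1)^2 * card B ^ \<rho>)"
      using ball_card(2)[OF finB f_in[OF p]] by (intro mult_left_mono) auto
    finally have "real (card ?Y) \<le> real (mult_dom * ((\<rho> + 1)^2 * card B ^ \<rho>))"
      by (simp only: of_nat_le_iff)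
    also have "\<dots> = real mult_dom * ((real \<rho> + 1)^2 * real (card B) ^ \<rho>)"
      by (simp add: add.commute)
    also have "\<dots> \<le> real mult_dom * ((s * real R + 1)^2 * exp (s * real R * ln (real (card B))))"
    proof -
      have "real (card B) ^ \<rho> = exp (real \<rho> * ln (real (card B)))"
        using Bne(2) by (simp add: exp_of_nat_mult)
      also have "\<dots> \<le> exp (s * real R * ln (real (card B)))"
        using \<rho> Bne(2) by (intro exp_le_cancel_iff[THEN iffD2] mult_right_mono) auto
      finally show ?thesis using \<rho> by (intro mult_left_mono mult_mono power_mono) auto
    qed
    finally have Y: "real (card ?Y) \<le> real mult_dom * ((s * real R + 1)^2 * exp (s * real R * ln (real (card B))))" .
    have mR: "real (card A) ^ R = exp (real R * ln (real (card A)))"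
      using Ane(2) by (simp add: exp_of_nat_mult)
    have "frac A R (\<lambda>ys. wdf p (up p ys) < s * real R)
        \<le> real mult_dom * ((s * real R + 1)^2 * exp (s * real R * ln (real (card B)))) / real (card A) ^ R"
      unfolding frac_card by (intro divide_right_mono Y) simp
    also have "\<dots> = real mult_dom * (s * real R + 1)^2 * exp (- c * real R)"
    proof -
      have "- c * real R = s * real R * ln (real (card B)) - real R * ln (real (card A))"
        by (simp add: c_def algebra_simps)
      then have "exp (- c * real R) = exp (s * real R * ln (real (card B))) / exp (real R * ln (real (card A)))"
        by (simp only: exp_diff)
      then show ?thesis by (simp only: mR times_divide_eq_right mult.assoc)
    qed
    also have "\<dots> \<le> \<eta>" by (rule R0[OF R])
    finally show ?thesis .
  qed
  then show ?thesis by blast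
qed

end

section \<open>Efficient paths are monotone\<close>

abbreviation pos :: "'a state \<Rightarrow> real" where "pos p \<equiv> real_of_int (snd p)"
abbreviation rlo :: "'a state \<Rightarrow> 'a state \<Rightarrow> real" where "rlo p q \<equiv> real_of_int (lo p q)"
abbreviation rhi :: "'a state \<Rightarrow> 'a state \<Rightarrow> real" where "rhi p q \<equiv> real_of_int (hi p q)"
abbreviation rwd :: "'a state \<Rightarrow> 'a state \<Rightarrow> real" where "rwd p q \<equiv> real_of_int (wd p q)"

text \<open>Nearly linear upward motion of the head through the hull of the two end states, with
  final lamps behind it and initial lamps ahead of it. The head at the two end times is only
  controlled up to one step \<open>u\<close>, since within the first or last step the path may turn
  back once.\<close>

definition rising :: "(nat \<Rightarrow> 'a state) \<Rightarrow> nat \<Rightarrow> real \<Rightarrow> real \<Rightarrow> bool" where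
  "rising P N u w \<longleftrightarrow>
     pos (P 0) \<le> rlo (P 0) (P N) + u + w \<and>
     rlo (P 0) (P N) + (real N - 1) * u - w \<le> pos (P N) \<and>
     rwd (P 0) (P N) \<le> real N * u + w \<and>
     (\<forall>i. 1 \<le> i \<and> i < N \<longrightarrow>
        \<bar>pos (P i) - (rlo (P 0) (P N) + u * real i)\<bar> \<le> w \<and>
        (\<forall>j. real_of_int j < rlo (P 0) (P N) + u * real i - w \<longrightarrow> fst (P i) j = fst (P N) j) \<and>
        (\<forall>j. rlo (P 0) (P N) + u * real i + w \<le> real_of_int j \<longrightarrow> fst (P i) j = fst (P 0) j))"

lemma wd_chain:
  fixes P :: "nat \<Rightarrow> 'a state"
  assumes fd: "\<And>i j. i \<le> N \<Longrightarrow> j \<le> N \<Longrightarrow> fd (P i) (P j)"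
    and step: "\<And>i. i < N \<Longrightarrow> rwd (P i) (P (Suc i)) \<le> v"
    and ij: "i \<le> j" "j \<le> N"
  shows "rwd (P i) (P j) \<le> v * (real j - real i)"
  using ij
proof (induction j rule: dec_induct)
  case base
  then show ?case by simp
next
  case (step j)
  have "wd (P i) (P (Suc j)) \<le> wd (P i) (P j) + wd (P j) (P (Suc j))"
    using step by (intro wd_triangle fd) auto
  then have "rwd (P i) (P (Suc j)) \<le> rwd (P i) (P j) + rwd (P j) (P (Suc j))"
    by linarith
  then show ?case using step assms(2)[of j] by (simp add: algebra_simps)
qed

text \<open>The hulls of \<open>P 0, P i\<close> and of \<open>P i, P N\<close> must cover the hull
  of \<open>P 0, P N\<close>, although their lengths add up to hardly more than its length. So they
  overlap only in an interval of length of order \<open>N * \<theta>\<close>, and the head at time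
  \<open>i\<close> lies in both. Which hull is the lower one is fixed at the middle time by
  \<open>mid\<close>.\<close>

lemma rising_aux:
  fixes P :: "nat \<Rightarrow> 'a state" and u \<theta> :: real
  assumes fd: "\<And>i j. i \<le> N \<Longrightarrow> j \<le> N \<Longrightarrow> fd (P i) (P j)"
    and step: "\<And>i. i < N \<Longrightarrow> rwd (P i) (P (Suc i)) \<le> u + \<theta>"
    and total: "real N * (u - \<theta>) \<le> rwd (P 0) (P N)"
    and N: "4 \<le> N" and th: "0 \<le> \<theta>" "4 * real N * \<theta> < u"
    and mid: "rlo (P 0) (P (N div 2)) \<le> rlo (P 0) (P N)" "rhi (P 0) (P N) \<le> rhi (P (N div 2)) (P N)"
  shows "rising P N u (2 * real N * \<theta>)"
proof -
  define a where "a = rlo (P 0) (P N)"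
  define b where "b = rhi (P 0) (P N)"
  have ab: "real N * u - real N * \<theta> \<le> b - a"
    using total by (simp add: a_def b_def wd_def algebra_simps)
  have ab2: "b - a \<le> real N * u + real N * \<theta>"
    using wd_chain[of N P "u + \<theta>" 0 N, OF fd step] by (simp add: a_def b_def wd_def algebra_simps)
  have chain: "rwd (P i) (P j) \<le> u * real j - u * real i + \<theta> * real j - \<theta> * real i"
    if "i \<le> j" "j \<le> N" for i j
    using wd_chain[of N P "u + \<theta>" i j, OF fd step that] by (simp add: algebra_simps)
  have u0: "0 < u" using th N by (smt (verit) mult_nonneg_nonneg of_nat_0_le_iff)
  have iN: "\<theta> * real i \<le> real N * \<theta>" "0 \<le> \<theta> * real i" if "i \<le> N" for i
    using that th(1) mult_left_mono[of "real i" "real N" \<theta>] by (auto simp: mult.commute)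
  have th1: "16 * \<theta> < u"
    using th N mult_right_mono[of 4 "real N" \<theta>] by simp
  define NU where "NU = u * real N"
  note fo = NU_def[symmetric]
  have hull: "rlo (P i) (P j) \<le> pos (P i)" "rlo (P i) (P j) \<le> pos (P j)"
     "pos (P i) \<le> rhi (P i) (P j)" "pos (P j) \<le> rhi (P i) (P j)"
     "rwd (P i) (P j) = rhi (P i) (P j) - rlo (P i) (P j)" if "i \<le> N" "j \<le> N" for i j
    using lo_le[OF fd[OF that]] hi_ge[OF fd[OF that]] by (simp_all add: wd_def)
  have p0: "a \<le> pos (P 0)" "pos (P 0) \<le> b" "a \<le> pos (P N)" "pos (P N) \<le> b"
    using hull[of 0 N] by (simp_all add: a_def b_def)
  \<comment> \<open>Neither of the two hulls is long enough to contain both ends \<open>a\<close>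
    and \<open>b\<close>, so each takes one end.\<close>
  have split: "(rlo (P 0) (P i) \<le> a \<and> b \<le> rhi (P i) (P N)) \<or> (rlo (P i) (P N) \<le> a \<and> b \<le> rhi (P 0) (P i))"
    if i: "1 \<le> i" "i < N" for i
  proof -
    have t: "min (lo (P 0) (P i)) (lo (P i) (P N)) \<le> lo (P 0) (P N)"
       "hi (P 0) (P N) \<le> max (hi (P 0) (P i)) (hi (P i) (P N))"
      using hull_triangle[OF fd fd, of 0 i N] i by auto
    have "u * real i \<le> real N * u - u"
      using i u0 mult_left_mono[of "real i" "real N - 1" u] by (simp add: algebra_simps)
    then have n1: "\<not> (rlo (P 0) (P i) \<le> a \<and> b \<le> rhi (P 0) (P i))"
      using chain[of 0 i] hull[of 0 i] i ab iN[of i] th th1 by (auto simp: algebra_simps)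
    define ui where "ui = u * real i"
    define ti where "ti = \<theta> * real i"
    have "u \<le> ui" "0 \<le> ti" using i u0 th by (simp_all add: ui_def ti_def)
    then have n2: "\<not> (rlo (P i) (P N) \<le> a \<and> b \<le> rhi (P i) (P N))"
      using chain[of i N, folded ui_def ti_def] hull[of i N] i ab th th1
      by (auto simp: algebra_simps)
    show ?thesis using t n1 n2 unfolding a_def b_def by linarith
  qed
  define h where "h = N div 2"
  have h: "2 \<le> h" "h < N" "2 * real h \<le> real N" using N by (auto simp: h_def)
  define uh where "uh = u * real h"
  have uh: "2 * u \<le> uh" "2 * uh \<le> NU" "4 * u \<le> NU"
    using h u0 N mult_left_mono[of "2 * real h" "real N" u] by (auto simp: uh_def NU_def)
  have ab': "NU - real N * \<theta> \<le> b - a" using ab by (simp add: NU_def mult.commute)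
  define thh where "thh = \<theta> * real h"
  have thh: "0 \<le> thh" "thh \<le> real N * \<theta>" using iN[of h] h th by (auto simp: thh_def)
  note ch = chain[of 0 h, folded NU_def uh_def thh_def] chain[of h N, folded NU_def uh_def thh_def]
  have midh: "rlo (P 0) (P h) \<le> a" "b \<le> rhi (P h) (P N)"
    using mid by (auto simp: h_def a_def b_def)
  \<comment> \<open>If the first step reached \<open>b\<close>, the head of \<open>P 0\<close> would
    be within one step of \<open>b\<close>; but it lies in the hull of \<open>P 0\<close> and the
    middle state, which starts at or below \<open>a\<close> and has only about half the
    length.\<close>
  have left1: "pos (P 0) \<le> a + u + \<theta>"
  proof -
    have "\<not> b \<le> rhi (P 0) (P 1)"
    proof
      assume "b \<le> rhi (P 0) (P 1)"
      then show False
        using chain[of 0 1] ch hull[of 0 1] hull[of 0 h] h ab' midh uh thh th th1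
        by auto
    qed
    then have "lo (P 0) (P 1) \<le> a" using split[of 1] N by auto
    then show ?thesis using chain[of 0 1] hull[of 0 1] N by auto
  qed
  have rightN: "a + (real N - 1) * u - 2 * real N * \<theta> \<le> pos (P N)"
  proof -
    let ?i = "N - 1"
    have i: "1 \<le> ?i" "?i < N" "real ?i = real N - 1" using N by auto
    have "\<not> rlo (P ?i) (P N) \<le> a"
    proof
      assume "rlo (P ?i) (P N) \<le> a"
      then show False
        using chain[of ?i N] ch hull[of ?i N] hull[of h N] h i ab' midh uh thh th th1
        by (auto simp: algebra_simps fo)
    qed
    then have "b \<le> hi (P ?i) (P N)" using split[OF i(1,2)] by auto
    then have "b - u - \<theta> \<le> pos (P N)"
      using chain[of ?i N] hull[of ?i N] i by (auto simp: algebra_simps)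
    moreover have "\<theta> \<le> real N * \<theta>" using iN[of 1] N by simp
    moreover have "(real N - 1) * u = real N * u - u" "2 * real N * \<theta> = 2 * (real N * \<theta>)"
      by (simp_all add: algebra_simps)
    ultimately show ?thesis using ab by linarith
  qed
  \<comment> \<open>In the first half, the wrong type would join the head of \<open>P 0\<close>,
    which is near \<open>a\<close>, to \<open>b\<close> within half of the steps; in the second half
    it would join the head of \<open>P N\<close>, which is near \<open>b\<close>, to
    \<open>a\<close>.\<close>
  have typeR: "rlo (P 0) (P i) \<le> a \<and> b \<le> rhi (P i) (P N)" if i: "1 \<le> i" "i < N" for i
  proof (rule ccontr)
    assume "\<not> ?thesis"
    then have L: "lo (P i) (P N) \<le> a" "b \<le> hi (P 0) (P i)" using split[OF i] by auto
    show False
    proof (cases "i \<le> h")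
      case True
      define ui where "ui = u * real i"
      have "ui \<le> uh" using u0 True by (simp add: ui_def uh_def)
      then show False
        using L chain[of 0 i, folded ui_def] hull[of 0 i] i ab' left1 uh iN[of i] th th1 by auto
    next
      case False
      define ui where "ui = u * real i"
      define ti where "ti = \<theta> * real i"
      have "uh \<le> ui" "0 \<le> ti" using u0 False th by (simp_all add: ui_def uh_def ti_def)
      then show False
        using L chain[of i N, folded ui_def ti_def NU_def] hull[of i N] i ab' rightN uh th th1
        by (auto simp: algebra_simps fo)
    qed
  qed
  have main: "\<bar>pos (P i) - (a + u * real i)\<bar> \<le> 2 * real N * \<theta> \<and>
        (\<forall>j. real_of_int j < a + u * real i - 2 * real N * \<theta> \<longrightarrow> fst (P i) j = fst (P N) j) \<and>
        (\<forall>j. a + u * real i + 2 * real N * \<theta> \<le> real_of_int j \<longrightarrow> fst (P i) j = fst (P 0) j)"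
    if i: "1 \<le> i" "i < N" for i
  proof -
    have hiU: "rhi (P 0) (P i) \<le> a + u * real i + real N * \<theta>"
      using typeR[OF i] chain[of 0 i] hull[of 0 i] i iN[of i] by auto
    have loV: "a + u * real i - 2 * real N * \<theta> \<le> rlo (P i) (P N)"
      using typeR[OF i] chain[of i N] hull[of i N] i iN[of i] ab by (auto simp: algebra_simps)
    have nn: "0 \<le> real N * \<theta>" using th by simp
    show ?thesis
    proof (intro conjI allI impI)
      show "\<bar>pos (P i) - (a + u * real i)\<bar> \<le> 2 * real N * \<theta>"
        using hiU loV hull[of 0 i] hull[of i N] i nn by auto
      fix j :: int
      show "fst (P i) j = fst (P N) j" if "j < a + u * real i - 2 * real N * \<theta>"
        using that loV i by (intro agree_below fd) auto
      show "fst (P i) j = fst (P 0) j" if "a + u * real i + 2 * real N * \<theta> \<le> j"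
        using that hiU i nn agree_above[OF fd[of 0 i], of j] by auto
    qed
  qed
  have nn: "\<theta> \<le> real N * \<theta>" using iN[of 1] N by simp
  show ?thesis
    unfolding rising_def a_def[symmetric]
  proof (intro conjI)
    show "pos (P 0) \<le> a + u + 2 * real N * \<theta>" using left1 nn th(1) by linarith
    show "a + (real N - 1) * u - 2 * real N * \<theta> \<le> pos (P N)" by (rule rightN)
    show "rwd (P 0) (P N) \<le> real N * u + 2 * real N * \<theta>"
      using ab2 hull(5)[of 0 N] nn th(1) by (simp add: a_def b_def)
  qed (use main in blast)
qed

text \<open>The two hulls at the middle time are too short to contain both ends. If the first one
  takes the lower end, \<open>rising_aux\<close> applies directly, otherwise after
  reflection.\<close>

lemma rising_or_falling:
  fixes P :: "nat \<Rightarrow> 'a state" and u \<theta> :: real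
  assumes fd: "\<And>i j. i \<le> N \<Longrightarrow> j \<le> N \<Longrightarrow> fd (P i) (P j)"
    and step: "\<And>i. i < N \<Longrightarrow> rwd (P i) (P (Suc i)) \<le> u + \<theta>"
    and total: "real N * (u - \<theta>) \<le> rwd (P 0) (P N)"
    and N: "4 \<le> N" and th: "0 \<le> \<theta>" "4 * real N * \<theta> < u"
  shows "rising P N u (2 * real N * \<theta>) \<or> rising (\<lambda>i. mirror (P i)) N u (2 * real N * \<theta>)"
proof -
  let ?h = "N div 2"
  have h: "?h \<le> N" by simp
  have hn: "real ?h * (u + \<theta>) < real N * (u - \<theta>)" "real (N - ?h) * (u + \<theta>) < real N * (u - \<theta>)"
  proof -
    have a: "16 * \<theta> < u" using th N mult_right_mono[of 4 "real N" \<theta>] by simp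
    have "real k * (u + \<theta>) < real N * (u - \<theta>)" if "k < N" for k
    proof -
      have "real k * (u + \<theta>) \<le> (real N - 1) * (u + \<theta>)"
        using that a th by (intro mult_right_mono) auto
      also have "\<dots> < real N * (u - \<theta>)" using th a by (simp add: algebra_simps)
      finally show ?thesis .
    qed
    from this[of ?h] this[of "N - ?h"] show "real ?h * (u + \<theta>) < real N * (u - \<theta>)"
      "real (N - ?h) * (u + \<theta>) < real N * (u - \<theta>)" using N by auto
  qed
  have U: "rwd (P 0) (P ?h) < rwd (P 0) (P N)"
    using wd_chain[of N P "u + \<theta>" 0 ?h, OF fd step] hn(1) total h by (simp add: mult.commute)
  have V: "rwd (P ?h) (P N) < rwd (P 0) (P N)"
    using wd_chain[of N P "u + \<theta>" ?h N, OF fd step] hn(2) total h by (simp add: mult.commute of_nat_diff)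
  have t: "min (lo (P 0) (P ?h)) (lo (P ?h) (P N)) \<le> lo (P 0) (P N)"
       "hi (P 0) (P N) \<le> max (hi (P 0) (P ?h)) (hi (P ?h) (P N))"
    using hull_triangle[OF fd fd, of 0 ?h N] h by auto
  consider (R) "rlo (P 0) (P ?h) \<le> rlo (P 0) (P N)" "rhi (P 0) (P N) \<le> rhi (P ?h) (P N)"
    | (L) "rlo (P ?h) (P N) \<le> rlo (P 0) (P N)" "rhi (P 0) (P N) \<le> rhi (P 0) (P ?h)"
    using t U V unfolding wd_def by linarith
  then show ?thesis
  proof cases
    case R
    then show ?thesis using rising_aux[of N P u \<theta>, OF fd step total N th] by blast
  next
    case L
    have "rising (\<lambda>i. mirror (P i)) N u (2 * real N * \<theta>)"
      using L fd step total N th h by (intro rising_aux) (simp_all add: lo_mirror hi_mirror)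
    then show ?thesis by blast
  qed
qed

section \<open>Energy of random walks\<close>

context lamp_qi
begin

definition energy :: "'a state \<Rightarrow> nat \<Rightarrow> real" where
  "energy p R = avg A R (\<lambda>ys. (wdf p (up p ys))\<^sup>2)"

definition Q :: "nat \<Rightarrow> real" where "Q R = (SUP p\<in>SA. energy p R)"

lemma SA_ne: "SA \<noteq> {}"
  using a0 by (auto simp: states_def intro!: exI[of _ "\<lambda>_. a0"])

lemma wdf_nonneg: "p \<in> SA \<Longrightarrow> q \<in> SA \<Longrightarrow> 0 \<le> wdf p q"
  using wd_nonneg[OF ffd] by simp

lemma wdf_triangle: "p \<in> SA \<Longrightarrow> q \<in> SA \<Longrightarrow> r \<in> SA \<Longrightarrow> wdf p r \<le> wdf p q + wdf q r"
  using wd_triangle[OF ffd ffd, of p q r] by (simp flip: of_int_add)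

lemma energy_bound: "p \<in> SA \<Longrightarrow> energy p R \<le> (real_of_int K * real R + real_of_int K)\<^sup>2"
  unfolding energy_def
proof (rule avg_le[OF finA Ane(1)])
  fix ys assume p: "p \<in> SA" and ys: "ys \<in> words A R"
  have q: "up p ys \<in> SA" using words_up[OF p ys] .
  have "wd (f p) (f (up p ys)) \<le> K * wd p (up p ys) + K" using f_le[OF p q] .
  also have "\<dots> \<le> K * int R + K"
    using wd_up[of p ys] ys K by (auto simp: words_def intro: mult_left_mono)
  finally have "wdf p (up p ys) \<le> real_of_int (K * int R + K)" by (simp only: of_int_le_iff)
  then show "(wdf p (up p ys))\<^sup>2 \<le> (real_of_int K * real R + real_of_int K)\<^sup>2"
    using wdf_nonneg[OF p q] by (intro power_mono) auto
qed

lemma bdd_en: "bdd_above ((\<lambda>p. energy p R) ` SA)"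
  using energy_bound by (auto intro!: bdd_aboveI2)

lemma energy_le_Q: "p \<in> SA \<Longrightarrow> energy p R \<le> Q R"
  unfolding Q_def by (rule cSUP_upper[OF _ bdd_en])

lemma Q_nonneg: "0 \<le> Q R"
proof -
  obtain p where p: "p \<in> SA" using SA_ne by auto
  have "0 \<le> energy p R" unfolding energy_def by (rule avg_ge[OF finA Ane(1)]) simp
  then show ?thesis using energy_le_Q[OF p] by (rule order.trans)
qed

text \<open>Conditioned on its first \<open>a\<close> letters, a random walk is a random walk from its \<open>a\<close>-th position.\<close>

lemma avg_step:
  assumes p: "p \<in> SA"
  shows "avg A (a + b) (\<lambda>ys. (wdf (up p (take a ys)) (up p ys))\<^sup>2) \<le> Q b"
proof -
  have "avg A (a + b) (\<lambda>ys. (wdf (up p (take a ys)) (up p ys))\<^sup>2)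
      = avg A a (\<lambda>us. energy (up p us) b)"
    unfolding avg_append energy_def
    by (intro avg_cong) (auto simp: words_def up_append)
  also have "\<dots> \<le> Q b"
    using words_up[OF p] by (intro avg_le[OF finA Ane(1)] energy_le_Q)
  finally show ?thesis .
qed

text \<open>Convexity of the square, applied to the two halves of the walk. It makes
  \<open>Q (2 ^ k) / 4 ^ k\<close> decreasing, and the root of the limit is the speed; this is why
  speeds are measured along powers of two.\<close>

lemma Q_double: "Q (2 * R) \<le> 4 * Q R"
  unfolding Q_def[of "2 * R"]
proof (rule cSUP_least[OF SA_ne])
  fix p assume p: "p \<in> SA"
  have "energy p (R + R) \<le> avg A (R + R) (\<lambda>ys. 2 * (wdf p (up p (take R ys)))\<^sup>2 +
      2 * (wdf (up p (take R ys)) (up p ys))\<^sup>2)"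
    unfolding energy_def
  proof (rule avg_mono)
    fix ys assume ys: "ys \<in> words A (R + R)"
    let ?x = "wdf p (up p (take R ys))" and ?y = "wdf (up p (take R ys)) (up p ys)"
    have q: "up p (take R ys) \<in> SA" "up p ys \<in> SA"
      using words_up[OF p words_take[OF ys]] words_up[OF p ys] .
    have "(wdf p (up p ys))\<^sup>2 \<le> (?x + ?y)\<^sup>2"
      using wdf_triangle[OF p q] wdf_nonneg[OF p q(2)] by (intro power_mono) auto
    also have "\<dots> \<le> 2 * ?x\<^sup>2 + 2 * ?y\<^sup>2"
      using zero_le_power2[of "?x - ?y"] by (simp add: power2_eq_square algebra_simps)
    finally show "(wdf p (up p ys))\<^sup>2 \<le> 2 * ?x\<^sup>2 + 2 * ?y\<^sup>2" .
  qed
  also have "\<dots> \<le> 2 * Q R + 2 * Q R"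
  proof -
    have "avg A (R + R) (\<lambda>ys. (wdf p (up p (take R ys)))\<^sup>2) \<le> Q R"
      using avg_take[OF finA Ane(1), of R R "\<lambda>us. (wdf p (up p us))\<^sup>2"] energy_le_Q[OF p, of R]
      by (simp add: energy_def)
    then show ?thesis unfolding avg_add avg_cmult
      using avg_step[OF p, of R R] by (intro add_mono mult_left_mono) auto
  qed
  finally have "energy p (R + R) \<le> 4 * Q R" by simp
  then show "energy p (2 * R) \<le> 4 * Q R" by (simp only: mult_2)
qed

text \<open>Only an asymptotic upper bound. The matching lower bound
  \<open>e\<^sup>2 * 4 ^ k \<le> Q (2 ^ k)\<close> is carried separately, for the places where a
  nearly extremal starting point must be found.\<close>

definition is_speed :: "real \<Rightarrow> bool" where
  "is_speed e \<longleftrightarrow> (\<forall>\<epsilon>>0. \<exists>k0. \<forall>k\<ge>k0. Q (2 ^ k) \<le> (e\<^sup>2 + \<epsilon>) * 4 ^ k)"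

lemma speed_exists: "\<exists>e\<ge>0. is_speed e \<and> (\<forall>k. e\<^sup>2 * 4 ^ k \<le> Q (2 ^ k))"
proof -
  define q where "q k = Q (2 ^ k) / 4 ^ k" for k :: nat
  have dec: "decseq q"
    unfolding decseq_Suc_iff
  proof
    fix k
    have "Q (2 ^ Suc k) \<le> 4 * Q (2 ^ k)" using Q_double[of "2 ^ k"] by simp
    then show "q (Suc k) \<le> q k" by (simp add: q_def divide_simps)
  qed
  have "convergent q"
  proof (rule decseq_convergent[OF dec, of 0])
    show "\<forall>i. 0 \<le> q i" using Q_nonneg by (simp add: q_def)
  qed (auto simp: convergent_def)
  then obtain l where l: "q \<longlonglongrightarrow> l" unfolding convergent_def by blast
  have lq: "l \<le> q k" for k using decseq_ge[OF dec l] .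
  have l0: "0 \<le> l" using LIMSEQ_le_const[OF l] Q_nonneg by (auto simp: q_def)
  show ?thesis
  proof (intro exI[of _ "sqrt l"] conjI allI)
    show "is_speed (sqrt l)"
      unfolding is_speed_def
    proof (intro allI impI)
      fix \<epsilon> :: real assume "0 < \<epsilon>"
      then have "eventually (\<lambda>k. q k < l + \<epsilon>) sequentially" using order_tendstoD(2)[OF l] by simp
      then obtain k0 where "\<And>k. k \<ge> k0 \<Longrightarrow> q k < l + \<epsilon>" unfolding eventually_sequentially by blast
      then show "\<exists>k0. \<forall>k\<ge>k0. Q (2 ^ k) \<le> ((sqrt l)\<^sup>2 + \<epsilon>) * 4 ^ k"
        using l0 by (intro exI[of _ k0]) (force simp: q_def field_simps less_imp_le)
    qed
    show "(sqrt l)\<^sup>2 * 4 ^ k \<le> Q (2 ^ k)" for k using lq[of k] l0 by (simp add: q_def field_simps)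
  qed (use l0 in simp)
qed

abbreviation path :: "'a state \<Rightarrow> nat \<Rightarrow> 'a list \<Rightarrow> nat \<Rightarrow> 'b state" where
  "path p r ys i \<equiv> f (up p (take (i * r) ys))"

definition efficient :: "'a state \<Rightarrow> nat \<Rightarrow> nat \<Rightarrow> real \<Rightarrow> real \<Rightarrow> 'a list \<Rightarrow> bool" where
  "efficient p N r u \<theta> ys \<longleftrightarrow> (\<forall>i<N. rwd (path p r ys i) (path p r ys (Suc i)) \<le> u + \<theta>) \<and>
     real N * (u - \<theta>) \<le> rwd (path p r ys 0) (path p r ys N)"

lemma words_take_le: "ys \<in> words A R \<Longrightarrow> a \<le> R \<Longrightarrow> take a ys \<in> words A a"
  using words_take[of ys A a "R - a"] by simp

lemma up_take_SA: "p \<in> SA \<Longrightarrow> ys \<in> words A R \<Longrightarrow> up p (take a ys) \<in> SA"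
  using set_take_subset[of a ys] by (auto simp: words_def intro!: up_states)

lemma wd_sum:
  assumes "p \<in> SA" "ys \<in> words A R"
  shows "rwd (path p r ys 0) (path p r ys N) \<le> (\<Sum>i<N. rwd (path p r ys i) (path p r ys (Suc i)))"
proof (induction N)
  case (Suc N)
  have "wdf (up p (take (0 * r) ys)) (up p (take (Suc N * r) ys)) \<le>
    wdf (up p (take (0 * r) ys)) (up p (take (N * r) ys)) +
    wdf (up p (take (N * r) ys)) (up p (take (Suc N * r) ys))"
    by (intro wdf_triangle up_take_SA[OF assms])
  then show ?case using Suc by simp
qed simp

text \<open>Consider the second moments of the deviations \<open>X i - e * r\<close>. Each
  \<open>X i\<close> has second moment at most about \<open>(e * r)\<^sup>2\<close>, while by the
  triangle inequality the means of the \<open>X i\<close> add up to almost \<open>N * e * r\<close>.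
  When the squares are expanded the main terms cancel, and Markov's inequality excludes a large
  deviation of any block.\<close>

lemma efficient_blocks:
  assumes e: "0 < e" "is_speed e" and N: "1 \<le> N" and d: "0 < d" and \<eta>: "0 < \<eta>"
  shows "\<exists>\<delta>>0. \<exists>k0. \<forall>k\<ge>k0. \<forall>p\<in>SA.
    1 - \<delta> \<le> frac A (N * 2 ^ k) (\<lambda>ys. (e - \<delta>) * real (N * 2 ^ k) \<le> wdf p (up p ys)) \<longrightarrow>
    1 - \<eta> \<le> frac A (N * 2 ^ k) (efficient p N (2 ^ k) (e * 2 ^ k) (d * 2 ^ k))"
proof -
  \<comment> \<open>Chosen to make the Markov bound \<open>N * (\<epsilon> + \<delta> * (2 * e + 2 *
    e\<^sup>2)) / d\<^sup>2\<close> at most \<open>\<eta> / 2\<close>. The other half of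
    \<open>\<eta>\<close> pays for the proportion \<open>\<delta>\<close> of paths that are too
    short.\<close>
  define \<epsilon> where "\<epsilon> = d\<^sup>2 * \<eta> / (4 * real N)"
  define \<delta> where "\<delta> = Min {e, d, \<eta> / 2, d\<^sup>2 * \<eta> / (4 * real N * (2 * e + 2 * e\<^sup>2))}"
  have pos: "0 < \<epsilon>" "0 < 2 * e + 2 * e\<^sup>2" using N d \<eta> e by (simp_all add: \<epsilon>_def add_pos_pos)
  have \<delta>: "0 < \<delta>" using pos d \<eta> e N unfolding \<delta>_def by (subst Min_gr_iff) auto
  have \<delta>': "\<delta> \<le> e" "\<delta> \<le> d" "\<delta> \<le> \<eta> / 2" "\<delta> \<le> d\<^sup>2 * \<eta> / (4 * real N * (2 * e + 2 * e\<^sup>2))"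
    unfolding \<delta>_def by (rule Min_le; simp)+
  have key: "real N * (\<epsilon> + \<delta> * (2 * e + 2 * e\<^sup>2)) / d\<^sup>2 \<le> \<eta> / 2"
  proof -
    have "\<delta> * (2 * e + 2 * e\<^sup>2) \<le> d\<^sup>2 * \<eta> / (4 * real N)"
    proof -
      define c where "c = 2 * e + 2 * e\<^sup>2"
      have "\<delta> * c \<le> d\<^sup>2 * \<eta> / (4 * real N * c) * c"
        using \<delta>'(4) pos(2) unfolding c_def by (intro mult_right_mono) auto
      then show ?thesis using pos(2) unfolding c_def[symmetric] by simp
    qed
    then have "real N * (\<epsilon> + \<delta> * (2 * e + 2 * e\<^sup>2)) \<le> real N * (d\<^sup>2 * \<eta> / (4 * real N) + d\<^sup>2 * \<eta> / (4 * real N))"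
      by (intro mult_left_mono add_mono) (simp_all add: \<epsilon>_def)
    also have "\<dots> = d\<^sup>2 * \<eta> / 2" using N by (simp add: field_simps)
    finally show ?thesis using d by (simp add: field_simps)
  qed
  obtain k0 where k0: "\<And>k. k \<ge> k0 \<Longrightarrow> Q (2 ^ k) \<le> (e\<^sup>2 + \<epsilon>) * 4 ^ k"
    using e(2) pos(1) unfolding is_speed_def by blast
  have "1 - \<eta> \<le> frac A (N * 2 ^ k) (efficient p N (2 ^ k) (e * 2 ^ k) (d * 2 ^ k))"
    if k: "k \<ge> k0" and p: "p \<in> SA"
      and low: "1 - \<delta> \<le> frac A (N * 2 ^ k) (\<lambda>ys. (e - \<delta>) * real (N * 2 ^ k) \<le> wdf p (up p ys))"
    for k p
  proof -
    define r :: nat where "r = 2 ^ k"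
    have r: "0 < real r" by (simp add: r_def)
    define W where "W = words A (N * r)"
    define X where "X = (\<lambda>i ys. rwd (path p r ys i) (path p r ys (Suc i)))"
    have X2: "avg A (N * r) (\<lambda>ys. (X i ys)\<^sup>2) \<le> (e\<^sup>2 + \<epsilon>) * (real r)\<^sup>2" if i: "i < N" for i
    proof -
      have "Suc i * r \<le> N * r" using i by (intro mult_le_mono1) simp
      then obtain b where b: "N * r = Suc i * r + b" using le_iff_add by blast
      have "avg A (N * r) (\<lambda>ys. (X i ys)\<^sup>2) =
          avg A (Suc i * r + b) (\<lambda>ys. (X i (take (Suc i * r) ys))\<^sup>2)"
        unfolding b X_def by (simp add: min_def)
      also have "\<dots> = avg A (Suc i * r) (\<lambda>us. (X i us)\<^sup>2)"
        by (rule avg_take[OF finA Ane(1)])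
      also have "\<dots> = avg A (i * r + r) (\<lambda>ys. (wdf (up p (take (i * r) ys)) (up p ys))\<^sup>2)"
        by (simp add: X_def add.commute) (intro avg_cong, auto simp: words_def)
      also have "\<dots> \<le> Q r" by (rule avg_step[OF p])
      also have "\<dots> \<le> (e\<^sup>2 + \<epsilon>) * (real r)\<^sup>2"
        using k0[OF k] by (simp add: r_def power_mult_distrib flip: power_mult)
          (simp add: power_mult mult.commute[of k])
      finally show ?thesis .
    qed
    have X1: "(e - \<delta>) * (1 - \<delta>) * real (N * r) \<le> (\<Sum>i<N. avg A (N * r) (X i))"
    proof -
      have "(e - \<delta>) * (1 - \<delta>) * real (N * r) \<le> (e - \<delta>) * real (N * r) *
         frac A (N * r) (\<lambda>ys. (e - \<delta>) * real (N * r) \<le> wdf p (up p ys))"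
      proof -
        have "(e - \<delta>) * real (N * r) * (1 - \<delta>) \<le> (e - \<delta>) * real (N * r) *
           frac A (N * r) (\<lambda>ys. (e - \<delta>) * real (N * r) \<le> wdf p (up p ys))"
          using low \<delta>'(1) unfolding r_def by (intro mult_left_mono) auto
        then show ?thesis by (simp only: mult_ac)
      qed
      also have "\<dots> \<le> avg A (N * r) (\<lambda>ys. wdf p (up p ys))"
        using \<delta>'(1) wdf_nonneg[OF p words_up[OF p]]
        by (intro avg_ge_frac[OF finA Ane(1)]) auto
      also have "\<dots> \<le> avg A (N * r) (\<lambda>ys. \<Sum>i<N. X i ys)"
      proof (rule avg_mono)
        fix ys assume ys: "ys \<in> words A (N * r)"
        then have "take (N * r) ys = ys" by (simp add: words_def)
        then show "wdf p (up p ys) \<le> (\<Sum>i<N. X i ys)"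
          using wd_sum[OF p ys, of r N] by (simp add: X_def)
      qed
      finally show ?thesis by (simp add: avg_sum)
    qed
    define V where "V = (\<lambda>ys. \<Sum>i<N. (X i ys - e * real r)\<^sup>2)"
    have "avg A (N * r) V = (\<Sum>i<N. avg A (N * r) (\<lambda>ys. (X i ys)\<^sup>2)) -
        2 * e * real r * (\<Sum>i<N. avg A (N * r) (X i)) + real N * (e * real r)\<^sup>2"
    proof -
      have "avg A (N * r) (\<lambda>ys. (X i ys - e * real r)\<^sup>2) =
         avg A (N * r) (\<lambda>ys. (X i ys)\<^sup>2) - 2 * e * real r * avg A (N * r) (X i) + (e * real r)\<^sup>2" for i
      proof -
        have "avg A (N * r) (\<lambda>ys. (X i ys - e * real r)\<^sup>2) =
          avg A (N * r) (\<lambda>ys. (X i ys)\<^sup>2 + ((- 2 * e * real r) * X i ys + (e * real r)\<^sup>2))"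
          by (intro avg_cong) (simp add: power2_eq_square algebra_simps)
        then show ?thesis by (simp only: avg_add avg_cmult avg_const[OF finA Ane(1)])
      qed
      then show ?thesis
        by (simp add: V_def avg_sum sum.distrib sum_subtractf sum_distrib_left)
    qed
    also have "\<dots> \<le> real N * ((e\<^sup>2 + \<epsilon>) * (real r)\<^sup>2) -
        2 * e * real r * ((e - \<delta>) * (1 - \<delta>) * real (N * r)) + real N * (e * real r)\<^sup>2"
    proof -
      have "(\<Sum>i<N. avg A (N * r) (\<lambda>ys. (X i ys)\<^sup>2)) \<le> real N * ((e\<^sup>2 + \<epsilon>) * (real r)\<^sup>2)"
        using sum_mono[of "{..<N}" "\<lambda>i. avg A (N * r) (\<lambda>ys. (X i ys)\<^sup>2)" "\<lambda>_. (e\<^sup>2 + \<epsilon>) * (real r)\<^sup>2"] X2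
        by simp
      moreover have "2 * e * real r * ((e - \<delta>) * (1 - \<delta>) * real (N * r)) \<le>
          2 * e * real r * (\<Sum>i<N. avg A (N * r) (X i))"
        using X1 e r by (intro mult_left_mono) auto
      ultimately show ?thesis by linarith
    qed
    also have "\<dots> = real N * (real r)\<^sup>2 * (\<epsilon> + \<delta> * (2 * e + 2 * e\<^sup>2) - 2 * e * \<delta>\<^sup>2)"
      by (simp add: power2_eq_square algebra_simps)
    also have "\<dots> \<le> real N * (real r)\<^sup>2 * (\<epsilon> + \<delta> * (2 * e + 2 * e\<^sup>2))"
      using e by (intro mult_left_mono) auto
    finally have V: "avg A (N * r) V \<le> real N * (real r)\<^sup>2 * (\<epsilon> + \<delta> * (2 * e + 2 * e\<^sup>2))" .
    have dr: "0 < (d * real r)\<^sup>2" using d r by simp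
    have "frac A (N * r) (\<lambda>ys. (d * real r)\<^sup>2 \<le> V ys) \<le> avg A (N * r) V / (d * real r)\<^sup>2"
      by (rule markov[OF finA Ane(1) dr]) (simp add: V_def sum_nonneg)
    also have "\<dots> \<le> real N * (real r)\<^sup>2 * (\<epsilon> + \<delta> * (2 * e + 2 * e\<^sup>2)) / (d * real r)\<^sup>2"
      by (intro divide_right_mono V) simp
    also have "\<dots> = real N * (\<epsilon> + \<delta> * (2 * e + 2 * e\<^sup>2)) / d\<^sup>2"
      using r d by (simp add: power_mult_distrib field_simps)
    also have "\<dots> \<le> \<eta> / 2" by (rule key)
    finally have big: "frac A (N * r) (\<lambda>ys. (d * real r)\<^sup>2 \<le> V ys) \<le> \<eta> / 2" .
    have "1 - \<eta> \<le> frac A (N * r) (\<lambda>ys. (e - \<delta>) * real (N * r) \<le> wdf p (up p ys)) +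
        frac A (N * r) (\<lambda>ys. \<not> (d * real r)\<^sup>2 \<le> V ys) - 1"
      using low big \<delta>'(3) by (simp add: frac_compl[OF finA Ane(1)] r_def)
    also have "\<dots> \<le> frac A (N * r) (\<lambda>ys. (e - \<delta>) * real (N * r) \<le> wdf p (up p ys) \<and>
        \<not> (d * real r)\<^sup>2 \<le> V ys)"
      by (rule frac_Int[OF finA Ane(1)])
    also have "\<dots> \<le> frac A (N * r) (efficient p N r (e * r) (d * r))"
    proof (rule frac_mono)
      fix ys assume ys: "ys \<in> words A (N * r)"
        and h: "(e - \<delta>) * real (N * r) \<le> wdf p (up p ys) \<and> \<not> (d * real r)\<^sup>2 \<le> V ys"
      have "X i ys \<le> e * real r + d * real r" if i: "i < N" for i
      proof (rule ccontr)
        assume "\<not> ?thesis"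
        then have "(d * real r)\<^sup>2 \<le> (X i ys - e * real r)\<^sup>2" using d r by (intro power_mono) auto
        also have "\<dots> \<le> V ys"
          unfolding V_def using i by (intro member_le_sum) auto
        finally show False using h by simp
      qed
      moreover have "real N * (e * real r - d * real r) \<le> wdf p (up p ys)"
      proof -
        have "real N * (e * real r - d * real r) = (e - d) * real (N * r)" by (simp add: algebra_simps)
        also have "\<dots> \<le> (e - \<delta>) * real (N * r)" using \<delta>'(2) by (intro mult_right_mono) auto
        finally show ?thesis using h by simp
      qed
      ultimately show "efficient p N r (e * r) (d * r) ys"
        using ys by (simp add: efficient_def X_def words_def)
    qed
    finally show ?thesis by (simp add: r_def)
  qed
  then show ?thesis using \<delta> by blast
qed

text \<open>A nearly maximal second moment could come from rare long paths, so \<open>p\<close> is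
  chosen nearly maximal for length \<open>2 * R\<close> and used at length \<open>R\<close>. Both
  halves have second moment at most about \<open>(e * R)\<^sup>2\<close>, so a total near
  \<open>4 * (e * R)\<^sup>2\<close> needs a large mixed term. The conditional mean of the second
  half is at most about \<open>e * R\<close>; hence the mean of the first half is almost
  \<open>e * R\<close>, and its variance is small.\<close>

lemma extremal_point:
  assumes e: "0 < e" "is_speed e" and lower: "\<And>k. e\<^sup>2 * 4 ^ k \<le> Q (2 ^ k)" and \<delta>: "0 < \<delta>"
  shows "\<exists>k0. \<forall>k\<ge>k0. \<exists>p\<in>SA.
    1 - \<delta> \<le> frac A (2 ^ k) (\<lambda>ys. (e - \<delta>) * real (2 ^ k) \<le> wdf p (up p ys))"
proof -
  \<comment> \<open>The variance below is at most \<open>8 * \<epsilon> * R\<^sup>2\<close>, so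
    Chebyshev's inequality at deviation \<open>\<delta> * R\<close> yields exactly
    \<open>\<delta>\<close>.\<close>
  define \<epsilon> where "\<epsilon> = \<delta> ^ 3 / 8"
  have \<epsilon>: "0 < \<epsilon>" using \<delta> by (simp add: \<epsilon>_def)
  obtain k0 where k0: "\<And>k. k \<ge> k0 \<Longrightarrow> Q (2 ^ k) \<le> (e\<^sup>2 + \<epsilon>) * 4 ^ k"
    using e(2) \<epsilon> unfolding is_speed_def by blast
  have "\<exists>p\<in>SA. 1 - \<delta> \<le> frac A (2 ^ k) (\<lambda>ys. (e - \<delta>) * real (2 ^ k) \<le> wdf p (up p ys))"
    if k: "k \<ge> k0" for k
  proof -
    define R :: nat where "R = 2 ^ k"
    have R: "0 < real R" by (simp add: R_def)
    have R4: "4 ^ k = (real R)\<^sup>2"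
      by (simp add: R_def power_mult[symmetric] mult.commute[of k]) (simp add: power_mult)
    have QR: "Q R \<le> (e\<^sup>2 + \<epsilon>) * (real R)\<^sup>2" using k0[OF k] by (simp add: R_def[symmetric] R4)
    have "e\<^sup>2 * (4 * (real R)\<^sup>2) \<le> Q (R + R)"
      using lower[of "Suc k"] R4 by (simp add: R_def mult_2)
    then have "(e\<^sup>2 - \<epsilon>) * (4 * (real R)\<^sup>2) < Q (R + R)"
      using \<epsilon> R by (intro order.strict_trans2[OF mult_strict_right_mono]) auto
    then obtain p where p: "p \<in> SA" and energy: "(e\<^sup>2 - \<epsilon>) * (4 * (real R)\<^sup>2) < energy p (R + R)"
      unfolding Q_def less_cSUP_iff[OF SA_ne bdd_en] by blast
    define D1 where "D1 = (\<lambda>us. wdf p (up p us))"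
    define D2 where "D2 = (\<lambda>us vs. wdf (up p us) (up p (us @ vs)))"
    define m1 where "m1 = avg A R D1"
    have s: "up p us \<in> SA" "up p (us @ vs) \<in> SA" if "us \<in> words A R" "vs \<in> words A R" for us vs
      using that words_up[OF p] by (auto simp: words_def intro!: up_states[OF p])
    have D1sq: "avg A R (\<lambda>us. (D1 us)\<^sup>2) \<le> (e\<^sup>2 + \<epsilon>) * (real R)\<^sup>2"
      using energy_le_Q[OF p, of R] QR by (simp add: D1_def energy_def)
    have D2sq: "avg A R (\<lambda>vs. (D2 us vs)\<^sup>2) \<le> (e\<^sup>2 + \<epsilon>) * (real R)\<^sup>2" if us: "us \<in> words A R" for us
      using energy_le_Q[OF words_up[OF p us], of R] QR by (simp add: D2_def energy_def up_append)
    \<comment> \<open>Uniform in the first half \<open>us\<close>, so that \<open>D1 us\<close> can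
      be kept as a factor when the mixed term is averaged.\<close>
    have D2m: "avg A R (D2 us) \<le> real R * (2 * e\<^sup>2 + \<epsilon>) / (2 * e)" if us: "us \<in> words A R" for us
    proof -
      have "avg A R (D2 us) \<le> avg A R (\<lambda>vs. 1 / (2 * e * real R) * ((D2 us vs)\<^sup>2 + (e * real R)\<^sup>2))"
      proof (rule avg_mono)
        fix vs
        have "2 * (D2 us vs) * (e * real R) \<le> (D2 us vs)\<^sup>2 + (e * real R)\<^sup>2" by (rule sum_squares_bound)
        then show "D2 us vs \<le> 1 / (2 * e * real R) * ((D2 us vs)\<^sup>2 + (e * real R)\<^sup>2)"
          using e R by (simp add: field_simps)
      qed
      also have "\<dots> = 1 / (2 * e * real R) * (avg A R (\<lambda>vs. (D2 us vs)\<^sup>2) + (e * real R)\<^sup>2)"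
        by (simp only: avg_cmult avg_add avg_const[OF finA Ane(1)])
      also have "\<dots> \<le> 1 / (2 * e * real R) * ((e\<^sup>2 + \<epsilon>) * (real R)\<^sup>2 + (e * real R)\<^sup>2)"
        using D2sq[OF us] e R by (intro mult_left_mono add_right_mono) auto
      also have "\<dots> = real R * (2 * e\<^sup>2 + \<epsilon>) / (2 * e)"
        using e R by (simp add: field_simps power2_eq_square)
      finally show ?thesis .
    qed
    have D1n: "0 \<le> D1 us" if "us \<in> words A R" for us
      using wdf_nonneg[OF p words_up[OF p that]] by (simp add: D1_def)
    have "energy p (R + R) \<le> avg A R (\<lambda>us. avg A R (\<lambda>vs. (D1 us)\<^sup>2 + ((D2 us vs)\<^sup>2 + 2 * D1 us * D2 us vs)))"
      unfolding energy_def avg_append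
    proof (rule avg_mono, rule avg_mono)
      fix us vs assume w: "us \<in> words A R" "vs \<in> words A R"
      have "(wdf p (up p (us @ vs)))\<^sup>2 \<le> (D1 us + D2 us vs)\<^sup>2"
        using wdf_triangle[OF p s[OF w]] wdf_nonneg[OF p s(2)[OF w]]
        by (intro power_mono) (auto simp: D1_def D2_def)
      then show "(wdf p (up p (us @ vs)))\<^sup>2 \<le> (D1 us)\<^sup>2 + ((D2 us vs)\<^sup>2 + 2 * D1 us * D2 us vs)"
        by (simp add: power2_sum)
    qed
    also have "\<dots> = avg A R (\<lambda>us. (D1 us)\<^sup>2) + (avg A R (\<lambda>us. avg A R (\<lambda>vs. (D2 us vs)\<^sup>2)) +
        avg A R (\<lambda>us. 2 * D1 us * avg A R (D2 us)))"
      by (simp only: avg_add avg_cmult avg_const[OF finA Ane(1)])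
    also have "\<dots> \<le> (e\<^sup>2 + \<epsilon>) * (real R)\<^sup>2 + ((e\<^sup>2 + \<epsilon>) * (real R)\<^sup>2 +
        avg A R (\<lambda>us. (real R * (2 * e\<^sup>2 + \<epsilon>) / e) * D1 us))"
    proof (rule add_mono[OF D1sq], rule add_mono)
      show "avg A R (\<lambda>us. avg A R (\<lambda>vs. (D2 us vs)\<^sup>2)) \<le> (e\<^sup>2 + \<epsilon>) * (real R)\<^sup>2"
        by (rule avg_le[OF finA Ane(1) D2sq])
      show "avg A R (\<lambda>us. 2 * D1 us * avg A R (D2 us)) \<le> avg A R (\<lambda>us. (real R * (2 * e\<^sup>2 + \<epsilon>) / e) * D1 us)"
      proof (rule avg_mono)
      fix us assume us: "us \<in> words A R"
      have "2 * D1 us * avg A R (D2 us) \<le> 2 * D1 us * (real R * (2 * e\<^sup>2 + \<epsilon>) / (2 * e))"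
        using D2m[OF us] D1n[OF us] by (intro mult_left_mono) auto
      then show "2 * D1 us * avg A R (D2 us) \<le> (real R * (2 * e\<^sup>2 + \<epsilon>) / e) * D1 us"
        by (simp add: mult.commute)
      qed
    qed
    also have "avg A R (\<lambda>us. (real R * (2 * e\<^sup>2 + \<epsilon>) / e) * D1 us) = real R * (2 * e\<^sup>2 + \<epsilon>) / e * m1"
      by (simp only: avg_cmult m1_def)
    finally have "(2 * e\<^sup>2 - 6 * \<epsilon>) * (real R)\<^sup>2 \<le> real R * (2 * e\<^sup>2 + \<epsilon>) / e * m1"
      using energy by (simp add: algebra_simps)
    then have "((2 * e\<^sup>2 - 6 * \<epsilon>) * real R * e) * real R \<le> ((2 * e\<^sup>2 + \<epsilon>) * m1) * real R"
      using e R by (simp add: field_simps power2_eq_square)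
    then have "(2 * e\<^sup>2 - 6 * \<epsilon>) * real R * e \<le> (2 * e\<^sup>2 + \<epsilon>) * m1"
      using R by (rule mult_right_le_imp_le)
    then have "2 * e * ((2 * e\<^sup>2 - 6 * \<epsilon>) * real R * e) \<le> 2 * e * ((2 * e\<^sup>2 + \<epsilon>) * m1)"
      using e by (intro mult_left_mono) auto
    moreover have "(2 * e\<^sup>2 - 7 * \<epsilon>) * real R * (2 * e\<^sup>2 + \<epsilon>) \<le> 2 * e * ((2 * e\<^sup>2 - 6 * \<epsilon>) * real R * e)"
      using R \<epsilon> by (simp add: power2_eq_square algebra_simps)
    ultimately have "(2 * e\<^sup>2 - 7 * \<epsilon>) * real R * (2 * e\<^sup>2 + \<epsilon>) \<le> 2 * e * m1 * (2 * e\<^sup>2 + \<epsilon>)"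
      by (simp add: algebra_simps)
    then have m1: "(2 * e\<^sup>2 - 7 * \<epsilon>) * real R \<le> 2 * e * m1"
      using \<epsilon> by (subst (asm) mult_le_cancel_right) (auto simp: add_nonneg_pos not_less)
    have "avg A R (\<lambda>us. (D1 us - e * real R)\<^sup>2) =
        avg A R (\<lambda>us. (D1 us)\<^sup>2) - 2 * e * m1 * real R + (e * real R)\<^sup>2"
    proof -
      have "avg A R (\<lambda>us. (D1 us - e * real R)\<^sup>2) =
          avg A R (\<lambda>us. (D1 us)\<^sup>2 + ((- 2 * e * real R) * D1 us + (e * real R)\<^sup>2))"
        by (intro avg_cong) (simp add: power2_eq_square algebra_simps)
      then show ?thesis
        by (simp only: avg_add avg_cmult avg_const[OF finA Ane(1)] m1_def) (simp add: algebra_simps)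
    qed
    also have "\<dots> \<le> (e\<^sup>2 + \<epsilon>) * (real R)\<^sup>2 - (2 * e\<^sup>2 - 7 * \<epsilon>) * real R * real R + (e * real R)\<^sup>2"
      using D1sq mult_right_mono[OF m1, of "real R"] by simp
    also have "\<dots> = 8 * \<epsilon> * (real R)\<^sup>2" by (simp add: power2_eq_square algebra_simps)
    finally have var: "avg A R (\<lambda>us. (D1 us - e * real R)\<^sup>2) \<le> 8 * \<epsilon> * (real R)\<^sup>2" .
    have dR: "0 < (\<delta> * real R)\<^sup>2" using \<delta> R by simp
    have "frac A R (\<lambda>us. \<not> (e - \<delta>) * real R \<le> wdf p (up p us)) \<le>
        frac A R (\<lambda>us. (\<delta> * real R)\<^sup>2 \<le> (D1 us - e * real R)\<^sup>2)"
    proof (rule frac_mono)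
      fix us assume "\<not> (e - \<delta>) * real R \<le> wdf p (up p us)"
      then have "\<delta> * real R \<le> e * real R - D1 us" by (simp add: D1_def algebra_simps)
      then have "(\<delta> * real R)\<^sup>2 \<le> (e * real R - D1 us)\<^sup>2"
        using \<delta> R by (intro power_mono) auto
      then show "(\<delta> * real R)\<^sup>2 \<le> (D1 us - e * real R)\<^sup>2" by (simp add: power2_commute)
    qed
    also have "\<dots> \<le> avg A R (\<lambda>us. (D1 us - e * real R)\<^sup>2) / (\<delta> * real R)\<^sup>2"
      by (rule markov[OF finA Ane(1) dR]) simp
    also have "\<dots> \<le> 8 * \<epsilon> * (real R)\<^sup>2 / (\<delta> * real R)\<^sup>2"
      by (intro divide_right_mono var) simp
    also have "\<dots> = \<delta>" using \<delta> R by (simp add: \<epsilon>_def field_simps power2_eq_square power3_eq_cube)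
    finally have "frac A R (\<lambda>us. \<not> (e - \<delta>) * real R \<le> wdf p (up p us)) \<le> \<delta>" .
    then have "1 - \<delta> \<le> frac A R (\<lambda>us. (e - \<delta>) * real R \<le> wdf p (up p us))"
      by (simp only: frac_compl[OF finA Ane(1)])
    then show ?thesis using p by (auto simp: R_def)
  qed
  then show ?thesis by blast
qed

end

text \<open>\<open>P\<close> carries its head far up. If the start of \<open>P'\<close> differs from
  the common end at a lamp \<open>i\<close> near the bottom, then \<open>P'\<close> also has to span
  from \<open>i\<close> to the final head, and falls short of \<open>N * u\<close> by at most
  \<open>j + 1\<close> steps. A falling \<open>P'\<close> would end with its head near the lower end
  of its hull, which is at or below \<open>i\<close>, and this is too low. So \<open>P'\<close>
  rises, and comparing lengths places its starting head near that of \<open>P\<close>.\<close>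

lemma common_end:
  fixes P P' :: "nat \<Rightarrow> 'a state"
  assumes P: "rising P N u w" and N: "w \<le> u / 4" "0 < u" "1 \<le> N"
    and fd: "fd (P 0) (P N)" "fd (P' 0) (P' N')"
    and eq: "P' N' = P N"
    and dis: "real_of_int i < pos (P 0) + u * (real j - 1) - 2 * w" "fst (P N) i \<noteq> fst (P' 0) i"
  shows "(real N - real j - 1) * u \<le> rwd (P' 0) (P' N')"
    and "\<lbrakk>real N * u = real N' * u'; w' \<le> u' / 4; u \<le> u'; real j * u \<le> u'; 8 \<le> N';
      rising P' N' u' w' \<or> rising (\<lambda>i. mirror (P' i)) N' u' w'\<rbrakk> \<Longrightarrow>
      rising P' N' u' w' \<and> \<bar>pos (P' 0) - pos (P 0)\<bar> \<le> 4 * u'"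
proof -
  define a where "a = rlo (P 0) (P N)"
  have a: "a \<le> pos (P 0)" "pos (P 0) \<le> a + u + w" "a + (real N - 1) * u - w \<le> pos (P N)"
     "pos (P N) \<le> a + real N * u + w"
    using P lo_le[OF fd(1)] hi_ge[OF fd(1)] by (auto simp: rising_def a_def wd_def)
  have lo: "rlo (P' 0) (P N) \<le> i"
    using diff_bounds(1)[OF fd(2), of i] dis(2) eq by simp
  have h': "pos (P N) \<le> rhi (P' 0) (P N)" "rlo (P' 0) (P N) \<le> pos (P' 0)"
    "rwd (P' 0) (P N) = rhi (P' 0) (P N) - rlo (P' 0) (P N)"
    "rlo (P' 0) (P N) \<le> pos (P N)"
    using hi_ge[OF fd(2)] lo_le[OF fd(2)] eq by (simp_all add: wd_def)
  show "(real N - real j - 1) * u \<le> rwd (P' 0) (P' N')"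
    using a lo h' dis(1) eq by (simp add: algebra_simps)
  assume *: "real N * u = real N' * u'" "w' \<le> u' / 4" "u \<le> u'" "real j * u \<le> u'" "8 \<le> N'"
      "rising P' N' u' w' \<or> rising (\<lambda>i. mirror (P' i)) N' u' w'"
  have u': "0 < u'" using * N by linarith
  define NU where "NU = real N' * u'"
  have NU: "real N * u = NU" "8 * u' \<le> NU" using *(1,5) u' by (auto simp: NU_def)
  have pT: "pos (P 0) + NU - 2 * u - 2 * w \<le> pos (P N)" "pos (P N) \<le> pos (P 0) + NU + w"
    using a NU(1) by (auto simp: algebra_simps)
  have not: "\<not> rising (\<lambda>i. mirror (P' i)) N' u' w'"
  proof
    assume "rising (\<lambda>i. mirror (P' i)) N' u' w'"
    then have "- rhi (P' 0) (P N) + (real N' - 1) * u' - w' \<le> - pos (P N)"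
      "rwd (P' 0) (P N) \<le> NU + w'"
      using fd(2) eq by (auto simp: rising_def lo_mirror NU_def)
    then have "- rhi (P' 0) (P N) + NU - u' - w' \<le> - pos (P N)" "rwd (P' 0) (P N) \<le> NU + w'"
      by (auto simp: NU_def algebra_simps)
    moreover have "u * (real j - 1) \<le> u' - u" using *(4) by (simp add: algebra_simps)
    ultimately show False using h' lo dis(1) pT NU(2) * N u' by linarith
  qed
  with *(6) have r: "rising P' N' u' w'" by blast
  then have "pos (P' 0) \<le> rlo (P' 0) (P N) + u' + w'" "rlo (P' 0) (P N) + NU - u' - w' \<le> pos (P N)"
      "rwd (P' 0) (P N) \<le> NU + w'"
    using eq by (auto simp: rising_def NU_def algebra_simps)
  then have "\<bar>pos (P' 0) - pos (P 0)\<bar> \<le> 4 * u'"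
    using h' pT * N u' by linarith
  with r show "rising P' N' u' w' \<and> \<bar>pos (P' 0) - pos (P 0)\<bar> \<le> 4 * u'" by blast
qed

context lamp_qi
begin

lemma mirror_lamp_qi: "lamp_qi A a0 B b0 (\<lambda>p. mirror (f p)) K"
proof
  fix p assume "p \<in> SA"
  then show "mirror (f p) \<in> SB" using f_in by simp
next
  fix s assume "s \<in> SB"
  then obtain p where "p \<in> SA" "wd (f p) (mirror s) \<le> K" using f_onto[of "mirror s"] by auto
  then show "\<exists>p\<in>SA. wd (mirror (f p)) s \<le> K"
    using wd_mirror[of "f p" "mirror s"] states_fd[OF f_in, of p "mirror s"] \<open>s \<in> SB\<close>
    by (intro bexI[of _ p]) auto
next
  fix p q assume pq: "p \<in> SA" "q \<in> SA"
  show "wd (mirror (f p)) (mirror (f q)) \<le> K * wd p q + K"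
    "wd p q \<le> K * wd (mirror (f p)) (mirror (f q)) + K"
    using f_le[OF pq] f_ge[OF pq] ffd[OF pq] by simp_all
qed (use finA a0 finB b0 K in auto)

lemma path_fd: "p \<in> SA \<Longrightarrow> p' \<in> SA \<Longrightarrow> ys \<in> words A R \<Longrightarrow> fd (path p r ys i) (path p' r' ys j)"
  by (intro ffd up_take_SA)

lemma prefix_count:
  assumes "p \<in> SA" "l \<le> v"
  shows "frac A R (\<lambda>us. f (up p us) \<in> box B b0 l v \<alpha> \<gamma>) \<le>
    real mult_dom * ((real_of_int (v - l) + 1) * real (card B) ^ nat (v - l)) / real (card A) ^ R"
proof -
  let ?S = "box B b0 l v \<alpha> \<gamma>"
  have "card {ys \<in> words A R. f (up p ys) \<in> ?S} \<le> mult_dom * card ?S"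
    by (rule card_words_preimage[OF assms(1) box_card(1)[OF finB assms(2)], of _ R]) auto
  also have "\<dots> \<le> mult_dom * ((nat (v - l) + 1) * card B ^ nat (v - l))"
    using box_card(2)[OF finB assms(2)] by (intro mult_left_mono) auto
  finally have "real (card {ys \<in> words A R. f (up p ys) \<in> ?S}) \<le>
      real (mult_dom * ((nat (v - l) + 1) * card B ^ nat (v - l)))"
    by (simp only: of_nat_le_iff)
  also have "\<dots> = real mult_dom * ((real_of_int (v - l) + 1) * real (card B) ^ nat (v - l))"
    using assms(2) by (simp add: algebra_simps)
  finally show ?thesis unfolding frac_card by (intro divide_right_mono) auto
qed

lemma cardB_power_le: "real k \<le> x \<Longrightarrow> real (card B) ^ k \<le> exp (x * ln (real (card B)))"
proof -
  assume k: "real k \<le> x"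
  have "real (card B) ^ k = exp (real k * ln (real (card B)))"
    using Bne(2) by (simp add: exp_of_nat_mult)
  also have "\<dots> \<le> exp (x * ln (real (card B)))"
    using k Bne(2) by (intro exp_le_cancel_iff[THEN iffD2] mult_right_mono) auto
  finally show ?thesis .
qed

lemma cardA_power: "real (card A) ^ k = exp (real k * ln (real (card A)))"
  using Ane(2) by (simp add: exp_of_nat_mult)

text \<open>After \<open>j\<close> blocks the lamps behind a rising image path are final, hence
  prescribed by \<open>\<beta>\<close>, and those ahead are still those of \<open>f p\<close>. The
  image of the prefix lies in a box of length about \<open>5 / 2 * e * r\<close>, which admits only
  a small part of the \<open>card A ^ (j * r)\<close> prefixes. With \<open>\<beta>\<close> the
  lamps of \<open>f p'\<close>, this provides the disagreement that \<open>common_end\<close>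
  requires.\<close>

lemma few_agree:
  assumes e: "0 < e" and j: "1 \<le> j" "5 / 2 * e * ln (real (card B)) < real j * ln (real (card A))"
    and \<eta>: "0 < \<eta>"
  shows "\<exists>r0. \<forall>r\<ge>r0. \<forall>N>j. \<forall>\<theta>. 0 \<le> \<theta> \<and> 4 * real N * \<theta> < e * real r \<longrightarrow> (\<forall>p\<in>SA. \<forall>\<beta>.
    frac A (N * r) (\<lambda>ys. rising (path p r ys) N (e * real r) (2 * real N * \<theta>) \<and>
      (\<forall>i. real_of_int i < pos (f p) + e * real r * (real j - 1) - 2 * (2 * real N * \<theta>) \<longrightarrow>
         fst (path p r ys N) i = \<beta> i)) \<le> \<eta>)"
proof -
  define c where "c = real j * ln (real (card A)) - 5 / 2 * e * ln (real (card B))"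
  have c: "0 < c" using j(2) by (simp add: c_def)
  obtain r0 where r0: "\<And>r. r \<ge> r0 \<Longrightarrow>
      real mult_dom * exp (2 * ln (real (card B))) * (5 / 2 * e * real r + 3) ^ 1 * exp (- c * real r) \<le> \<eta>"
    using power_exp_decay[OF c \<eta>] by blast
  have "frac A (N * r) (\<lambda>ys. rising (path p r ys) N (e * real r) (2 * real N * \<theta>) \<and>
      (\<forall>i. real_of_int i < pos (f p) + e * real r * (real j - 1) - 2 * (2 * real N * \<theta>) \<longrightarrow>
         fst (path p r ys N) i = \<beta> i)) \<le> \<eta>"
    if r: "r \<ge> r0" and N: "N > j" and th: "0 \<le> \<theta>" "4 * real N * \<theta> < e * real r" and p: "p \<in> SA"
    for r N \<theta> p \<beta>
  proof -
    define u where "u = e * real r"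
    define w where "w = 2 * real N * \<theta>"
    have w: "0 \<le> w" "w < u / 2" using th by (auto simp: w_def u_def)
    define l where "l = \<lfloor>pos (f p) + u * (real j - 1) - 2 * w\<rfloor>"
    define v where "v = \<lceil>pos (f p) + u * real j + w\<rceil>"
    have l: "real_of_int l \<le> pos (f p) + u * (real j - 1) - 2 * w"
        "pos (f p) + u * (real j - 1) - 2 * w - 1 < real_of_int l"
      unfolding l_def by linarith+
    have v: "pos (f p) + u * real j + w \<le> real_of_int v" "real_of_int v < pos (f p) + u * real j + w + 1"
      unfolding v_def by linarith+
    \<comment> \<open>The box has length about \<open>u + 3 * w\<close> with
      \<open>w < u / 2\<close>: this is the origin of \<open>5 / 2\<close>.\<close>
    have vl: "real_of_int (v - l) \<le> 5 / 2 * u + 2" using l v w by (simp add: algebra_simps)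
    have lv: "l \<le> v" using l(1) v(1) w by (simp add: algebra_simps)
    obtain b where b: "N * r = j * r + b" using N le_iff_add[of "j * r" "N * r"] by auto
    have "frac A (N * r) (\<lambda>ys. rising (path p r ys) N u w \<and>
      (\<forall>i. real_of_int i < pos (f p) + u * (real j - 1) - 2 * w \<longrightarrow> fst (path p r ys N) i = \<beta> i))
      \<le> frac A (N * r) (\<lambda>ys. f (up p (take (j * r) ys)) \<in> box B b0 l v \<beta> (fst (f p)))"
    proof (rule frac_mono)
      fix ys assume ys: "ys \<in> words A (N * r)" and h: "rising (path p r ys) N u w \<and>
        (\<forall>i. real_of_int i < pos (f p) + u * (real j - 1) - 2 * w \<longrightarrow> fst (path p r ys N) i = \<beta> i)"
      define a where "a = rlo (path p r ys 0) (path p r ys N)"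
      have a: "a \<le> pos (f p)" "pos (f p) \<le> a + u + w"
        using h lo_le(1)[OF path_fd[OF p p ys, where r = r and i = 0 and r' = r and j = N]] by (auto simp: rising_def a_def)
      have R: "\<bar>pos (path p r ys j) - (a + u * real j)\<bar> \<le> w"
        "\<And>i. real_of_int i < a + u * real j - w \<Longrightarrow> fst (path p r ys j) i = fst (path p r ys N) i"
        "\<And>i. a + u * real j + w \<le> real_of_int i \<Longrightarrow> fst (path p r ys j) i = fst (f p) i"
        using h j(1) N unfolding rising_def a_def[symmetric] by auto
      show "f (up p (take (j * r) ys)) \<in> box B b0 l v \<beta> (fst (f p))"
        unfolding box_def
      proof (intro CollectI conjI allI impI)
        show "f (up p (take (j * r) ys)) \<in> SB" by (rule f_in[OF up_take_SA[OF p ys]])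
        show "l \<le> snd (f (up p (take (j * r) ys)))"
          using R(1) a l(1) by (simp add: algebra_simps)
        show "snd (f (up p (take (j * r) ys))) \<le> v"
          using R(1) a v(1) by (simp add: algebra_simps)
        fix i
        show "fst (f (up p (take (j * r) ys))) i = \<beta> i" if "i < l"
        proof -
          have "real_of_int i < pos (f p) + u * (real j - 1) - 2 * w" using that l(1) by linarith
          moreover from this have "real_of_int i < a + u * real j - w"
            using a by (simp add: algebra_simps)
          ultimately show ?thesis using R(2)[of i] h by auto
        qed
        show "fst (f (up p (take (j * r) ys))) i = fst (f p) i" if "i \<ge> v"
          using R(3)[of i] a(1) v(1) that by auto
      qed
    qed
    also have "\<dots> = frac A (j * r) (\<lambda>us. f (up p us) \<in> box B b0 l v \<beta> (fst (f p)))"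
      unfolding b frac_def
      using avg_take[OF finA Ane(1), of "j * r" b "\<lambda>us. of_bool (f (up p us) \<in> box B b0 l v \<beta> (fst (f p)))"]
      by simp
    also have "\<dots> \<le> real mult_dom * ((real_of_int (v - l) + 1) * real (card B) ^ nat (v - l)) / real (card A) ^ (j * r)"
      by (rule prefix_count[OF p lv])
    also have "\<dots> \<le> real mult_dom * ((5 / 2 * u + 3) * exp ((5 / 2 * u + 2) * ln (real (card B)))) / real (card A) ^ (j * r)"
      using vl lv by (intro divide_right_mono mult_left_mono mult_mono cardB_power_le) auto
    also have "\<dots> = real mult_dom * exp (2 * ln (real (card B))) * (5 / 2 * e * real r + 3) ^ 1 * exp (- c * real r)"
    proof -
      have "(5 / 2 * u + 2) * ln (real (card B)) - real (j * r) * ln (real (card A)) =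
         2 * ln (real (card B)) + - c * real r"
        by (simp add: c_def u_def algebra_simps)
      then have q: "exp ((5 / 2 * u + 2) * ln (real (card B))) / real (card A) ^ (j * r) =
          exp (2 * ln (real (card B))) * exp (- c * real r)"
        unfolding cardA_power exp_diff[symmetric] exp_add[symmetric] by simp
      have "real mult_dom * ((5 / 2 * u + 3) * exp ((5 / 2 * u + 2) * ln (real (card B)))) / real (card A) ^ (j * r)
        = real mult_dom * (5 / 2 * u + 3) * (exp ((5 / 2 * u + 2) * ln (real (card B))) / real (card A) ^ (j * r))"
        by simp
      also have "\<dots> = real mult_dom * exp (2 * ln (real (card B))) * (5 / 2 * u + 3) ^ 1 * exp (- c * real r)"
        unfolding q by simp
      finally show ?thesis by (simp only: u_def mult.assoc)
    qed
    also have "\<dots> \<le> \<eta>" by (rule r0[OF r])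
    finally show ?thesis by (simp add: u_def w_def)
  qed
  then show ?thesis by blast
qed

definition same_box :: "nat \<Rightarrow> 'a state \<Rightarrow> 'a state \<Rightarrow> bool" where
  "same_box R p p' \<longleftrightarrow> snd p = snd p' \<and>
     (\<forall>i. i < snd p \<or> snd p + int R \<le> i \<longrightarrow> fst p i = fst p' i)"

lemma same_box_up: "same_box R p p' \<Longrightarrow> ys \<in> words A R \<Longrightarrow> up p ys = up p' ys"
  unfolding same_box_def words_def by (intro up_cong[where R = R]) auto

text \<open>One word, read from \<open>p\<close> in \<open>N\<close> blocks and from
  \<open>p'\<close> in \<open>N'\<close> blocks; \<open>spread\<close> needs the second subdivision
  to be coarser.\<close>

definition both_rising :: "'a state \<Rightarrow> 'a state \<Rightarrow> nat \<Rightarrow> nat \<Rightarrow> real \<Rightarrow> real \<Rightarrow> nat \<Rightarrow> nat \<Rightarrow> real \<Rightarrow> real \<Rightarrow> 'a list \<Rightarrow> bool" where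
  "both_rising p p' N r u w N' r' u' w' ys \<longleftrightarrow>
     rising (path p r ys) N u w \<and> rising (path p' r' ys) N' u' w' \<and>
     \<bar>pos (f p') - pos (f p)\<bar> \<le> 4 * u'"

lemma efficient_rising:
  assumes "p \<in> SA" "ys \<in> words A R" "efficient p N r u \<theta> ys" "4 \<le> N" "0 \<le> \<theta>" "4 * real N * \<theta> < u"
  shows "rising (path p r ys) N u (2 * real N * \<theta>) \<or>
    rising (\<lambda>i. mirror (path p r ys i)) N u (2 * real N * \<theta>)"
  using assms(3) by (intro rising_or_falling path_fd[OF assms(1,1,2)] assms(4-6)) (auto simp: efficient_def)

text \<open>The first conclusion uses efficiency from \<open>p\<close> only. It is what later makes
  the path from \<open>p'\<close> efficient, so that the second conclusion becomes available. The
  falling case is the rising one for the reflected map.\<close>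

lemma spread_aux:
  assumes p: "p \<in> SA" "p' \<in> SA" and R: "same_box R p p'" "N * r = R" "N' * r' = R"
    and ys: "ys \<in> words A R" and efficient: "efficient p N r u \<theta> ys"
    and N: "4 \<le> N" "0 \<le> \<theta>" "8 * real N * \<theta> < u" "0 < u" and w: "w = 2 * real N * \<theta>"
    and agR: "\<not> (rising (path p r ys) N u w \<and>
      (\<forall>i. real_of_int i < pos (f p) + u * (real j - 1) - 2 * w \<longrightarrow>
         fst (path p r ys N) i = fst (f p') i))"
    and agL: "\<not> (rising (\<lambda>i. mirror (path p r ys i)) N u w \<and>
      (\<forall>i. real_of_int i < pos (mirror (f p)) + u * (real j - 1) - 2 * w \<longrightarrow>
         fst (mirror (path p r ys N)) i = fst (mirror (f p')) i))"
  shows "(real N - real j - 1) * u \<le> wdf p' (up p' ys)"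
    and "\<lbrakk>efficient p' N' r' u' \<theta>' ys; 8 * real N' * \<theta>' < u'; 0 \<le> \<theta>'; w' = 2 * real N' * \<theta>';
      real N * u = real N' * u'; u \<le> u'; real j * u \<le> u'; 8 \<le> N'\<rbrakk> \<Longrightarrow>
      both_rising p p' N r u w N' r' u' w' ys \<or> lamp_qi.both_rising (\<lambda>p. mirror (f p)) p p' N r u w N' r' u' w' ys"
proof -
  have len: "length ys = R" using ys by (simp add: words_def)
  have eq: "path p' r' ys N' = path p r ys N" "path p' r' ys N' = f (up p' ys)"
    using same_box_up[OF R(1) ys] R(2,3) len by simp_all
  have fd: "fd (path p r ys 0) (path p r ys N)" "fd (path p' r' ys 0) (path p' r' ys N')"
    by (rule path_fd[OF p(1) p(1) ys], rule path_fd[OF p(2) p(2) ys])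
  have w': "w \<le> u / 4" "1 \<le> N" using N w by auto
  have wm: "wdf p' (up p' ys) = rwd (path p' r' ys 0) (path p' r' ys N')" using eq by simp
  have rf: "rising (path p r ys) N u w \<or> rising (\<lambda>i. mirror (path p r ys i)) N u w"
    using efficient_rising[OF p(1) ys efficient N(1,2)] N w by auto
  define C where "C u' \<theta>' w' \<longleftrightarrow> efficient p' N' r' u' \<theta>' ys \<and> 8 * real N' * \<theta>' < u' \<and> 0 \<le> \<theta>' \<and>
      w' = 2 * real N' * \<theta>' \<and> real N * u = real N' * u' \<and> u \<le> u' \<and> real j * u \<le> u' \<and> 8 \<le> N'"
    for u' \<theta>' w'
  have main: "(real N - real j - 1) * u \<le> wdf p' (up p' ys) \<and> (\<forall>u' \<theta>' w'. C u' \<theta>' w' \<longrightarrow>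
      both_rising p p' N r u w N' r' u' w' ys \<or> lamp_qi.both_rising (\<lambda>p. mirror (f p)) p p' N r u w N' r' u' w' ys)"
    using rf
  proof
    assume r: "rising (path p r ys) N u w"
    then obtain i where i: "real_of_int i < pos (path p r ys 0) + u * (real j - 1) - 2 * w"
       "fst (path p r ys N) i \<noteq> fst (path p' r' ys 0) i" using agR by auto
    note c = common_end[OF r w'(1) N(4) w'(2) fd eq(1) i]
    have "(real N - real j - 1) * u \<le> wdf p' (up p' ys)" using c(1) wm by simp
    moreover have "both_rising p p' N r u w N' r' u' w' ys"
      if *: "efficient p' N' r' u' \<theta>' ys" "8 * real N' * \<theta>' < u'" "0 \<le> \<theta>'" "w' = 2 * real N' * \<theta>'"
        "real N * u = real N' * u'" "u \<le> u'" "real j * u \<le> u'" "8 \<le> N'" for u' \<theta>' w'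
    proof -
      have "rising (path p' r' ys) N' u' w' \<or> rising (\<lambda>i. mirror (path p' r' ys i)) N' u' w'"
        using efficient_rising[OF p(2) ys *(1)] * mult_nonneg_nonneg[OF of_nat_0_le_iff[of N'] *(3)] by auto
      moreover have "w' \<le> u' / 4" using * by auto
      ultimately show ?thesis using c(2)[of u' w'] * r by (simp add: both_rising_def)
    qed
    ultimately show ?thesis unfolding C_def by blast
  next
    assume r: "rising (\<lambda>i. mirror (path p r ys i)) N u w"
    then obtain i where i: "real_of_int i < pos (mirror (path p r ys 0)) + u * (real j - 1) - 2 * w"
       "fst (mirror (path p r ys N)) i \<noteq> fst (mirror (path p' r' ys 0)) i" using agL by auto
    have fdm: "fd (mirror (path p r ys 0)) (mirror (path p r ys N))"
       "fd (mirror (path p' r' ys 0)) (mirror (path p' r' ys N'))" using fd by simp_all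
    have eqm: "mirror (path p' r' ys N') = mirror (path p r ys N)" using eq by simp
    note c = common_end[where P' = "\<lambda>i. mirror (path p' r' ys i)" and N' = N',
        OF r w'(1) N(4) w'(2) fdm eqm i]
    have "(real N - real j - 1) * u \<le> wdf p' (up p' ys)" using c(1) wm fd by simp
    moreover have "lamp_qi.both_rising (\<lambda>p. mirror (f p)) p p' N r u w N' r' u' w' ys"
      if *: "efficient p' N' r' u' \<theta>' ys" "8 * real N' * \<theta>' < u'" "0 \<le> \<theta>'" "w' = 2 * real N' * \<theta>'"
        "real N * u = real N' * u'" "u \<le> u'" "real j * u \<le> u'" "8 \<le> N'" for u' \<theta>' w'
    proof -
      have "rising (path p' r' ys) N' u' w' \<or> rising (\<lambda>i. mirror (path p' r' ys i)) N' u' w'"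
        using efficient_rising[OF p(2) ys *(1)] * mult_nonneg_nonneg[OF of_nat_0_le_iff[of N'] *(3)] by auto
      moreover have "w' \<le> u' / 4" using * by auto
      ultimately show ?thesis using c(2)[of u' w'] * r
        by (simp add: lamp_qi.both_rising_def[OF mirror_lamp_qi] disj_commute)
    qed
    ultimately show ?thesis unfolding C_def by blast
  qed
  then show "(real N - real j - 1) * u \<le> wdf p' (up p' ys)"
    and "\<lbrakk>efficient p' N' r' u' \<theta>' ys; 8 * real N' * \<theta>' < u'; 0 \<le> \<theta>'; w' = 2 * real N' * \<theta>';
      real N * u = real N' * u'; u \<le> u'; real j * u \<le> u'; 8 \<le> N'\<rbrakk> \<Longrightarrow>
      both_rising p p' N r u w N' r' u' w' ys \<or> lamp_qi.both_rising (\<lambda>p. mirror (f p)) p p' N r u w N' r' u' w' ys"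
    using main unfolding C_def by blast+
qed

end

context lamp_qi
begin

lemma mirror_agree_few:
  assumes e: "0 < e" and j: "1 \<le> j" "5 / 2 * e * ln (real (card B)) < real j * ln (real (card A))"
    and \<eta>: "0 < \<eta>"
  shows "\<exists>r0. \<forall>r\<ge>r0. \<forall>N>j. \<forall>\<theta>. 0 \<le> \<theta> \<and> 4 * real N * \<theta> < e * real r \<longrightarrow> (\<forall>p\<in>SA. \<forall>\<beta>.
    frac A (N * r) (\<lambda>ys. rising (\<lambda>i. mirror (path p r ys i)) N (e * real r) (2 * real N * \<theta>) \<and>
      (\<forall>i. real_of_int i < pos (mirror (f p)) + e * real r * (real j - 1) - 2 * (2 * real N * \<theta>) \<longrightarrow>
         fst (mirror (path p r ys N)) i = \<beta> i)) \<le> \<eta>)"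
  by (rule lamp_qi.few_agree[OF mirror_lamp_qi e j \<eta>])

lemma frac_inter3:
  assumes "1 - x \<le> frac A R P" "frac A R P1 \<le> y" "frac A R P2 \<le> y"
  shows "1 - x - 2 * y \<le> frac A R (\<lambda>ys. P ys \<and> \<not> P1 ys \<and> \<not> P2 ys)"
proof -
  have "frac A R (\<lambda>ys. P1 ys \<or> P2 ys) \<le> 2 * y" using frac_Un[of A R P1 P2] assms by linarith
  then have "1 - 2 * y \<le> frac A R (\<lambda>ys. \<not> (P1 ys \<or> P2 ys))"
    using frac_compl[OF finA Ane(1), of R "\<lambda>ys. P1 ys \<or> P2 ys"] by linarith
  then have "1 - x - 2 * y \<le> frac A R (\<lambda>ys. P ys \<and> \<not> (P1 ys \<or> P2 ys))"
    using frac_Int[OF finA Ane(1), of R P "\<lambda>ys. \<not> (P1 ys \<or> P2 ys)"] assms(1) by linarith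
  then show ?thesis by simp
qed

text \<open>Passing from \<open>p\<close> to \<open>p'\<close> loses up to \<open>j + 1\<close>
  blocks, where \<open>j\<close> depends only on \<open>e\<close> and the two alphabets. To leave
  the path from \<open>p'\<close> nearly extremal, this loss must be small relative to the whole
  length; therefore \<open>p\<close> is examined with \<open>2 ^ b\<close> times as many blocks. In
  this way nearly extremal behaviour at \<open>p\<close> spreads over the whole box, at the price of
  a coarser scale.\<close>

lemma spread:
  assumes e: "0 < e" "is_speed e" and cA: "2 \<le> card A"
    and N': "8 \<le> N'" and d': "0 < d'" "8 * real N' * d' < e" and \<eta>': "0 < \<eta>'"
  shows "\<exists>b N d \<eta>. N = N' * 2 ^ b \<and> 0 < d \<and> 8 * real N * d < e \<and> 0 < \<eta> \<and> \<eta> \<le> \<eta>' \<and>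
    (\<exists>k0. \<forall>k\<ge>k0. \<forall>p\<in>SA. 1 - \<eta> \<le> frac A (N * 2 ^ k) (efficient p N (2 ^ k) (e * 2 ^ k) (d * 2 ^ k)) \<longrightarrow>
      (\<forall>p'\<in>SA. same_box (N * 2 ^ k) p p' \<longrightarrow> 1 - \<eta>' \<le> frac A (N * 2 ^ k) (\<lambda>ys.
         both_rising p p' N (2 ^ k) (e * 2 ^ k) (2 * real N * (d * 2 ^ k))
           N' (2 ^ (b + k)) (e * 2 ^ (b + k)) (2 * real N' * (d' * 2 ^ (b + k))) ys \<or>
         lamp_qi.both_rising (\<lambda>p. mirror (f p)) p p' N (2 ^ k) (e * 2 ^ k) (2 * real N * (d * 2 ^ k))
           N' (2 ^ (b + k)) (e * 2 ^ (b + k)) (2 * real N' * (d' * 2 ^ (b + k))) ys)))"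
proof -
  obtain \<delta> k1 where \<delta>: "0 < \<delta>" and k1: "\<And>k p. \<lbrakk>k \<ge> k1; p \<in> SA;
      1 - \<delta> \<le> frac A (N' * 2 ^ k) (\<lambda>ys. (e - \<delta>) * real (N' * 2 ^ k) \<le> wdf p (up p ys))\<rbrakk> \<Longrightarrow>
      1 - \<eta>' / 4 \<le> frac A (N' * 2 ^ k) (efficient p N' (2 ^ k) (e * 2 ^ k) (d' * 2 ^ k))"
    using efficient_blocks[OF e, of N' d' "\<eta>' / 4"] N' d' \<eta>' by auto
  have lnA: "0 < ln (real (card A))" using cA by simp
  obtain j0 :: nat where j0: "5 / 2 * e * ln (real (card B)) / ln (real (card A)) < real j0"
    using reals_Archimedean2 by blast
  define j where "j = max 1 j0"
  have j: "1 \<le> j" "5 / 2 * e * ln (real (card B)) < real j * ln (real (card A))"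
  proof -
    have "5 / 2 * e * ln (real (card B)) / ln (real (card A)) < real j" using j0 by (simp add: j_def)
    then show "5 / 2 * e * ln (real (card B)) < real j * ln (real (card A))"
      using lnA by (simp add: divide_less_eq)
  qed (simp add: j_def)
  \<comment> \<open>The second bound keeps the loss of \<open>j + 1\<close> fine blocks below
    \<open>\<delta>\<close> times the whole length; the first lets \<open>j\<close> fine blocks fit
    into a coarse one.\<close>
  obtain b where b: "max (real j) ((real j + 1) * e / \<delta>) < 2 ^ b" using real_arch_pow[of "2::real" "max (real j) ((real j + 1) * e / \<delta>)"] by auto
  define N where "N = N' * 2 ^ b"
  have rN: "real N = real N' * 2 ^ b" by (simp add: N_def)
  have bN: "2 ^ b \<le> real N" using N' by (simp add: rN)
  have Nj: "real j < real N" "(real j + 1) * e / \<delta> < real N"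
    using b bN unfolding max_less_iff_conj by linarith+
  have N8: "8 \<le> N" using N' mult_le_mono[OF N', of 1 "2 ^ b"] by (simp add: N_def)
  define d where "d = e / (16 * real N)"
  \<comment> \<open>Three sets of words of proportion \<open>\<eta>\<close> are discarded:
    inefficient ones and those agreeing with \<open>f p'\<close> while rising or falling. So
    \<open>3 * \<eta> \<le> \<delta>\<close> and
    \<open>\<eta>' / 4 + 3 * \<eta> \<le> \<eta>'\<close> are needed.\<close>
  define \<eta> where "\<eta> = min (\<delta> / 4) (\<eta>' / 8)"
  have \<eta>: "0 < \<eta>" "\<eta> \<le> \<delta> / 4" "\<eta> \<le> \<eta>' / 8" using \<delta> \<eta>' by (auto simp: \<eta>_def)
  have d: "0 < d" "8 * real N * d = e / 2" using e N8 by (auto simp: d_def)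
  obtain r1 where r1: "\<And>r \<theta> p \<beta>. \<lbrakk>r \<ge> r1; 0 \<le> \<theta>; 4 * real N * \<theta> < e * real r; p \<in> SA\<rbrakk> \<Longrightarrow>
    frac A (N * r) (\<lambda>ys. rising (path p r ys) N (e * real r) (2 * real N * \<theta>) \<and>
      (\<forall>i. real_of_int i < pos (f p) + e * real r * (real j - 1) - 2 * (2 * real N * \<theta>) \<longrightarrow>
         fst (path p r ys N) i = \<beta> i)) \<le> \<eta>"
    using few_agree[OF e(1) j \<eta>(1)] Nj(1)[unfolded of_nat_less_iff] by blast
  obtain r2 where r2: "\<And>r \<theta> p \<beta>. \<lbrakk>r \<ge> r2; 0 \<le> \<theta>; 4 * real N * \<theta> < e * real r; p \<in> SA\<rbrakk> \<Longrightarrow>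
    frac A (N * r) (\<lambda>ys. rising (\<lambda>i. mirror (path p r ys i)) N (e * real r) (2 * real N * \<theta>) \<and>
      (\<forall>i. real_of_int i < pos (mirror (f p)) + e * real r * (real j - 1) - 2 * (2 * real N * \<theta>) \<longrightarrow>
         fst (mirror (path p r ys N)) i = \<beta> i)) \<le> \<eta>"
    using mirror_agree_few[OF e(1) j \<eta>(1)] Nj(1)[unfolded of_nat_less_iff] by blast
  define k0 where "k0 = Max {k1, r1, r2}"
  have main: "1 - \<eta>' \<le> frac A (N * 2 ^ k) (\<lambda>ys.
         both_rising p p' N (2 ^ k) (e * 2 ^ k) (2 * real N * (d * 2 ^ k))
           N' (2 ^ (b + k)) (e * 2 ^ (b + k)) (2 * real N' * (d' * 2 ^ (b + k))) ys \<or>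
         lamp_qi.both_rising (\<lambda>p. mirror (f p)) p p' N (2 ^ k) (e * 2 ^ k) (2 * real N * (d * 2 ^ k))
           N' (2 ^ (b + k)) (e * 2 ^ (b + k)) (2 * real N' * (d' * 2 ^ (b + k))) ys)"
    if k: "k \<ge> k0" and p: "p \<in> SA" "p' \<in> SA"
      and g: "1 - \<eta> \<le> frac A (N * 2 ^ k) (efficient p N (2 ^ k) (e * 2 ^ k) (d * 2 ^ k))"
      and box: "same_box (N * 2 ^ k) p p'" for k p p'
  proof -
    define r :: nat where "r = 2 ^ k"
    define r' :: nat where "r' = 2 ^ (b + k)"
    define u where "u = e * real r"
    define u' where "u' = e * real r'"
    define \<theta> where "\<theta> = d * real r"
    define \<theta>' where "\<theta>' = d' * real r'"
    define w where "w = 2 * real N * \<theta>"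
    define w' where "w' = 2 * real N' * \<theta>'"
    have r: "0 < real r" "r1 \<le> r" "r2 \<le> r"
    proof -
      have "k < r" by (simp add: r_def)
      then show "r1 \<le> r" "r2 \<le> r" using k by (auto simp: k0_def)
    qed (simp add: r_def)
    have rr: "N' * r' = N * r" "real r' = 2 ^ b * real r"
      by (simp_all add: N_def r_def r'_def power_add)
    have th: "0 \<le> \<theta>" "8 * real N * \<theta> < u" "0 \<le> \<theta>'" "8 * real N' * \<theta>' < u'"
    proof -
      have "8 * real N * \<theta> = (e / 2) * real r" by (simp only: \<theta>_def d(2)[symmetric] mult.assoc)
      also have "\<dots> < u" using e r by (simp add: u_def)
      finally show "8 * real N * \<theta> < u" .
      have "0 < real r'" by (simp add: r'_def)
      then have "(8 * real N' * d') * real r' < e * real r'" using d'(2) by (intro mult_strict_right_mono)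
      then show "8 * real N' * \<theta>' < u'" by (simp only: \<theta>'_def u'_def mult.assoc)
    qed (use d d' in \<open>simp_all add: \<theta>_def \<theta>'_def\<close>)
    have u: "0 < u" "real N * u = real N' * u'" "u \<le> u'" "real j * u \<le> u'"
    proof -
      show "0 < u" using e r by (simp add: u_def)
      show "real N * u = real N' * u'" by (simp add: u_def u'_def rr(2) rN)
      have uu: "u' = 2 ^ b * u" by (simp add: u_def u'_def rr(2))
      show "u \<le> u'" using \<open>0 < u\<close> by (simp add: uu)
      show "real j * u \<le> u'" using \<open>0 < u\<close> b by (simp add: uu less_imp_le)
    qed
    define agR where "agR = (\<lambda>ys. rising (path p r ys) N u w \<and>
      (\<forall>i. real_of_int i < pos (f p) + u * (real j - 1) - 2 * w \<longrightarrow> fst (path p r ys N) i = fst (f p') i))"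
    define agL where "agL = (\<lambda>ys. rising (\<lambda>i. mirror (path p r ys i)) N u w \<and>
      (\<forall>i. real_of_int i < pos (mirror (f p)) + u * (real j - 1) - 2 * w \<longrightarrow>
         fst (mirror (path p r ys N)) i = fst (mirror (f p')) i))"
    have th4: "4 * real N * \<theta> < e * real r"
    proof -
      have "4 * real N * \<theta> \<le> 8 * real N * \<theta>" using th(1) by (intro mult_right_mono) auto
      then show ?thesis using th(2) unfolding u_def by linarith
    qed
    have fR: "frac A (N * r) agR \<le> \<eta>"
      using r1[OF r(2) th(1) th4 p(1), of "fst (f p')"] by (simp add: agR_def u_def w_def)
    have fL: "frac A (N * r) agL \<le> \<eta>"
      using r2[OF r(3) th(1) th4 p(1), of "fst (mirror (f p'))"] by (simp add: agL_def u_def w_def)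
    have g': "1 - \<eta> \<le> frac A (N * r) (efficient p N r u \<theta>)" using g by (simp add: r_def u_def \<theta>_def)
    define G where "G = (\<lambda>ys. efficient p N r u \<theta> ys \<and> \<not> agR ys \<and> \<not> agL ys)"
    have G: "1 - \<eta> - 2 * \<eta> \<le> frac A (N * r) G"
      using frac_inter3[OF g' fR fL] by (simp add: G_def)
    note aux = spread_aux[OF p box[folded r_def] refl rr(1), of _ u \<theta> w j]
    have N4: "4 \<le> N" using N8 by simp
    have sep: "(real N - real j - 1) * u \<le> wdf p' (up p' ys)"
      if "ys \<in> words A (N * r)" "G ys" for ys
      using aux(1)[OF that(1) _ N4 th(1,2) u(1) w_def] that(2) unfolding G_def agR_def agL_def by blast
    have close: "both_rising p p' N r u w N' r' u' w' ys \<or>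
        lamp_qi.both_rising (\<lambda>p. mirror (f p)) p p' N r u w N' r' u' w' ys"
      if "ys \<in> words A (N * r)" "G ys" "efficient p' N' r' u' \<theta>' ys" for ys
      using aux(2)[OF that(1) _ N4 th(1,2) u(1) w_def _ _ that(3) th(4,3) w'_def u(2-4) N'] that(2)
      unfolding G_def agR_def agL_def by blast
    have "1 - \<delta> \<le> 1 - \<eta> - 2 * \<eta>" using \<eta> \<delta> by simp
    also note G
    also have "frac A (N * r) G \<le> frac A (N' * r') (\<lambda>ys. (e - \<delta>) * real (N' * r') \<le> wdf p' (up p' ys))"
      unfolding rr(1)
    proof (rule frac_mono)
      fix ys assume ys: "ys \<in> words A (N * r)" "G ys"
      have "(e - \<delta>) * real (N * r) = (real N * e - real N * \<delta>) * real r" by (simp add: algebra_simps)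
      also have "\<dots> \<le> (real N * e - (real j + 1) * e) * real r"
        using Nj(2) \<delta> by (intro mult_right_mono) (auto simp: field_simps)
      also have "\<dots> = (real N - real j - 1) * u" by (simp add: u_def algebra_simps)
      also have "\<dots> \<le> wdf p' (up p' ys)" by (rule sep[OF ys])
      finally show "(e - \<delta>) * real (N * r) \<le> wdf p' (up p' ys)" .
    qed
    finally have "1 - \<delta> \<le> frac A (N' * 2 ^ (b + k)) (\<lambda>ys. (e - \<delta>) * real (N' * 2 ^ (b + k)) \<le> wdf p' (up p' ys))"
      by (simp only: r'_def)
    from k1[OF _ p(2) this] k have "1 - \<eta>' / 4 \<le> frac A (N' * r') (efficient p' N' r' u' \<theta>')"
      by (simp add: k0_def r'_def u'_def \<theta>'_def)
    then have "1 - \<eta>' \<le> frac A (N * r) G + frac A (N * r) (efficient p' N' r' u' \<theta>') - 1"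
      using G \<eta> \<eta>' unfolding rr(1) by linarith
    also have "\<dots> \<le> frac A (N * r) (\<lambda>ys. G ys \<and> efficient p' N' r' u' \<theta>' ys)"
      by (rule frac_Int[OF finA Ane(1)])
    also have "\<dots> \<le> frac A (N * r) (\<lambda>ys. both_rising p p' N r u w N' r' u' w' ys \<or>
        lamp_qi.both_rising (\<lambda>p. mirror (f p)) p p' N r u w N' r' u' w' ys)"
      using close by (intro frac_mono) blast
    finally show ?thesis
      by (simp add: r_def u_def w_def r'_def u'_def w'_def \<theta>_def \<theta>'_def)
  qed
  have "\<eta> \<le> \<eta>'" using \<eta> \<eta>' by simp
  then show ?thesis
    using main d \<eta>(1) e(1) N_def by (intro exI[of _ b] exI[of _ N] exI[of _ d] exI[of _ \<eta>] conjI exI[of _ k0]) auto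
qed

end

section \<open>The speed of random walks\<close>

lemma card_le_fibres:
  assumes "finite T" "\<And>x. x \<in> S \<Longrightarrow> g x \<in> T" "\<And>y. y \<in> T \<Longrightarrow> finite {x\<in>S. g x = y} \<and> card {x\<in>S. g x = y} \<le> k"
  shows "card S \<le> k * card T"
proof -
  have "S = (\<Union>y\<in>T. {x\<in>S. g x = y})" using assms(2) by auto
  then have "card S \<le> (\<Sum>y\<in>T. card {x\<in>S. g x = y})" using card_UN_le[OF assms(1)] by metis
  also have "\<dots> \<le> (\<Sum>y\<in>T. k)" using assms(3) by (intro sum_mono) blast
  finally show ?thesis by (simp add: mult.commute)
qed

definition overwrite :: "'a state \<Rightarrow> 'a list \<Rightarrow> 'a state" where
  "overwrite p xs = (fst (up p xs), snd p)"

lemma overwrite_sel [simp]: "snd (overwrite p xs) = snd p" "fst (overwrite p xs) = fst (up p xs)"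
  by (simp_all add: overwrite_def)

context lamp_qi
begin

lemma overwrite_SA: "p \<in> SA \<Longrightarrow> xs \<in> words A R \<Longrightarrow> overwrite p xs \<in> SA"
  using words_up[of p xs R] by (auto simp: states_def)

lemma overwrite_box: "xs \<in> words A R \<Longrightarrow> same_box R p (overwrite p xs)"
  by (auto simp: same_box_def fst_up words_def)

end

text \<open>The box of a nearly extremal \<open>p\<close>. Its middle is at length \<open>S\<close>,
  after \<open>h\<close> coarse blocks; a coarse block consists of \<open>c\<close> fine ones, and
  \<open>M\<close> is half the width of the image window in coarse steps. By \<open>small\<close>,
  rewriting the window moves a preimage by at most half the box.\<close>

locale rising_box = lamp_qi +
  fixes p :: "'a state" and N r :: nat and u w :: real and N' r' :: nat and u' w' :: real
    and c h M R S :: nat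
  assumes p: "p \<in> states A a0"
    and many: "\<And>xs. xs \<in> words A R \<Longrightarrow> 3 / 10 \<le> frac A R (both_rising p (overwrite p xs) N r u w N' r' u' w')"
    and R: "R = N * r" "R = N' * r'" "R = 2 * S" "S = h * r'" "r' = c * r" "N = N' * c" "N' = 2 * h"
    and u: "0 < u" "u' = real c * u" "u \<le> u'" "0 \<le> w" "w \<le> u / 4" "0 \<le> w'" "w' \<le> u' / 4"
    and M: "8 \<le> M" "M < h" and c: "1 \<le> c"
    and small: "real_of_int K * (real_of_int K + 2 * real M * u' + 2) + real_of_int K \<le> real S"
begin

abbreviation "t \<equiv> snd p"
abbreviation "good xs ys \<equiv> both_rising p (overwrite p xs) N r u w N' r' u' w' ys"
text \<open>A state in the middle of the box: the first half of \<open>ys\<close> is written, the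
  second half of \<open>xs\<close> is still untouched.\<close>

abbreviation "z xs ys \<equiv> up (overwrite p xs) (take S ys)"

text \<open>Double counting of good pairs. The word \<open>y0\<close> obtained here is a probe:
  written from different starting points, it erases what they have in their lower parts.\<close>

lemma exists_common_word:
  "\<exists>y0\<in>words A R. 3 / 10 * real (card A) ^ R \<le> card {xs \<in> words A R. good xs y0}"
proof (rule ccontr)
  assume "\<not> ?thesis"
  then have lt: "real (card {xs \<in> words A R. good xs y}) < 3 / 10 * real (card A) ^ R"
    if "y \<in> words A R" for y using that by force
  let ?W = "words A R"
  have "replicate R a0 \<in> ?W" using a0 by (auto simp: words_def)
  then have W: "finite ?W" "card ?W = card A ^ R" "?W \<noteq> {}"
    using words_card[OF finA] by blast+
  have "(\<Sum>y\<in>?W. real (card {xs \<in> ?W. good xs y})) < (\<Sum>y\<in>?W. 3 / 10 * real (card A) ^ R)"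
    using W lt by (intro sum_strict_mono) auto
  also have "\<dots> = 3 / 10 * real (card A) ^ R * real (card A) ^ R" by (simp add: W)
  also have "\<dots> = (\<Sum>xs\<in>?W. 3 / 10 * real (card A) ^ R)" by (simp add: W)
  also have "\<dots> \<le> (\<Sum>xs\<in>?W. real (card {y \<in> ?W. good xs y}))"
  proof (rule sum_mono)
    fix xs assume "xs \<in> ?W"
    then show "3 / 10 * real (card A) ^ R \<le> real (card {y \<in> ?W. good xs y})"
      using many[of xs] Ane(2) by (simp add: frac_card field_simps)
  qed
  also have "\<dots> = (\<Sum>y\<in>?W. real (card {xs \<in> ?W. good xs y}))"
  proof -
    have "(\<Sum>xs\<in>?W. real (card {y \<in> ?W. good xs y})) = (\<Sum>xs\<in>?W. \<Sum>y\<in>?W. of_bool (good xs y))"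
      using W(1) by (simp add: Int_def)
    also have "\<dots> = (\<Sum>y\<in>?W. \<Sum>xs\<in>?W. of_bool (good xs y))" by (rule sum.swap)
    finally show ?thesis using W(1) by (simp add: Int_def)
  qed
  finally show False by simp
qed

lemma snd_z: "ys \<in> words A R \<Longrightarrow> snd (z xs ys) = t + int S"
  using R by (simp add: words_def)

lemma fst_z:
  assumes "xs \<in> words A R" "ys \<in> words A R"
  shows "fst (z xs ys) i = (if t \<le> i \<and> i < t + int S then ys ! nat (i - t)
     else if t + int S \<le> i \<and> i < t + int R then xs ! nat (i - t) else fst p i)"
  using assms R(3) by (auto simp: fst_up words_def)

lemma z_SA: "xs \<in> words A R \<Longrightarrow> ys \<in> words A R \<Longrightarrow> z xs ys \<in> SA"
  by (rule up_take_SA[OF overwrite_SA[OF p]])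

lemma z_inj:
  assumes "xs \<in> words A R" "ys \<in> words A R" "xs' \<in> words A R" "ys' \<in> words A R"
    "z xs ys = z xs' ys'"
  shows "take S ys = take S ys'" "drop S xs = drop S xs'"
proof -
  have e: "fst (z xs ys) i = fst (z xs' ys') i" for i using assms(5) by simp
  show "take S ys = take S ys'"
  proof (rule nth_equalityI)
    fix k assume "k < length (take S ys)"
    then show "take S ys ! k = take S ys' ! k"
      using e[of "t + int k"] fst_z[OF assms(1,2)] fst_z[OF assms(3,4)] by simp
  qed (use assms in \<open>simp add: words_def\<close>)
  show "drop S xs = drop S xs'"
  proof (rule nth_equalityI)
    fix k assume "k < length (drop S xs)"
    then have k: "S + k < R" using assms(1) by (simp add: words_def)
    then have "xs ! (S + k) = xs' ! (S + k)"
      using e[of "t + int (S + k)"] fst_z[OF assms(1,2)] fst_z[OF assms(3,4)]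
      by (simp add: nat_int_add)
    then show "drop S xs ! k = drop S xs' ! k" using k assms(1,3) by (simp add: words_def)
  qed (use assms in \<open>simp add: words_def\<close>)
qed

definition p0 :: real where "p0 = pos (f p)"
definition l :: int where "l = \<lfloor>p0 + u' * real h - u' * real M\<rfloor>"
definition v :: int where "v = \<lceil>p0 + u' * real h + u' * real M\<rceil>"

lemma lv: "real_of_int l \<le> p0 + u' * real h - u' * real M" "p0 + u' * real h - u' * real M < real_of_int l + 1"
  "p0 + u' * real h + u' * real M \<le> real_of_int v" "real_of_int v < p0 + u' * real h + u' * real M + 1"
  unfolding l_def v_def by linarith+

lemma u'_pos: "0 < u'" using u by linarith

lemma M_u': "8 * u' \<le> u' * real M"
  using M u'_pos by simp

definition window :: "'b list \<Rightarrow> 'b state \<Rightarrow> 'b state" where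
  "window om s = (\<lambda>i. if l \<le> i \<and> i < v then om ! nat (i - l) else fst s i, snd s)"

lemma good_mid:
  assumes xs: "xs \<in> words A R" and ys: "ys \<in> words A R" and g: "good xs ys" and i: "1 \<le> i" "i < N'"
  defines "a \<equiv> rlo (f (overwrite p xs)) (f (up p ys))"
  shows "p0 - 21 / 4 * u' \<le> a" "a \<le> p0 + 4 * u'"
    "\<bar>pos (path (overwrite p xs) r' ys i) - (a + u' * real i)\<bar> \<le> u' / 4"
    "\<And>k. real_of_int k < a + u' * real i - u' / 4 \<Longrightarrow> fst (path (overwrite p xs) r' ys i) k = fst (f (up p ys)) k"
    "\<And>k. a + u' * real i + u' / 4 \<le> real_of_int k \<Longrightarrow>
       fst (path (overwrite p xs) r' ys i) k = fst (f (overwrite p xs)) k"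
proof -
  have len: "length ys = N' * r'" using ys R by (simp add: words_def)
  have T: "path (overwrite p xs) r' ys N' = f (up p ys)"
    using same_box_up[OF overwrite_box[OF xs] ys, of p] len by simp
  have ri: "rising (path (overwrite p xs) r' ys) N' u' w'"
    and cl: "\<bar>pos (f (overwrite p xs)) - p0\<bar> \<le> 4 * u'"
    using g by (auto simp: both_rising_def p0_def)
  have "a \<le> pos (f (overwrite p xs))" "pos (f (overwrite p xs)) \<le> a + u' + w'"
    using ri lo_le(1)[OF ffd[OF overwrite_SA[OF p xs] words_up[OF p ys]]] T
    by (auto simp: rising_def a_def)
  \<comment> \<open>\<open>21 / 4\<close> is 4 for the distance of the two starting heads and
    \<open>1 + 1 / 4\<close> for the distance of a starting head from the lower end of its
    hull.\<close>
  then show "p0 - 21 / 4 * u' \<le> a" "a \<le> p0 + 4 * u'" using cl u by auto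
  have "\<bar>pos (path (overwrite p xs) r' ys i) - (a + u' * real i)\<bar> \<le> w' \<and>
    (\<forall>k. real_of_int k < a + u' * real i - w' \<longrightarrow> fst (path (overwrite p xs) r' ys i) k = fst (f (up p ys)) k) \<and>
    (\<forall>k. a + u' * real i + w' \<le> real_of_int k \<longrightarrow>
       fst (path (overwrite p xs) r' ys i) k = fst (f (overwrite p xs)) k)"
    using ri i T unfolding rising_def a_def by simp
  then show "\<bar>pos (path (overwrite p xs) r' ys i) - (a + u' * real i)\<bar> \<le> u' / 4"
    "\<And>k. real_of_int k < a + u' * real i - u' / 4 \<Longrightarrow> fst (path (overwrite p xs) r' ys i) k = fst (f (up p ys)) k"
    "\<And>k. a + u' * real i + u' / 4 \<le> real_of_int k \<Longrightarrow>
       fst (path (overwrite p xs) r' ys i) k = fst (f (overwrite p xs)) k"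
    using u by auto
qed

lemma h: "1 \<le> h" "h < N'" "1 \<le> h - M" "h - M < N'" "h + M < N'"
  using M R(7) by auto

lemma mid_eq: "path (overwrite p xs) r' ys h = f (z xs ys)"
  using R(4) by simp

text \<open>Below the window the image already shows the common end, which depends on
  \<open>ys\<close> only; above it the image still shows the start, which depends on
  \<open>xs\<close> only. The margin \<open>8 \<le> M\<close> absorbs the uncertainty of the
  hull.\<close>

lemma good_head:
  assumes xs: "xs \<in> words A R" and ys: "ys \<in> words A R" and g: "good xs ys"
  shows "l \<le> snd (f (z xs ys))" "snd (f (z xs ys)) \<le> v"
    "\<And>k. k < l \<Longrightarrow> fst (f (z xs ys)) k = fst (f (up p ys)) k"
    "\<And>k. v \<le> k \<Longrightarrow> fst (f (z xs ys)) k = fst (f (overwrite p xs)) k"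
proof -
  note G = good_mid[OF assms h(1,2), unfolded mid_eq]
  have "real_of_int l \<le> pos (f (z xs ys))" "pos (f (z xs ys)) \<le> real_of_int v"
    using G(1-3) lv M_u' u'_pos by linarith+
  then show "l \<le> snd (f (z xs ys))" "snd (f (z xs ys)) \<le> v" by simp_all
  fix k
  show "fst (f (z xs ys)) k = fst (f (up p ys)) k" if "k < l"
  proof (rule G(4))
    have "real_of_int k \<le> real_of_int l - 1" using that by linarith
    then show "real_of_int k < rlo (f (overwrite p xs)) (f (up p ys)) + u' * real h - u' / 4"
      using G(1-3) lv M_u' u'_pos by linarith
  qed
  show "fst (f (z xs ys)) k = fst (f (overwrite p xs)) k" if "v \<le> k"
  proof (rule G(5))
    have "real_of_int v \<le> real_of_int k" using that by linarith
    then show "rlo (f (overwrite p xs)) (f (up p ys)) + u' * real h + u' / 4 \<le> real_of_int k"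
      using G(1-3) lv M_u' u'_pos by linarith
  qed
qed

lemma window_SB: "s \<in> SB \<Longrightarrow> om \<in> words B (nat (v - l)) \<Longrightarrow> window om s \<in> SB"
proof -
  assume s: "s \<in> SB" and om: "om \<in> words B (nat (v - l))"
  have "fst (window om s) i \<in> B" for i
    using s om nth_mem[of "nat (i - l)" om] by (auto simp: window_def states_def words_def)
  moreover have "{i. fst (window om s) i \<noteq> b0} \<subseteq> {l..<v} \<union> {i. fst s i \<noteq> b0}"
    by (auto simp: window_def)
  then have "finite {i. fst (window om s) i \<noteq> b0}"
    by (rule finite_subset) (use s in \<open>simp add: states_def\<close>)
  ultimately show ?thesis by (simp add: states_def)
qed

definition Zbox :: "'a state set" where "Zbox = box A a0 t (t + int R) (fst p) (fst p)"

lemma Zbox_card: "finite Zbox" "card Zbox \<le> (R + 1) * card A ^ R"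
  using box_card[OF finA, of t "t + int R" a0 "fst p" "fst p"] by (simp_all add: Zbox_def)

text \<open>The rewritten state is near the image of some \<open>x\<close>, and by
  \<open>small\<close> this \<open>x\<close> is within \<open>S\<close> of a state whose head is in
  the centre of the box. So every lamp in which \<open>x\<close> differs, and its head, stay inside
  the box.\<close>

lemma window_cover:
  assumes xs: "xs \<in> words A R" and ys: "ys \<in> words A R" and g: "good xs ys"
    and om: "om \<in> words B (nat (v - l))"
  shows "\<exists>x\<in>Zbox. wd (f x) (window om (f (z xs ys))) \<le> K"
proof -
  let ?s = "f (z xs ys)" let ?q = "window om ?s"
  have s: "?s \<in> SB" by (rule f_in[OF z_SA[OF xs ys]])
  have q: "?q \<in> SB" by (rule window_SB[OF s om])
  obtain x where x: "x \<in> SA" "wd (f x) ?q \<le> K" using f_onto[OF q] by blast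
  have "wd ?q ?s \<le> v - l"
    using good_head(1,2)[OF xs ys g] by (intro wd_le states_fd[OF q s]) (auto simp: window_def)
  then have "wd (f x) ?s \<le> K + (v - l)"
    using wd_triangle[OF states_fd[OF f_in[OF x(1)] q] states_fd[OF q s]] x(2) by linarith
  then have "wd x (z xs ys) \<le> K * (K + (v - l)) + K"
    using f_ge[OF x(1) z_SA[OF xs ys]] K mult_left_mono[of "wd (f x) ?s" "K + (v - l)" K] by linarith
  also have "\<dots> \<le> int S"
  proof -
    have "real_of_int (v - l) \<le> 2 * real M * u' + 2" using lv by (simp add: algebra_simps)
    then have "real_of_int K * (real_of_int K + real_of_int (v - l)) + real_of_int K \<le>
        real_of_int K * (real_of_int K + 2 * real M * u' + 2) + real_of_int K"
      using K by (intro add_right_mono mult_left_mono) auto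
    also note small
    finally have "real_of_int (K * (K + (v - l)) + K) \<le> real_of_int (int S)" by simp
    then show ?thesis by (simp only: of_int_le_iff)
  qed
  finally have wx: "wd x (z xs ys) \<le> int S" .
  note fd = states_fd[OF x(1) z_SA[OF xs ys]]
  have lo: "t \<le> lo x (z xs ys)" "hi x (z xs ys) \<le> t + int R"
    using wx lo_le(2)[OF fd] hi_ge(2)[OF fd] snd_z[OF ys, of xs] R(3) by (auto simp: wd_def)
  have "x \<in> Zbox"
    unfolding Zbox_def box_def
  proof (intro CollectI conjI allI impI)
    show "t \<le> snd x" "snd x \<le> t + int R" using lo lo_le(1)[OF fd] hi_ge(1)[OF fd] by auto
    fix i
    show "fst x i = fst p i" if "i < t"
      using agree_below[OF fd, of i] lo that fst_z[OF xs ys, of i] by auto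
    show "fst x i = fst p i" if "t + int R \<le> i"
      using agree_above[OF fd, of i] lo that fst_z[OF xs ys, of i] R(3) by auto
  qed fact
  with x(2) show ?thesis by blast
qed

lemma good_base:
  assumes ys: "ys \<in> words A R" and g: "good xs ys" and i: "1 \<le> i" "i < N'"
  defines "a \<equiv> rlo (f p) (f (up p ys))"
  shows "a \<le> p0" "p0 \<le> a + u + w"
    "\<bar>pos (f (up p (take (i * r') ys))) - (a + u' * real i)\<bar> \<le> w"
    "\<And>k. real_of_int k < a + u' * real i - w \<Longrightarrow> fst (f (up p (take (i * r') ys))) k = fst (f (up p ys)) k"
    "\<And>k. a + u' * real i + w \<le> real_of_int k \<Longrightarrow> fst (f (up p (take (i * r') ys))) k = fst (f p) k"
proof -
  have len: "length ys = N * r" using ys R by (simp add: words_def)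
  have T: "path p r ys N = f (up p ys)" using len by simp
  have P: "path p r ys (i * c) = f (up p (take (i * r') ys))" by (simp add: R(5) mult.assoc)
  have ic: "1 \<le> i * c" "i * c < N" "u * real (i * c) = u' * real i"
    using i c R(6) u(2) by (simp_all add: Suc_le_eq)
  have ri: "rising (path p r ys) N u w" using g by (simp add: both_rising_def)
  then show "p0 \<le> a + u + w" unfolding rising_def T by (simp add: p0_def a_def)
  show "a \<le> p0" using lo_le(1)[OF ffd[OF p words_up[OF p ys]]] by (simp add: a_def p0_def)
  have "\<bar>pos (path p r ys (i * c)) - (a + u * real (i * c))\<bar> \<le> w \<and>
    (\<forall>k. real_of_int k < a + u * real (i * c) - w \<longrightarrow> fst (path p r ys (i * c)) k = fst (f (up p ys)) k) \<and>
    (\<forall>k. a + u * real (i * c) + w \<le> real_of_int k \<longrightarrow> fst (path p r ys (i * c)) k = fst (f p) k)"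
  proof -
    have a: "rlo (path p r ys 0) (f (up p ys)) = a" by (simp add: a_def)
    have "path p r ys 0 = f p" by simp
    then show ?thesis using ri ic(1,2) unfolding rising_def T a by metis
  qed
  then show "\<bar>pos (f (up p (take (i * r') ys))) - (a + u' * real i)\<bar> \<le> w"
    "\<And>k. real_of_int k < a + u' * real i - w \<Longrightarrow> fst (f (up p (take (i * r') ys))) k = fst (f (up p ys)) k"
    "\<And>k. a + u' * real i + w \<le> real_of_int k \<Longrightarrow> fst (f (up p (take (i * r') ys))) k = fst (f p) k"
    unfolding P ic(3) by blast+
qed

definition l1 :: int where "l1 = \<lfloor>p0 + u' * real (h - M) - u - 2 * w\<rfloor>"
definition v1 :: int where "v1 = \<lceil>p0 + u' * real (h - M) + w\<rceil>"
definition l2 :: int where "l2 = \<lfloor>p0 + u' * real (h + M) - 6 * u'\<rfloor>"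
definition v2 :: int where "v2 = \<lceil>p0 + u' * real (h + M) + 5 * u'\<rceil>"

lemma lv12: "real_of_int l1 \<le> p0 + u' * real (h - M) - u - 2 * w" "p0 + u' * real (h - M) + w \<le> real_of_int v1"
  "real_of_int l2 \<le> p0 + u' * real (h + M) - 6 * u'" "p0 + u' * real (h + M) + 5 * u' \<le> real_of_int v2"
  "real_of_int (v1 - l1) \<le> 2 * u' + 2" "real_of_int (v2 - l2) \<le> 11 * u' + 2" "l1 \<le> v1" "l2 \<le> v2"
proof -
  have a: "p0 + u' * real (h - M) - u - 2 * w < real_of_int l1 + 1" "real_of_int v1 < p0 + u' * real (h - M) + w + 1"
    "p0 + u' * real (h + M) - 6 * u' < real_of_int l2 + 1" "real_of_int v2 < p0 + u' * real (h + M) + 5 * u' + 1"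
    unfolding l1_def v1_def l2_def v2_def by linarith+
  show b: "real_of_int l1 \<le> p0 + u' * real (h - M) - u - 2 * w" "p0 + u' * real (h - M) + w \<le> real_of_int v1"
    "real_of_int l2 \<le> p0 + u' * real (h + M) - 6 * u'" "p0 + u' * real (h + M) + 5 * u' \<le> real_of_int v2"
    unfolding l1_def v1_def l2_def v2_def by linarith+
  show "real_of_int (v1 - l1) \<le> 2 * u' + 2" "real_of_int (v2 - l2) \<le> 11 * u' + 2"
    unfolding of_int_diff using a u u'_pos by linarith+
  have "real_of_int l1 \<le> real_of_int v1" "real_of_int l2 \<le> real_of_int v2" using b u u'_pos by linarith+
  then show "l1 \<le> v1" "l2 \<le> v2" by simp_all
qed

text \<open>Here the walk starts at \<open>p\<close> itself and is known at the fine scale. Its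
  image after \<open>h - M\<close> coarse blocks has final, hence prescribed, lamps below and those
  of \<open>f p\<close> above, in a box of length about \<open>2 * u'\<close>. So the lower part of
  a middle state has few possibilities.\<close>

lemma good_prefix:
  assumes xs: "xs \<in> words A R" and ys: "ys \<in> words A R" and g: "good xs ys"
    and q: "\<And>i. i < l \<Longrightarrow> fst (f (z xs ys)) i = \<alpha> i"
  shows "f (up p (take ((h - M) * r') ys)) \<in> box B b0 l1 v1 \<alpha> (fst (f p))"
  unfolding box_def
proof (intro CollectI conjI allI impI)
  note G = good_base[OF ys g h(3,4)]
  let ?s = "f (up p (take ((h - M) * r') ys))"
  have uM: "u' * real (h - M) = u' * real h - u' * real M" using M by (simp add: of_nat_diff algebra_simps)
  show "?s \<in> SB" by (rule f_in[OF up_take_SA[OF p ys]])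
  have "real_of_int l1 \<le> pos ?s" "pos ?s \<le> real_of_int v1" using G(1-3) lv12 u by linarith+
  then show "l1 \<le> snd ?s" "snd ?s \<le> v1" by simp_all
  fix i
  show "fst ?s i = \<alpha> i" if "i < l1"
  proof -
    have i: "real_of_int i \<le> real_of_int l1 - 1" using that by linarith
    have "fst ?s i = fst (f (up p ys)) i" using i G(1-3) lv12 u by (intro G(4)) linarith
    moreover have "real_of_int i < real_of_int l" using i lv lv12 u uM by linarith
    ultimately show ?thesis using good_head(3)[OF xs ys g, of i] q[of i] by simp
  qed
  show "fst ?s i = fst (f p) i" if "v1 \<le> i"
  proof -
    have i: "real_of_int v1 \<le> real_of_int i" using that by linarith
    then show ?thesis using G(1-3) lv12 u by (intro G(5)) linarith
  qed
qed

text \<open>Writing \<open>y0\<close> removes the first \<open>h + M\<close> coarse blocks of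
  \<open>xs\<close> from the state. Its image then has the lamps of \<open>f (up p y0)\<close> below
  and prescribed lamps above, so the upper part of a middle state has few possibilities. Only the
  coarse scale is available at this starting point, hence the longer box of about
  \<open>11 * u'\<close>.\<close>

lemma good_suffix:
  assumes xs: "xs \<in> words A R" and ys: "ys \<in> words A R" and g: "good xs ys"
    and y0: "y0 \<in> words A R" "good xs y0"
    and q: "\<And>i. v \<le> i \<Longrightarrow> fst (f (z xs ys)) i = \<gamma> i"
  shows "f (up (overwrite p xs) (take ((h + M) * r') y0)) \<in> box B b0 l2 v2 (fst (f (up p y0))) \<gamma>"
  unfolding box_def
proof (intro CollectI conjI allI impI)
  have i2: "1 \<le> h + M" using M by simp
  note G = good_mid[OF xs y0 i2 h(5)]
  let ?s = "path (overwrite p xs) r' y0 (h + M)"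
  have uM: "u' * real (h + M) = u' * real h + u' * real M" by (simp add: algebra_simps)
  show "?s \<in> SB" by (rule f_in[OF up_take_SA[OF overwrite_SA[OF p xs] y0(1)]])
  have "real_of_int l2 \<le> pos ?s" "pos ?s \<le> real_of_int v2" using G(1-3) lv12 u'_pos by linarith+
  then show "l2 \<le> snd ?s" "snd ?s \<le> v2" by simp_all
  fix i
  show "fst ?s i = fst (f (up p y0)) i" if "i < l2"
  proof -
    have "real_of_int i < real_of_int l2" using that by linarith
    then show ?thesis using G(1-3) lv12 u'_pos by (intro G(4)) linarith
  qed
  show "fst ?s i = \<gamma> i" if "v2 \<le> i"
  proof -
    have i: "real_of_int v2 \<le> real_of_int i" using that by linarith
    have "fst ?s i = fst (f (overwrite p xs)) i" using i G(1-3) lv12 u'_pos by (intro G(5)) linarith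
    moreover have "real_of_int v < real_of_int i + 1" using i lv lv12 u'_pos uM by linarith
    then have "v \<le> i" by linarith
    ultimately show ?thesis using good_head(4)[OF xs ys g, of i] q[of i] by simp
  qed
qed

definition class_bound :: nat where
  "class_bound = (mult_dom * ((nat (v1 - l1) + 1) * card B ^ nat (v1 - l1))) * (card A ^ (2 * M * r') *
     (mult_dom * ((nat (v2 - l2) + 1) * card B ^ nat (v2 - l2))))"

text \<open>Middle states whose images agree outside the window are cut at \<open>i1\<close> and
  \<open>i2\<close>, that is, \<open>M\<close> coarse blocks below and above the head. The lower
  part is controlled by \<open>good_prefix\<close>, the upper part by \<open>good_suffix\<close>,
  and the \<open>2 * M * r'\<close> lamps between are left free.\<close>

lemma class_card:
  assumes y0: "y0 \<in> words A R"
    and Z: "\<And>zz. zz \<in> Z \<Longrightarrow> \<exists>xs\<in>words A R. \<exists>ys\<in>words A R. zz = z xs ys \<and> good xs ys \<and> good xs y0"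
    and q: "\<And>zz i. zz \<in> Z \<Longrightarrow> i < l \<Longrightarrow> fst (f zz) i = \<alpha> i" "\<And>zz i. zz \<in> Z \<Longrightarrow> v \<le> i \<Longrightarrow> fst (f zz) i = \<gamma> i"
  shows "finite Z \<and> card Z \<le> class_bound"
proof -
  define i1 where "i1 = (h - M) * r'"
  define i2 where "i2 = (h + M) * r'"
  have i12: "i1 + 2 * M * r' = i2" "i1 \<le> S" "S \<le> i2" "i2 \<le> R"
  proof -
    have "h - M + 2 * M = h + M" using M by simp
    then show "i1 + 2 * M * r' = i2" unfolding i1_def i2_def by (metis add_mult_distrib)
    show "i1 \<le> S" "S \<le> i2" by (simp_all add: i1_def i2_def R(4))
    show "i2 \<le> R" unfolding i2_def R(2) using h(5) by (intro mult_le_mono1) simp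
  qed
  define Y1 where "Y1 = {us \<in> words A i1. f (up p us) \<in> box B b0 l1 v1 \<alpha> (fst (f p))}"
  define X1 where "X1 = {x \<in> SA. f x \<in> box B b0 l2 v2 (fst (f (up p y0))) \<gamma>}"
  define cut where "cut = (\<lambda>(zz::'a state) (a::nat) b. map (\<lambda>k. fst zz (t + int k)) [a..<b])"
  define \<phi> where "\<phi> = (\<lambda>zz. (cut zz 0 i1, cut zz i1 i2, up (fst zz, t) (take i2 y0)))"
  have box1: "finite (box B b0 l1 v1 \<alpha> (fst (f p)))"
     "card (box B b0 l1 v1 \<alpha> (fst (f p))) \<le> (nat (v1 - l1) + 1) * card B ^ nat (v1 - l1)"
    by (rule box_card[OF finB lv12(7)])+
  have box2: "finite (box B b0 l2 v2 (fst (f (up p y0))) \<gamma>)"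
     "card (box B b0 l2 v2 (fst (f (up p y0))) \<gamma>) \<le> (nat (v2 - l2) + 1) * card B ^ nat (v2 - l2)"
    by (rule box_card[OF finB lv12(8)])+
  have cY: "card Y1 \<le> mult_dom * card (box B b0 l1 v1 \<alpha> (fst (f p)))"
    by (rule card_words_preimage[OF p box1(1), of _ i1]) (auto simp: Y1_def)
  have fY: "finite Y1" using words_card(2)[OF finA] by (simp add: Y1_def)
  have X: "finite X1" "card X1 \<le> mult_dom * card (box B b0 l2 v2 (fst (f (up p y0))) \<gamma>)"
    by (rule card_preimage[OF box2(1)]; auto simp: X1_def)+
  let ?T = "Y1 \<times> words A (2 * M * r') \<times> X1"
  have fT: "finite ?T" using fY X(1) words_card(2)[OF finA] by simp
  have rng: "\<phi> zz \<in> ?T" if zz: "zz \<in> Z" for zz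
  proof -
    obtain xs ys where w: "xs \<in> words A R" "ys \<in> words A R" "zz = z xs ys" "good xs ys" "good xs y0"
      using Z[OF zz] by blast
    have zA: "fst zz i \<in> A" for i using z_SA[OF w(1,2)] w(3) by (simp add: states_def)
    have "cut zz 0 i1 = take i1 ys"
    proof (rule nth_equalityI)
      show "length (cut zz 0 i1) = length (take i1 ys)"
        using w(2) i12 R(3) by (simp add: cut_def words_def)
      fix k assume "k < length (cut zz 0 i1)"
      then have k: "k < i1" by (simp add: cut_def)
      then show "cut zz 0 i1 ! k = take i1 ys ! k"
        using fst_z[OF w(1,2), of "t + int k"] i12 w(3) by (simp add: cut_def)
    qed
    moreover have "take i1 ys \<in> Y1"
      using good_prefix[OF w(1,2,4), of \<alpha>] q(1)[OF zz] w(3) words_take_le[OF w(2)] i12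
      by (auto simp: Y1_def i1_def)
    moreover have "cut zz i1 i2 \<in> words A (2 * M * r')"
      using zA i12(1) by (auto simp: cut_def words_def)
    moreover have "up (fst zz, t) (take i2 y0) = up (overwrite p xs) (take i2 y0)"
    proof (rule up_cong[where R = i2])
      show "length (take i2 y0) = i2" using y0 i12 by (simp add: words_def)
      fix i assume "i < snd (fst zz, t) \<or> snd (fst zz, t) + int i2 \<le> i"
      then show "fst (fst zz, t) i = fst (overwrite p xs) i"
        using fst_z[OF w(1,2), of i] w(1,3) i12 by (auto simp: fst_up words_def)
    qed simp
    moreover have "up (overwrite p xs) (take i2 y0) \<in> X1"
      using good_suffix[OF w(1,2,4) y0 w(5), of \<gamma>] q(2)[OF zz] w(3)
        up_take_SA[OF overwrite_SA[OF p w(1)] y0]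
      by (auto simp: X1_def i2_def)
    ultimately show ?thesis by (simp add: \<phi>_def)
  qed
  have inj: "inj_on \<phi> Z"
  proof (rule inj_onI)
    fix z1 z2 assume zz: "z1 \<in> Z" "z2 \<in> Z" and e: "\<phi> z1 = \<phi> z2"
    obtain xs1 ys1 where w1: "xs1 \<in> words A R" "ys1 \<in> words A R" "z1 = z xs1 ys1" using Z[OF zz(1)] by blast
    obtain xs2 ys2 where w2: "xs2 \<in> words A R" "ys2 \<in> words A R" "z2 = z xs2 ys2" using Z[OF zz(2)] by blast
    have c: "cut z1 0 i1 = cut z2 0 i1" "cut z1 i1 i2 = cut z2 i1 i2"
      "up (fst z1, t) (take i2 y0) = up (fst z2, t) (take i2 y0)" using e by (auto simp: \<phi>_def)
    have len: "length (take i2 y0) = i2" using y0 i12 by (simp add: words_def)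
    have "fst z1 i = fst z2 i" for i
    proof (cases "t \<le> i \<and> i < t + int i2")
      case True
      define k where "k = nat (i - t)"
      have k: "i = t + int k" "k < i2" using True by (auto simp: k_def)
      show ?thesis
      proof (cases "k < i1")
        case True
        then have "cut z1 0 i1 ! k = cut z2 0 i1 ! k" using c by simp
        with True show ?thesis by (simp add: cut_def k)
      next
        case False
        then have "cut z1 i1 i2 ! (k - i1) = cut z2 i1 i2 ! (k - i1)" using c by simp
        with False k nth_upt[of i1 "k - i1" i2] show ?thesis by (simp add: cut_def)
      qed
    next
      case False
      have "fst (up (fst z1, t) (take i2 y0)) i = fst (up (fst z2, t) (take i2 y0)) i" using c(3) by simp
      with False len show ?thesis by (auto simp: fst_up)
    qed
    then have "fst z1 = fst z2" by blast
    moreover have "snd z1 = snd z2" using snd_z w1 w2 by simp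
    ultimately show "z1 = z2" by (simp add: prod_eq_iff)
  qed
  have fin: "finite Z" using inj rng fT by (metis finite_imageD finite_subset image_subsetI)
  have "card Z \<le> card ?T" by (rule card_inj_on_le[OF inj _ fT]) (use rng in blast)
  also have "\<dots> = card Y1 * (card A ^ (2 * M * r') * card X1)"
    by (simp add: card_cartesian_product words_card(1)[OF finA])
  also have "\<dots> \<le> class_bound"
    unfolding class_bound_def
    using order.trans[OF cY mult_left_mono[OF box1(2)]] order.trans[OF X(2) mult_left_mono[OF box2(2)]]
    by (intro mult_le_mono) auto
  finally show ?thesis using fin by blast
qed

text \<open>The lamps of \<open>f (z xs ys)\<close> in the window from \<open>l\<close> to \<open>v\<close> can be rewritten freely: each rewritten state
  is close to the image of a state in \<open>Zbox\<close>, which has only about \<open>card A ^ R\<close> elements.\<close>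

lemma volume_count:
  "9 / 100 * real (card B) ^ nat (v - l) \<le> real class_bound * real mult_cod * (real R + 1)"
proof -
  define m where "m = card A ^ R"
  have m: "0 < real m" using Ane(2) by (simp add: m_def)
  obtain y0 where y0: "y0 \<in> words A R" "3 / 10 * real m \<le> card {xs \<in> words A R. good xs y0}"
    using exists_common_word by (auto simp: m_def)
  define X0 where "X0 = {xs \<in> words A R. good xs y0}"
  define G where "G = (SIGMA xs:X0. {ys \<in> words A R. good xs ys})"
  define Z where "Z = (\<lambda>(xs, ys). z xs ys) ` G"
  have finW: "finite (words A n)" "card (words A n) = card A ^ n" for n using words_card[OF finA] by auto
  have finG: "finite G" "finite X0" using finW by (auto simp: G_def X0_def)
  have "9 / 100 * (real m * real m) \<le> 3 / 10 * real m * card X0"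
    using y0(2) m by (simp add: X0_def)
  also have "\<dots> = (\<Sum>xs\<in>X0. 3 / 10 * real m)" by simp
  also have "\<dots> \<le> (\<Sum>xs\<in>X0. real (card {ys \<in> words A R. good xs ys}))"
  proof (rule sum_mono)
    fix xs assume "xs \<in> X0"
    then show "3 / 10 * real m \<le> real (card {ys \<in> words A R. good xs ys})"
      using many[of xs] m by (simp add: frac_card field_simps X0_def m_def)
  qed
  also have "\<dots> = card G" using finG finW by (simp add: G_def)
  finally have cG: "9 / 100 * (real m * real m) \<le> card G" .
  have SS: "card A ^ S * card A ^ S = m" by (simp add: m_def R(3) mult_2 power_add)
  \<comment> \<open>The words \<open>take S xs\<close> and \<open>drop S ys\<close> leave no trace
    in \<open>z xs ys\<close>, so at most \<open>m\<close> pairs give the same middle state.\<close>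
  have "card G \<le> m * card Z"
  proof (rule card_le_fibres[of Z G "\<lambda>(xs, ys). z xs ys"])
    fix zz
    let ?F = "{x \<in> G. (case x of (xs, ys) \<Rightarrow> z xs ys) = zz}"
    let ?g = "\<lambda>(xs, ys). (take S xs, drop S ys)"
    have "inj_on ?g ?F"
    proof (rule inj_onI)
      fix x x' assume x: "x \<in> ?F" "x' \<in> ?F" "?g x = ?g x'"
      obtain xs ys xs' ys' where e: "x = (xs, ys)" "x' = (xs', ys')" by fastforce
      then have "take S ys = take S ys'" "drop S xs = drop S xs'"
        using x z_inj[of xs ys xs' ys'] by (auto simp: G_def X0_def)
      moreover have "take S xs = take S xs'" "drop S ys = drop S ys'" using x(3) e by auto
      ultimately show "x = x'" unfolding e by (metis append_take_drop_id)
    qed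
    moreover have "?g ` ?F \<subseteq> words A S \<times> words A S"
      using words_take[of _ A S S] words_drop[of _ A S S] R(3) by (auto simp: G_def X0_def mult_2)
    ultimately have "card ?F \<le> card (words A S \<times> words A S)"
      using finW by (intro card_inj_on_le) auto
    then show "finite ?F \<and> card ?F \<le> m"
      using finG SS by (simp add: card_cartesian_product finW)
  qed (use finG in \<open>auto simp: Z_def\<close>)
  then have "real (card G) \<le> real m * real (card Z)" by (simp flip: of_nat_mult)
  with cG have "9 / 100 * (real m * real m) \<le> real m * real (card Z)" by linarith
  then have cZ: "9 / 100 * real m \<le> real (card Z)" using m by simp
  define W where "W = nat (v - l)"
  have finB': "finite (words B W)" "card (words B W) = card B ^ W" using words_card[OF finB] by auto
  define Qs where "Qs = (\<lambda>(zz, om). window om (f zz)) ` (Z \<times> words B W)"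
  have Zw: "\<exists>xs\<in>words A R. \<exists>ys\<in>words A R. zz = z xs ys \<and> good xs ys \<and> good xs y0" if "zz \<in> Z" for zz
    using that by (force simp: Z_def G_def X0_def)
  have finZ: "finite Z" using finG by (simp add: Z_def)
  have ZA: "Zbox \<subseteq> SA" by (auto simp: Zbox_def box_def)
  have QB: "Qs \<subseteq> SB"
    using Zw window_SB[OF f_in[OF z_SA]] by (fastforce simp: Qs_def W_def)
  have cov: "\<exists>x\<in>Zbox. wd (f x) q \<le> K" if "q \<in> Qs" for q
    using that Zw window_cover by (fastforce simp: Qs_def W_def)
  note Qc = card_cover[OF Zbox_card(1) ZA QB cov]
  \<comment> \<open>A rewritten state shows \<open>om\<close> inside the window and the lamps of
    \<open>f zz\<close> outside, so its origins form a class as in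
    \<open>class_card\<close>.\<close>
  have "card (Z \<times> words B W) \<le> class_bound * card Qs"
  proof (rule card_le_fibres[of Qs _ "\<lambda>(zz, om). window om (f zz)", OF Qc(1)])
    fix q
    let ?F = "{x \<in> Z \<times> words B W. (case x of (zz, om) \<Rightarrow> window om (f zz)) = q}"
    have inj: "inj_on fst ?F"
    proof (rule inj_onI, clarify)
      fix zz om zz' om'
      assume om: "om \<in> words B W" "om' \<in> words B W" "window om' (f zz') = window om (f zz)"
        and "fst (zz, om) = fst (zz', om')"
      have "om = om'"
      proof (rule nth_equalityI)
        fix k assume "k < length om"
        then have "int k < v - l" using om(1) by (auto simp: words_def W_def)
        moreover have "fst (window om' (f zz')) (l + int k) = fst (window om (f zz)) (l + int k)"
          using om(3) by simp
        ultimately show "om ! k = om' ! k" by (simp add: window_def)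
      qed (use om in \<open>simp add: words_def\<close>)
      with \<open>fst (zz, om) = fst (zz', om')\<close> show "zz = zz' \<and> om = om'" by simp
    qed
    have "finite (fst ` ?F) \<and> card (fst ` ?F) \<le> class_bound"
    proof (rule class_card[OF y0(1), of _ "fst q" "fst q"])
      fix zz i assume "zz \<in> fst ` ?F"
      then obtain om where o: "zz \<in> Z" "window om (f zz) = q" by auto
      show "\<exists>xs\<in>words A R. \<exists>ys\<in>words A R. zz = z xs ys \<and> good xs ys \<and> good xs y0" by (rule Zw[OF o(1)])
      show "i < l \<Longrightarrow> fst (f zz) i = fst q i" "v \<le> i \<Longrightarrow> fst (f zz) i = fst q i"
        using o(2) by (auto simp: window_def)
    qed
    then show "finite ?F \<and> card ?F \<le> class_bound"
      using inj finZ finB' by (simp add: card_image)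
  qed (auto simp: Qs_def)
  also have "\<dots> \<le> class_bound * (mult_cod * ((R + 1) * m))"
    using Qc(2) Zbox_card(2) by (intro mult_le_mono order_refl order.trans[OF Qc(2)]) (auto simp: m_def)
  finally have "real (card Z * card B ^ W) \<le> real (class_bound * (mult_cod * ((R + 1) * m)))"
    unfolding of_nat_le_iff by (simp add: card_cartesian_product finB')
  then have "real (card Z) * real (card B) ^ W \<le> (real class_bound * real mult_cod * (real R + 1)) * real m"
    by (simp add: algebra_simps)
  moreover have "9 / 100 * real m * real (card B) ^ W \<le> real (card Z) * real (card B) ^ W"
    by (intro mult_right_mono cZ) simp
  ultimately have "(9 / 100 * real (card B) ^ W) * real m \<le> (real class_bound * real mult_cod * (real R + 1)) * real m"
    by (simp add: algebra_simps)
  then have "9 / 100 * real (card B) ^ W \<le> real class_bound * real mult_cod * (real R + 1)"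
    using m by (rule mult_right_le_imp_le)
  then show ?thesis by (simp only: W_def)
qed

lemma class_bound_le:
  "real class_bound \<le> (real mult_dom)\<^sup>2 * ((2 * u' + 3) * (11 * u' + 3)) *
     exp ((13 * u' + 4) * ln (real (card B))) * exp (2 * real M * real r' * ln (real (card A)))"
proof -
  have a: "real (mult_dom * ((nat (v1 - l1) + 1) * card B ^ nat (v1 - l1))) \<le>
     real mult_dom * ((2 * u' + 3) * exp ((2 * u' + 2) * ln (real (card B))))"
    using lv12(5,7) cardB_power_le[of "nat (v1 - l1)" "2 * u' + 2"] u'_pos
    unfolding of_nat_mult of_nat_power by (intro mult_left_mono mult_mono) auto
  have b: "real (mult_dom * ((nat (v2 - l2) + 1) * card B ^ nat (v2 - l2))) \<le>
     real mult_dom * ((11 * u' + 3) * exp ((11 * u' + 2) * ln (real (card B))))"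
    using lv12(6,8) cardB_power_le[of "nat (v2 - l2)" "11 * u' + 2"] u'_pos
    unfolding of_nat_mult of_nat_power by (intro mult_left_mono mult_mono) auto
  have c': "real (card A ^ (2 * M * r')) = exp (2 * real M * real r' * ln (real (card A)))"
    by (simp add: cardA_power)
  have "real class_bound \<le> (real mult_dom * ((2 * u' + 3) * exp ((2 * u' + 2) * ln (real (card B))))) *
     (exp (2 * real M * real r' * ln (real (card A))) *
      (real mult_dom * ((11 * u' + 3) * exp ((11 * u' + 2) * ln (real (card B))))))"
    unfolding class_bound_def of_nat_mult[of "_ * _" "_ * _"]
    unfolding of_nat_mult[of "card A ^ _"] c'
    using u'_pos by (intro mult_mono a b order_refl mult_nonneg_nonneg) auto
  also have "\<dots> = (real mult_dom)\<^sup>2 * ((2 * u' + 3) * (11 * u' + 3)) *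
     (exp ((2 * u' + 2) * ln (real (card B))) * exp ((11 * u' + 2) * ln (real (card B)))) *
     exp (2 * real M * real r' * ln (real (card A)))"
    by (simp add: power2_eq_square mult_ac)
  also have "exp ((2 * u' + 2) * ln (real (card B))) * exp ((11 * u' + 2) * ln (real (card B))) =
      exp ((13 * u' + 4) * ln (real (card B)))"
    unfolding exp_add[symmetric] by (simp add: algebra_simps)
  finally show ?thesis .
qed

text \<open>About \<open>2 * M * u'\<close> free image lamps are weighed against
  \<open>2 * M * r'\<close> free lamps of the domain. The number \<open>13 = 2 + 11\<close> is the
  cost of the two boundary boxes; it does not grow with \<open>M\<close>, so a wide window makes it
  negligible.\<close>

lemma volume_ineq:
  "9 / 100 * exp ((2 * real M - 13) * u' * ln (real (card B)) - 2 * real M * real r' * ln (real (card A))) \<le>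
    (real mult_dom)\<^sup>2 * real mult_cod * exp (4 * ln (real (card B))) *
    ((2 * u' + 3) * (11 * u' + 3) * (real R + 1))"
proof -
  define x where "x = exp (2 * real M * real r' * ln (real (card A)))"
  define y where "y = exp (13 * u' * ln (real (card B)))"
  define b4 where "b4 = exp (4 * ln (real (card B)))"
  have pos: "0 < x" "0 < y" by (simp_all add: x_def y_def)
  have "2 * real M * u' \<le> real (nat (v - l))"
  proof -
    have "2 * real M * u' \<le> real_of_int (v - l)" using lv by (simp add: algebra_simps)
    then show ?thesis by linarith
  qed
  then have "exp (2 * real M * u' * ln (real (card B))) \<le> real (card B) ^ nat (v - l)"
  proof -
    assume *: "2 * real M * u' \<le> real (nat (v - l))"
    have "real (card B) ^ nat (v - l) = exp (real (nat (v - l)) * ln (real (card B)))"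
      using Bne(2) by (simp add: exp_of_nat_mult)
    moreover have "2 * real M * u' * ln (real (card B)) \<le> real (nat (v - l)) * ln (real (card B))"
      using * Bne(2) by (intro mult_right_mono) auto
    ultimately show ?thesis by simp
  qed
  then have "9 / 100 * exp (2 * real M * u' * ln (real (card B))) \<le> real class_bound * (real mult_cod * (real R + 1))"
    using volume_count by (simp add: mult.assoc)
  also have "\<dots> \<le> ((real mult_dom)\<^sup>2 * ((2 * u' + 3) * (11 * u' + 3)) * (y * b4) * x) * (real mult_cod * (real R + 1))"
  proof -
    have "exp ((13 * u' + 4) * ln (real (card B))) = y * b4"
      by (simp add: y_def b4_def exp_add[symmetric] algebra_simps)
    then show ?thesis using class_bound_le unfolding x_def by (intro mult_right_mono) auto
  qed
  finally have "9 / 100 * (exp (2 * real M * u' * ln (real (card B))) / (y * x)) \<le>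
      (real mult_dom)\<^sup>2 * ((2 * u' + 3) * (11 * u' + 3)) * b4 * (real mult_cod * (real R + 1))"
    using pos by (simp add: field_simps)
  moreover have "exp (2 * real M * u' * ln (real (card B))) / (y * x) =
      exp ((2 * real M - 13) * u' * ln (real (card B)) - 2 * real M * real r' * ln (real (card A)))"
    unfolding x_def y_def exp_add[symmetric] exp_diff[symmetric] by (simp add: algebra_simps)
  ultimately show ?thesis by (simp add: b4_def mult_ac)
qed

end

lemma rising_gain:
  assumes "rising P N u w"
  shows "(real N - 2) * u - 2 * w \<le> pos (P N) - pos (P 0)"
  using assms by (auto simp: rising_def algebra_simps)

lemma rising_exclusive:
  assumes "rising P N u w" "rising (\<lambda>i. mirror (P i)) N u w" "w \<le> u / 4" "0 < u" "4 \<le> N"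
  shows False
proof -
  have "2 * u \<le> (real N - 2) * u" using assms(4,5) by (intro mult_right_mono) auto
  then have "u \<le> (real N - 2) * u - 2 * w" using assms(3,4) by linarith
  then show False using rising_gain[OF assms(1)] rising_gain[OF assms(2)] assms(4) by simp
qed

section \<open>The speed is the ratio of the logarithms\<close>

context lamp_qi
begin

lemma volume_bound:
  assumes p: "p \<in> SA" and R: "R = N * r" "R = N' * r'" "r' = c * r" "N = N' * c" "N' = 2 * h"
    and u: "0 < u" "u' = real c * u" "u \<le> u'" "0 \<le> w" "w \<le> u / 4" "0 \<le> w'" "w' \<le> u' / 4"
    and M: "8 \<le> M" "M < h" and c: "1 \<le> c"
    and small: "real_of_int K * (real_of_int K + 2 * real M * u' + 2) + real_of_int K \<le> real (h * r')"
    and base: "9 / 20 \<le> frac A R (\<lambda>ys. rising (path p r ys) N u w)"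
    and near: "\<And>p'. p' \<in> SA \<Longrightarrow> same_box R p p' \<Longrightarrow> 9 / 10 \<le> frac A R (\<lambda>ys. both_rising p p' N r u w N' r' u' w' ys \<or>
        lamp_qi.both_rising (\<lambda>p. mirror (f p)) p p' N r u w N' r' u' w' ys)"
  shows "9 / 100 * exp ((2 * real M - 13) * u' * ln (real (card B)) - 2 * real M * real r' * ln (real (card A))) \<le>
    (real mult_dom)\<^sup>2 * real mult_cod * exp (4 * ln (real (card B))) *
    ((2 * u' + 3) * (11 * u' + 3) * (real R + 1))"
proof -
  have N4: "4 \<le> N"
  proof -
    have "4 * 1 \<le> N' * c" using M R(5) c by (intro mult_le_mono) auto
    then show ?thesis using R(4) by simp
  qed
  have "rising_box A a0 B b0 f K p N r u w N' r' u' w' c h M R (h * r')"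
  proof (unfold_locales)
    fix xs assume xs: "xs \<in> words A R"
    let ?p' = "overwrite p xs"
    \<comment> \<open>\<open>9 / 20 + 9 / 10 - 1 = 7 / 20\<close>. On this set of words the path
      from \<open>p\<close> rises, which excludes the falling alternative.\<close>
    have "7 / 20 \<le> frac A R (\<lambda>ys. rising (path p r ys) N u w) + frac A R (\<lambda>ys. both_rising p ?p' N r u w N' r' u' w' ys \<or>
        lamp_qi.both_rising (\<lambda>p. mirror (f p)) p ?p' N r u w N' r' u' w' ys) - 1"
      using base near[OF overwrite_SA[OF p xs] overwrite_box[OF xs]] by linarith
    also have "\<dots> \<le> frac A R (\<lambda>ys. rising (path p r ys) N u w \<and> (both_rising p ?p' N r u w N' r' u' w' ys \<or>
        lamp_qi.both_rising (\<lambda>p. mirror (f p)) p ?p' N r u w N' r' u' w' ys))"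
      by (rule frac_Int[OF finA Ane(1)])
    also have "\<dots> \<le> frac A R (both_rising p ?p' N r u w N' r' u' w')"
      using rising_exclusive[OF _ _ u(5,1) N4]
      by (intro frac_mono) (auto simp: lamp_qi.both_rising_def[OF mirror_lamp_qi])
    finally show "3 / 10 \<le> frac A R (both_rising p ?p' N r u w N' r' u' w')" by simp
  qed (use assms in auto)
  then show ?thesis by (rule rising_box.volume_ineq)
qed

text \<open>With a larger speed, \<open>volume_ineq\<close> at a nearly extremal starting point
  would bound an exponential in the block length by a polynomial.\<close>

lemma speed_le:
  assumes cA: "2 \<le> card A" and e: "0 < e" "is_speed e" and lower: "\<And>k. e\<^sup>2 * 4 ^ k \<le> Q (2 ^ k)"
  shows "e * ln (real (card B)) \<le> ln (real (card A))"
proof (rule ccontr)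
  define lA where "lA = ln (real (card A))"
  define lB where "lB = ln (real (card B))"
  assume "\<not> e * ln (real (card B)) \<le> ln (real (card A))"
  then have gap: "0 < e * lB - lA" by (simp add: lA_def lB_def)
  \<comment> \<open>Makes the rate \<open>c0\<close> positive: the gain
    \<open>2 * M * (e * lB - lA)\<close> across the window exceeds the boundary cost
    \<open>13 * e * lB\<close>.\<close>
  obtain M0 :: nat where M0: "13 * e * lB / (2 * (e * lB - lA)) < real M0"
    using reals_Archimedean2 by blast
  define M where "M = max 8 M0"
  have "13 * e * lB / (2 * (e * lB - lA)) < real M" using M0 by (simp add: M_def)
  then have "13 * e * lB < real M * (2 * (e * lB - lA))" using gap by (simp add: divide_less_eq)
  define c0 where "c0 = (2 * real M - 13) * e * lB - 2 * real M * lA"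
  have c0: "0 < c0" using \<open>13 * e * lB < _\<close> by (simp add: c0_def algebra_simps)
  \<comment> \<open>A power of two for \<open>h\<close> makes the total length
    \<open>N * 2 ^ k\<close> a power of two, as \<open>extremal_point\<close> requires. The bound by
    \<open>2 * K * M * e + 1\<close> is what \<open>small\<close> needs.\<close>
  obtain a where a: "max (max 4 (real M)) (2 * real_of_int K * real M * e + 1) < 2 ^ a"
    using real_arch_pow[of "2::real" "max (max 4 (real M)) (2 * real_of_int K * real M * e + 1)"] by auto
  define h :: nat where "h = 2 ^ a"
  have rh: "real h = 2 ^ a" by (simp add: h_def)
  have h: "4 < real h" "real M < real h" "2 * real_of_int K * real M * e + 1 < real h"
    using a unfolding rh max_less_iff_conj by auto
  define N' where "N' = 2 * h"
  have N': "8 \<le> N'" using h by (simp add: N'_def)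
  define d' where "d' = e / (16 * real N')"
  have d': "0 < d'" "8 * real N' * d' < e" using e N' by (auto simp: d'_def)
  have tenth: "0 < (1 / 10 :: real)" by simp
  obtain b N d \<eta> k0 where sp: "N = N' * 2 ^ b" "0 < d" "8 * real N * d < e" "0 < \<eta>" "\<eta> \<le> 1 / 10"
    and near: "\<And>k p p'. \<lbrakk>k \<ge> k0; p \<in> SA; 1 - \<eta> \<le> frac A (N * 2 ^ k) (efficient p N (2 ^ k) (e * 2 ^ k) (d * 2 ^ k));
      p' \<in> SA; same_box (N * 2 ^ k) p p'\<rbrakk> \<Longrightarrow> 1 - 1 / 10 \<le> frac A (N * 2 ^ k) (\<lambda>ys.
         both_rising p p' N (2 ^ k) (e * 2 ^ k) (2 * real N * (d * 2 ^ k))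
           N' (2 ^ (b + k)) (e * 2 ^ (b + k)) (2 * real N' * (d' * 2 ^ (b + k))) ys \<or>
         lamp_qi.both_rising (\<lambda>p. mirror (f p)) p p' N (2 ^ k) (e * 2 ^ k) (2 * real N * (d * 2 ^ k))
           N' (2 ^ (b + k)) (e * 2 ^ (b + k)) (2 * real N' * (d' * 2 ^ (b + k))) ys)"
    using spread[OF e cA N' d' tenth] by blast
  have N: "1 \<le> N" "4 \<le> N" using sp(1) N' mult_le_mono[OF N', of 1 "2 ^ b"] by auto
  obtain \<delta> k1 where \<delta>: "0 < \<delta>" and k1: "\<And>k p. \<lbrakk>k \<ge> k1; p \<in> SA;
      1 - \<delta> \<le> frac A (N * 2 ^ k) (\<lambda>ys. (e - \<delta>) * real (N * 2 ^ k) \<le> wdf p (up p ys))\<rbrakk> \<Longrightarrow>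
      1 - \<eta> \<le> frac A (N * 2 ^ k) (efficient p N (2 ^ k) (e * 2 ^ k) (d * 2 ^ k))"
    using efficient_blocks[OF e N(1) sp(2,4)] by blast
  obtain k2 where k2: "\<And>k. k \<ge> k2 \<Longrightarrow> \<exists>p\<in>SA.
    1 - \<delta> \<le> frac A (2 ^ k) (\<lambda>ys. (e - \<delta>) * real (2 ^ k) \<le> wdf p (up p ys))"
    using extremal_point[OF e lower \<delta>] by blast
  define C where "C = (real mult_dom)\<^sup>2 * real mult_cod * exp (4 * lB)"
  have C: "0 \<le> C" by (simp add: C_def)
  obtain r0 where r0: "\<And>r. r \<ge> r0 \<Longrightarrow> C * ((11 * e + real N') * real r + 3) ^ 3 * exp (- c0 * real r) \<le> 8 / 100"
    using power_exp_decay[OF c0, of "8 / 100" C "11 * e + real N'" 3 3] by auto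
  define k where "k = Max {k0, k1, k2, r0, nat (K * (K + 2) + K)}"
  have k: "k \<ge> k0" "k \<ge> k1" "k \<ge> k2" "k \<ge> r0" "k \<ge> nat (K * (K + 2) + K)"
    unfolding k_def by (rule Max_ge; simp)+
  define r :: nat where "r = 2 ^ k"
  define r' :: nat where "r' = 2 ^ (b + k)"
  define R where "R = N * r"
  define u where "u = e * real r"
  define u' where "u' = e * real r'"
  define w where "w = 2 * real N * (d * real r)"
  define w' where "w' = 2 * real N' * (d' * real r')"
  have kr: "k \<le> r'" "0 < real r" "0 < real r'"
  proof -
    have "k < 2 ^ k" by simp
    also have "\<dots> \<le> r'" by (simp add: r'_def)
    finally show "k \<le> r'" by simp
  qed (simp_all add: r_def r'_def)
  have Req: "R = N * r" "R = N' * r'" "r' = 2 ^ b * r" "N = N' * 2 ^ b" "N' = 2 * h"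
    by (simp_all add: R_def sp(1) r_def r'_def power_add N'_def)
  have uu: "0 < u" "u' = real (2 ^ b) * u" "u \<le> u'" "0 \<le> w" "w \<le> u / 4" "0 \<le> w'" "w' \<le> u' / 4"
  proof -
    show "0 < u" using e kr by (simp add: u_def)
    show u': "u' = real (2 ^ b) * u" by (simp add: u'_def u_def Req(3))
    show "u \<le> u'" using \<open>0 < u\<close> unfolding u' by simp
    show "0 \<le> w" "0 \<le> w'" using sp d' by (simp_all add: w_def w'_def)
    have "(8 * real N * d) * real r \<le> e * real r" using sp(3) by (intro mult_right_mono) auto
    then show "w \<le> u / 4" by (simp add: w_def u_def)
    have "(8 * real N' * d') * real r' \<le> e * real r'" using d'(2) by (intro mult_right_mono) auto
    then show "w' \<le> u' / 4" by (simp add: w'_def u'_def)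
  qed
  have small: "real_of_int K * (real_of_int K + 2 * real M * u' + 2) + real_of_int K \<le> real (h * r')"
  proof -
    have "K * (K + 2) + K \<le> int r'" using k(5) kr(1) by linarith
    then have "real_of_int (K * (K + 2) + K) \<le> real r'" by (metis of_int_le_iff of_int_of_nat_eq)
    then have "real_of_int K * (real_of_int K + 2 * real M * u' + 2) + real_of_int K \<le>
        (2 * real_of_int K * real M * e + 1) * real r'"
      by (simp add: u'_def algebra_simps)
    also have "\<dots> \<le> real h * real r'" using h(3) by (intro mult_right_mono) auto
    finally show ?thesis by simp
  qed
  have M: "8 \<le> M" "M < h" using h(2) by (auto simp: M_def)
  have c1: "1 \<le> (2::nat) ^ b" by simp
  obtain p where p: "p \<in> SA" and g: "1 - \<eta> \<le> frac A R (efficient p N r u (d * real r))"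
  proof -
    have R2: "N * 2 ^ k = 2 ^ (1 + a + b + k)" by (simp add: sp(1) N'_def h_def power_add)
    obtain p where p: "p \<in> SA"
      and "1 - \<delta> \<le> frac A (N * 2 ^ k) (\<lambda>ys. (e - \<delta>) * real (N * 2 ^ k) \<le> wdf p (up p ys))"
      using k2[of "1 + a + b + k"] k(3) unfolding R2 by auto
    from k1[OF k(2) this] p that show ?thesis by (simp add: R_def r_def u_def)
  qed
  have near': "9 / 10 \<le> frac A R (\<lambda>ys. both_rising p p' N r u w N' r' u' w' ys \<or>
        lamp_qi.both_rising (\<lambda>p. mirror (f p)) p p' N r u w N' r' u' w' ys)"
    if "p' \<in> SA" "same_box R p p'" for p'
    using near[OF k(1) p _ that(1)] g that(2)
    by (simp add: R_def r_def u_def w_def r'_def u'_def w'_def)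
  have sbp: "same_box R p p" by (simp add: same_box_def)
  have "9 / 10 \<le> frac A R (\<lambda>ys. rising (path p r ys) N u w \<or> rising (\<lambda>i. mirror (path p r ys i)) N u w)"
    by (rule order.trans[OF near'[OF p sbp]], rule frac_mono)
      (auto simp: both_rising_def lamp_qi.both_rising_def[OF mirror_lamp_qi])
  also have "\<dots> \<le> frac A R (\<lambda>ys. rising (path p r ys) N u w) +
      frac A R (\<lambda>ys. rising (\<lambda>i. mirror (path p r ys i)) N u w)" by (rule frac_Un)
  finally consider (up) "9 / 20 \<le> frac A R (\<lambda>ys. rising (path p r ys) N u w)"
    | (down) "9 / 20 \<le> frac A R (\<lambda>ys. rising (\<lambda>i. mirror (path p r ys i)) N u w)" by linarith
  then have "9 / 100 * exp ((2 * real M - 13) * u' * lB - 2 * real M * real r' * lA) \<le>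
    C * ((2 * u' + 3) * (11 * u' + 3) * (real R + 1))"
  proof cases
    case up
    from volume_bound[OF p Req uu M c1 small up near'] show ?thesis by (simp add: lA_def lB_def C_def)
  next
    case down
    interpret m: lamp_qi A a0 B b0 "\<lambda>p. mirror (f p)" K by (rule mirror_lamp_qi)
    have "9 / 10 \<le> frac A R (\<lambda>ys. m.both_rising p p' N r u w N' r' u' w' ys \<or>
        lamp_qi.both_rising (\<lambda>p. mirror (mirror (f p))) p p' N r u w N' r' u' w' ys)"
      if "p' \<in> SA" "same_box R p p'" for p'
      using near'[OF that] by (simp add: disj_commute)
    from m.volume_bound[OF p Req uu M c1 small down this] show ?thesis by (simp add: lA_def lB_def C_def)
  qed
  also have "\<dots> \<le> C * ((11 * e + real N') * real r' + 3) ^ 3"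
  proof -
    define y where "y = (11 * e + real N') * real r' + 3"
    have y: "2 * u' + 3 \<le> y" "11 * u' + 3 \<le> y" "real R + 1 \<le> y"
      using e kr by (auto simp: y_def u'_def Req(2) algebra_simps)
    have "0 \<le> u'" using uu by linarith
    then have "(2 * u' + 3) * (11 * u' + 3) * (real R + 1) \<le> y * y * y"
      using y by (intro mult_mono) auto
    then show ?thesis using C unfolding y_def[symmetric]
      by (intro mult_left_mono) (simp_all add: power3_eq_cube)
  qed
  finally have fin: "9 / 100 * exp ((2 * real M - 13) * u' * lB - 2 * real M * real r' * lA) \<le>
    C * ((11 * e + real N') * real r' + 3) ^ 3" .
  have "(2 * real M - 13) * u' * lB - 2 * real M * real r' * lA = c0 * real r'"
    by (simp add: c0_def u'_def algebra_simps)
  then have "9 / 100 \<le> C * ((11 * e + real N') * real r' + 3) ^ 3 * exp (- c0 * real r')"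
    using fin by (simp add: exp_minus field_simps)
  also have "\<dots> \<le> 8 / 100" using r0 k(4) kr(1) by simp
  finally show False by simp
qed

text \<open>By \<open>typical_lower\<close>, any single starting point already has second moment at
  least about \<open>(s * R)\<^sup>2\<close>.\<close>

lemma speed_ge:
  assumes cB: "2 \<le> card B" and e: "0 \<le> e" "is_speed e"
    and s: "0 \<le> s" "s * ln (real (card B)) < ln (real (card A))"
  shows "s \<le> e"
proof (rule ccontr)
  assume "\<not> s \<le> e"
  then have es: "e\<^sup>2 < s\<^sup>2" using e(1) by (simp add: power_strict_mono)
  define \<eta> where "\<eta> = (s\<^sup>2 - e\<^sup>2) / (4 * s\<^sup>2)"
  have s2: "0 < s\<^sup>2" using es by (smt (verit) zero_le_power2)
  have \<eta>: "0 < \<eta>" "\<eta> * s\<^sup>2 = (s\<^sup>2 - e\<^sup>2) / 4" using es s2 by (auto simp: \<eta>_def)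
  obtain R0 where R0: "\<And>R p. R \<ge> R0 \<Longrightarrow> p \<in> SA \<Longrightarrow> frac A R (\<lambda>ys. wdf p (up p ys) < s * real R) \<le> \<eta>"
    using typical_lower[OF s \<eta>(1)] by blast
  have "0 < (s\<^sup>2 - e\<^sup>2) / 4" using es by simp
  then obtain k0 where k0: "\<And>k. k \<ge> k0 \<Longrightarrow> Q (2 ^ k) \<le> (e\<^sup>2 + (s\<^sup>2 - e\<^sup>2) / 4) * 4 ^ k"
    using e(2) unfolding is_speed_def by blast
  define k where "k = max k0 R0"
  define R :: nat where "R = 2 ^ k"
  have "k < R" by (simp add: R_def)
  then have R: "R0 \<le> R" "0 < real R" by (auto simp: k_def)
  have R4: "4 ^ k = (real R)\<^sup>2"
    by (simp add: R_def power_mult[symmetric] mult.commute[of k]) (simp add: power_mult)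
  obtain p where p: "p \<in> SA" using SA_ne by auto
  have "1 - \<eta> \<le> frac A R (\<lambda>ys. \<not> wdf p (up p ys) < s * real R)"
    using R0[OF R(1) p] by (simp add: frac_compl[OF finA Ane(1)])
  also have "\<dots> \<le> frac A R (\<lambda>ys. (s * real R)\<^sup>2 \<le> (wdf p (up p ys))\<^sup>2)"
    using s(1) by (intro frac_mono power_mono) auto
  finally have "(s * real R)\<^sup>2 * (1 - \<eta>) \<le> (s * real R)\<^sup>2 * frac A R (\<lambda>ys. (s * real R)\<^sup>2 \<le> (wdf p (up p ys))\<^sup>2)"
    by (rule mult_left_mono) simp
  also have "\<dots> \<le> energy p R"
    unfolding energy_def by (rule avg_ge_frac[OF finA Ane(1)]) auto
  also have "\<dots> \<le> Q R" by (rule energy_le_Q[OF p])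
  also have "\<dots> \<le> (e\<^sup>2 + (s\<^sup>2 - e\<^sup>2) / 4) * (real R)\<^sup>2"
    using k0[of k] by (simp add: k_def R_def[unfolded k_def] R4[unfolded k_def])
  finally have "(s\<^sup>2 * (1 - \<eta>)) * (real R)\<^sup>2 \<le> (e\<^sup>2 + (s\<^sup>2 - e\<^sup>2) / 4) * (real R)\<^sup>2"
    by (simp add: power_mult_distrib algebra_simps)
  then have "s\<^sup>2 * (1 - \<eta>) \<le> e\<^sup>2 + (s\<^sup>2 - e\<^sup>2) / 4"
    using R(2) by (simp add: mult_le_cancel_right)
  then have "s\<^sup>2 - \<eta> * s\<^sup>2 \<le> e\<^sup>2 + (s\<^sup>2 - e\<^sup>2) / 4" by (simp add: algebra_simps)
  then show False using \<eta>(2) es by (simp add: field_simps)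
qed

lemma speed_eq:
  assumes cA: "2 \<le> card A" and cB: "2 \<le> card B"
  shows "is_speed (ln (real (card A)) / ln (real (card B)))"
proof -
  obtain e where e: "0 \<le> e" "is_speed e" "\<And>k. e\<^sup>2 * 4 ^ k \<le> Q (2 ^ k)" using speed_exists by blast
  let ?l = "ln (real (card A)) / ln (real (card B))"
  have l: "0 < ln (real (card A))" "0 < ln (real (card B))" using cA cB by auto
  have ge: "?l \<le> e"
  proof (rule field_le_epsilon)
    fix x :: real assume x: "0 < x"
    show "?l \<le> e + x"
    proof (cases "0 \<le> ?l - x")
      case True
      have "(?l - x) * ln (real (card B)) < ln (real (card A))" using l x by (simp add: algebra_simps)
      from speed_ge[OF cB e(1,2) True this] show ?thesis by simp
    qed (use e in auto)
  qed
  have "0 < ?l" using l by simp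
  then have "e * ln (real (card B)) \<le> ln (real (card A))"
    using ge speed_le[OF cA _ e(2,3)] by linarith
  then have "e \<le> ?l" using l by (simp add: pos_le_divide_eq)
  then have "e = ?l" using ge by simp
  then show ?thesis using e(2) by simp
qed

text \<open>The counting bound now has the same rate as the supremum, so
  \<open>typical_lower\<close> supplies the hypothesis of \<open>efficient_blocks\<close> at every
  \<open>p\<close>, and \<open>spread\<close> applies to every box. A single good word then both
  compares the two starting heads and moves the head far.\<close>

lemma heads:
  assumes cA: "2 \<le> card A" and cB: "2 \<le> card B"
  defines "e \<equiv> ln (real (card A)) / ln (real (card B))"
  shows "\<exists>j0. \<forall>j\<ge>j0.
    (\<forall>p\<in>SA. \<forall>p'\<in>SA. same_box (2 ^ j) p p' \<longrightarrow> \<bar>pos (f p') - pos (f p)\<bar> \<le> e * 2 ^ j / 4) \<and>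
    (\<forall>p\<in>SA. \<exists>ys\<in>words A (2 ^ j). 4 / 5 * e * 2 ^ j \<le> \<bar>pos (f (up p ys)) - pos (f p)\<bar>)"
proof -
  have l: "0 < ln (real (card A))" "0 < ln (real (card B))" using cA cB by auto
  have e: "0 < e" "is_speed e" using l speed_eq[OF cA cB] by (auto simp: e_def)
  \<comment> \<open>With 16 coarse blocks the tolerance \<open>4 * u'\<close> for the starting heads
    is a quarter of \<open>e * 2 ^ j\<close>.\<close>
  define N' :: nat where "N' = 16"
  define d' where "d' = e / (16 * real N')"
  have N': "8 \<le> N'" and d': "0 < d'" "8 * real N' * d' < e" using e by (auto simp: d'_def N'_def)
  have quarter: "0 < (1 / 4 :: real)" by simp
  obtain b N d \<eta> k0 where sp: "N = N' * 2 ^ b" "0 < d" "8 * real N * d < e" "0 < \<eta>" "\<eta> \<le> 1 / 4"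
    and near: "\<And>k p p'. \<lbrakk>k \<ge> k0; p \<in> SA; 1 - \<eta> \<le> frac A (N * 2 ^ k) (efficient p N (2 ^ k) (e * 2 ^ k) (d * 2 ^ k));
      p' \<in> SA; same_box (N * 2 ^ k) p p'\<rbrakk> \<Longrightarrow> 1 - 1 / 4 \<le> frac A (N * 2 ^ k) (\<lambda>ys.
         both_rising p p' N (2 ^ k) (e * 2 ^ k) (2 * real N * (d * 2 ^ k))
           N' (2 ^ (b + k)) (e * 2 ^ (b + k)) (2 * real N' * (d' * 2 ^ (b + k))) ys \<or>
         lamp_qi.both_rising (\<lambda>p. mirror (f p)) p p' N (2 ^ k) (e * 2 ^ k) (2 * real N * (d * 2 ^ k))
           N' (2 ^ (b + k)) (e * 2 ^ (b + k)) (2 * real N' * (d' * 2 ^ (b + k))) ys)"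
    using spread[OF e cA N' d' quarter] by blast
  have N: "1 \<le> N" "16 \<le> N" using sp(1) by (simp_all add: N'_def)
  obtain \<delta> k1 where \<delta>: "0 < \<delta>" and k1: "\<And>k p. \<lbrakk>k \<ge> k1; p \<in> SA;
      1 - \<delta> \<le> frac A (N * 2 ^ k) (\<lambda>ys. (e - \<delta>) * real (N * 2 ^ k) \<le> wdf p (up p ys))\<rbrakk> \<Longrightarrow>
      1 - \<eta> \<le> frac A (N * 2 ^ k) (efficient p N (2 ^ k) (e * 2 ^ k) (d * 2 ^ k))"
    using efficient_blocks[OF e N(1) sp(2,4)] by blast
  \<comment> \<open>Slightly below the speed, so that \<open>typical_lower\<close> applies; the
    maximum keeps it nonnegative.\<close>
  define s where "s = max 0 (e - \<delta>)"
  have "s < e" using e \<delta> by (simp add: s_def)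
  then have "s * ln (real (card B)) < e * ln (real (card B))" using l by simp
  then have s: "0 \<le> s" "s * ln (real (card B)) < ln (real (card A))" using l by (auto simp: e_def s_def)
  obtain R0 where R0: "\<And>R p. R \<ge> R0 \<Longrightarrow> p \<in> SA \<Longrightarrow> frac A R (\<lambda>ys. wdf p (up p ys) < s * real R) \<le> \<delta>"
    using typical_lower[OF s \<delta>] by blast
  have main: "\<bar>pos (f p') - pos (f p)\<bar> \<le> e * 2 ^ j / 4 \<and>
      (\<exists>ys\<in>words A (2 ^ j). 4 / 5 * e * 2 ^ j \<le> \<bar>pos (f (up p ys)) - pos (f p)\<bar>)"
    if j: "j \<ge> 4 + b + Max {k0, k1, R0}" and p: "p \<in> SA" "p' \<in> SA" "same_box (2 ^ j) p p'" for j p p'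
  proof -
    define k where "k = j - 4 - b"
    have k: "k0 \<le> k" "k1 \<le> k" "R0 \<le> k" and jk: "j = 4 + b + k"
      using j by (auto simp: k_def)
    have R: "2 ^ j = N * 2 ^ k" by (simp add: jk sp(1) N'_def power_add)
    have rR: "(2::real) ^ j = real N * 2 ^ k" using arg_cong[OF R, of real] by simp
    have "k < 2 ^ k" by simp
    also have "\<dots> \<le> N * 2 ^ k" using N by simp
    finally have "R0 \<le> N * 2 ^ k" using k by simp
    from R0[OF this p(1)]
    have "1 - \<delta> \<le> frac A (N * 2 ^ k) (\<lambda>ys. \<not> wdf p (up p ys) < s * real (N * 2 ^ k))"
      by (simp add: frac_compl[OF finA Ane(1)])
    also have "\<dots> \<le> frac A (N * 2 ^ k) (\<lambda>ys. (e - \<delta>) * real (N * 2 ^ k) \<le> wdf p (up p ys))"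
    proof (rule frac_mono)
      fix ys assume "\<not> wdf p (up p ys) < s * real (N * 2 ^ k)"
      moreover have "(e - \<delta>) * real (N * 2 ^ k) \<le> s * real (N * 2 ^ k)"
        by (intro mult_right_mono) (auto simp: s_def)
      ultimately show "(e - \<delta>) * real (N * 2 ^ k) \<le> wdf p (up p ys)" by linarith
    qed
    finally have g: "1 - \<eta> \<le> frac A (N * 2 ^ k) (efficient p N (2 ^ k) (e * 2 ^ k) (d * 2 ^ k))"
      by (rule k1[OF k(2) p(1)])
    define u where "u = e * (2::real) ^ k"
    define w where "w = 2 * real N * (d * 2 ^ k)"
    define u' where "u' = e * (2::real) ^ (b + k)"
    have u: "0 < u" "w \<le> u / 4" "real N * u = e * 2 ^ j" "u' = e * 2 ^ j / 16"
    proof -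
      show "0 < u" using e by (simp add: u_def)
      have "(8 * real N * d) * 2 ^ k \<le> e * (2::real) ^ k" using sp(3) by (intro mult_right_mono) auto
      then show "w \<le> u / 4" by (simp add: w_def u_def)
      show "real N * u = e * 2 ^ j" by (simp add: u_def rR)
      show "u' = e * 2 ^ j / 16" by (simp add: u'_def jk power_add)
    qed
    have "0 < 1 - 1 / (4::real)" by simp
    also note near[OF k(1) p(1) g p(2) p(3)[unfolded R]]
    finally obtain ys where ys: "ys \<in> words A (N * 2 ^ k)"
      and h: "both_rising p p' N (2 ^ k) u w N' (2 ^ (b + k)) u' (2 * real N' * (d' * 2 ^ (b + k))) ys \<or>
         lamp_qi.both_rising (\<lambda>p. mirror (f p)) p p' N (2 ^ k) u w N' (2 ^ (b + k)) u' (2 * real N' * (d' * 2 ^ (b + k))) ys"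
      unfolding u_def u'_def w_def by (auto dest!: frac_pos)
    have "\<bar>pos (f p') - pos (f p)\<bar> \<le> 4 * u'"
      using h by (auto simp: both_rising_def lamp_qi.both_rising_def[OF mirror_lamp_qi])
    then have c1: "\<bar>pos (f p') - pos (f p)\<bar> \<le> e * 2 ^ j / 4" using u(4) by simp
    have len: "take (N * 2 ^ k) ys = ys" using ys by (simp add: words_def)
    have "(real N - 2) * u - 2 * w \<le> \<bar>pos (path p (2 ^ k) ys N) - pos (path p (2 ^ k) ys 0)\<bar>"
      using h rising_gain[of "path p (2 ^ k) ys" N u w]
        rising_gain[of "\<lambda>i. mirror (path p (2 ^ k) ys i)" N u w]
      by (auto simp: both_rising_def lamp_qi.both_rising_def[OF mirror_lamp_qi])
    then have "real N * u - 5 / 2 * u \<le> \<bar>pos (f (up p ys)) - pos (f p)\<bar>"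
      using u(2) len by (simp add: algebra_simps)
    moreover have "16 * u \<le> real N * u" using N u(1) by (intro mult_right_mono) auto
    ultimately have "4 / 5 * (real N * u) \<le> \<bar>pos (f (up p ys)) - pos (f p)\<bar>" by linarith
    then show ?thesis using c1 ys by (auto simp: u(3) R mult.assoc)
  qed
  have refl: "same_box (2 ^ j) p p" for j p by (simp add: same_box_def)
  show ?thesis using main refl by (intro exI[of _ "4 + b + Max {k0, k1, R0}"]) blast
qed

lemma mirror_dom_lamp_qi: "lamp_qi A a0 B b0 (\<lambda>p. f (mirror p)) K"
proof
  fix s assume "s \<in> SB"
  then obtain p where "p \<in> SA" "wd (f p) s \<le> K" using f_onto by blast
  then show "\<exists>p\<in>SA. wd (f (mirror p)) s \<le> K" by (intro bexI[of _ "mirror p"]) auto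
next
  fix p q assume pq: "p \<in> SA" "q \<in> SA"
  then show "wd (f (mirror p)) (f (mirror q)) \<le> K * wd p q + K"
    "wd p q \<le> K * wd (f (mirror p)) (f (mirror q)) + K"
    using f_le[of "mirror p" "mirror q"] f_ge[of "mirror p" "mirror q"] states_fd[OF pq] by simp_all
qed (use finA a0 finB b0 K f_in in auto)

text \<open>\<open>heads\<close> provides one word \<open>zs\<close> that moves the head far. The
  states \<open>up p ys\<close> and \<open>up p zs\<close> have the same head and agree outside the
  window below it; after reflecting the domain they lie in one box, so their image heads are close.
  As \<open>4 / 5 - 1 / 4 > 1 / 2\<close>, every word moves the head far, without
  exceptions.\<close>

lemma heads_move:
  assumes cA: "2 \<le> card A" and cB: "2 \<le> card B"
  shows "\<exists>R\<ge>1. \<forall>p\<in>SA. \<forall>ys\<in>words A R. x \<le> \<bar>pos (f (up p ys)) - pos (f p)\<bar>"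
proof -
  define e where "e = ln (real (card A)) / ln (real (card B))"
  have e: "0 < e" using cA cB by (simp add: e_def)
  interpret m: lamp_qi A a0 B b0 "\<lambda>p. f (mirror p)" K by (rule mirror_dom_lamp_qi)
  obtain j1 where j1: "\<And>j p. j \<ge> j1 \<Longrightarrow> p \<in> SA \<Longrightarrow>
      \<exists>ys\<in>words A (2 ^ j). 4 / 5 * e * 2 ^ j \<le> \<bar>pos (f (up p ys)) - pos (f p)\<bar>"
    using heads[OF cA cB] unfolding e_def by blast
  obtain j2 where j2: "\<And>j p p'. j \<ge> j2 \<Longrightarrow> p \<in> SA \<Longrightarrow> p' \<in> SA \<Longrightarrow> same_box (2 ^ j) p p' \<Longrightarrow>
      \<bar>pos (f (mirror p')) - pos (f (mirror p))\<bar> \<le> e * 2 ^ j / 4"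
    using m.heads[OF cA cB] unfolding e_def by blast
  obtain j3 where j3: "2 * x / e < 2 ^ j3" using real_arch_pow[of "2::real"] by auto
  define j where "j = Max {j1, j2, j3}"
  have j: "j1 \<le> j" "j2 \<le> j" "j3 \<le> j" by (simp_all add: j_def)
  have "(2::real) ^ j3 \<le> 2 ^ j" using j(3) by (intro power_increasing) auto
  then have "e * 2 ^ j3 \<le> e * 2 ^ j" using e by (intro mult_left_mono) auto
  moreover have "2 * x < e * 2 ^ j3" using j3 e by (simp add: pos_divide_less_eq mult.commute)
  ultimately have xj: "x \<le> e * 2 ^ j / 2" by simp
  have "x \<le> \<bar>pos (f (up p ys)) - pos (f p)\<bar>" if p: "p \<in> SA" and ys: "ys \<in> words A (2 ^ j)" for p ys
  proof -
    obtain zs where zs: "zs \<in> words A (2 ^ j)" "4 / 5 * e * 2 ^ j \<le> \<bar>pos (f (up p zs)) - pos (f p)\<bar>"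
      using j1[OF j(1) p] by blast
    have "same_box (2 ^ j) (mirror (up p zs)) (mirror (up p ys))"
      using zs(1) ys by (auto simp: same_box_def fst_up words_def)
    then have "\<bar>pos (f (up p ys)) - pos (f (up p zs))\<bar> \<le> e * 2 ^ j / 4"
      using j2[OF j(2), of "mirror (up p zs)" "mirror (up p ys)"] words_up[OF p] zs(1) ys by simp
    moreover have "0 < e * 2 ^ j" using e by simp
    ultimately show ?thesis using zs(2) xj by linarith
  qed
  then show ?thesis by (intro exI[of _ "2 ^ j"]) auto
qed

end

section \<open>Monotone vertical lines\<close>

definition confs :: "'a set \<Rightarrow> 'a \<Rightarrow> (int \<Rightarrow> 'a) set" where
  "confs A z = {c. (\<forall>i. c i \<in> A) \<and> finite {i. c i \<noteq> z}}"

text \<open>As \<open>t\<close> grows, the walk that replaces \<open>b\<close> by \<open>a\<close>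
  from left to right: a vertical line in the Diestel-Leader picture, with \<open>a\<close> and
  \<open>b\<close> as its two boundary data.\<close>

definition line :: "(int \<Rightarrow> 'a) \<Rightarrow> (int \<Rightarrow> 'a) \<Rightarrow> int \<Rightarrow> 'a state" where
  "line a b t = (\<lambda>i. if i < t then a i else b i, t)"

lemma line_sel [simp]: "snd (line a b t) = t" "fst (line a b t) i = (if i < t then a i else b i)"
  by (simp_all add: line_def)

lemma states_confs: "p \<in> states A z \<longleftrightarrow> fst p \<in> confs A z"
  by (simp add: states_def confs_def)

lemma line_states: "a \<in> confs A z \<Longrightarrow> b \<in> confs A z \<Longrightarrow> line a b t \<in> states A z"
proof -
  assume "a \<in> confs A z" "b \<in> confs A z"
  then have "finite ({i. a i \<noteq> z} \<union> {i. b i \<noteq> z})" by (simp add: confs_def)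
  then have "finite {i. fst (line a b t) i \<noteq> z}" by (rule rev_finite_subset) auto
  then show ?thesis using \<open>a \<in> _\<close> \<open>b \<in> _\<close> by (simp add: states_def confs_def)
qed

lemma line_up: "line a b (t + int R) = up (line a b t) (map (\<lambda>k. a (t + int k)) [0..<R])"
  by (intro prod_eqI ext) (auto simp: fst_up)

lemma line_cong: "(\<And>i. i < t \<Longrightarrow> a i = a' i) \<Longrightarrow> (\<And>i. t \<le> i \<Longrightarrow> b i = b' i) \<Longrightarrow> line a b t = line a' b' t"
  by (intro prod_eqI ext) auto

lemma line_self: "line (fst p) (fst p) (snd p) = p"
  by (intro prod_eqI ext) auto

lemma confs_bound:
  assumes "a \<in> confs A z"
  obtains m where "0 \<le> m" "\<And>i. \<bar>i\<bar> \<ge> m \<Longrightarrow> a i = z"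
proof -
  have fin: "finite ((\<lambda>i. \<bar>i\<bar>) ` {i. a i \<noteq> z})" using assms by (simp add: confs_def)
  define m where "m = Max (insert 0 ((\<lambda>i. \<bar>i\<bar>) ` {i. a i \<noteq> z})) + 1"
  have le: "\<bar>i\<bar> + 1 \<le> m" if "a i \<noteq> z" for i
    unfolding m_def using fin that by (intro add_right_mono Max_ge) auto
  show thesis
  proof (rule that[of m])
    have "0 \<le> Max (insert 0 ((\<lambda>i. \<bar>i\<bar>) ` {i. a i \<noteq> z}))" using fin by (intro Max_ge) auto
    then show "0 \<le> m" by (simp add: m_def)
  qed (use le in fastforce)
qed

lemma confs_const: "z \<in> A \<Longrightarrow> (\<lambda>_. z) \<in> confs A z"
  by (simp add: confs_def)

lemma confs_upd: "a \<in> confs A z \<Longrightarrow> y \<in> A \<Longrightarrow> a(j := y) \<in> confs A z"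
  unfolding confs_def by (auto intro: finite_subset[of _ "insert j {i. a i \<noteq> z}"])

context lamp_qi
begin

abbreviation "CA \<equiv> confs A a0"
abbreviation "CB \<equiv> confs B b0"
abbreviation "za \<equiv> (\<lambda>_::int. a0)"

definition H :: "(int \<Rightarrow> 'a) \<Rightarrow> (int \<Rightarrow> 'a) \<Rightarrow> int \<Rightarrow> int" where
  "H a b t = snd (f (line a b t))"

lemma za: "za \<in> CA" using a0 by (rule confs_const)

lemma line_SA: "a \<in> CA \<Longrightarrow> b \<in> CA \<Longrightarrow> line a b t \<in> SA"
  by (rule line_states)

lemma line_step:
  assumes "a \<in> CA" "b \<in> CA"
  shows "wd (f (line a b t)) (f (line a b (t + 1))) \<le> 2 * K"
proof -
  have "line a b (t + 1) = up (line a b t) [a t]" using line_up[of a b t 1] by simp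
  then have "wd (line a b t) (line a b (t + 1)) \<le> 1" using wd_up[of "line a b t" "[a t]"] by simp
  then have "K * wd (line a b t) (line a b (t + 1)) \<le> K * 1" using K by (intro mult_left_mono) auto
  then show ?thesis
    using f_le[OF line_SA[OF assms, of t] line_SA[OF assms, of "t + 1"]] by linarith
qed

lemma H_step:
  assumes "a \<in> CA" "b \<in> CA"
  shows "\<bar>H a b (t + 1) - H a b t\<bar> \<le> 2 * K"
  using line_step[OF assms, of t] head_wd[OF ffd[OF line_SA[OF assms, of t] line_SA[OF assms, of "t + 1"]]]
  by (simp add: H_def abs_minus_commute)

lemma H_lipschitz:
  assumes "a \<in> CA" "b \<in> CA"
  shows "\<bar>H a b (t + int k) - H a b t\<bar> \<le> 2 * K * int k"
proof (induction k)
  case (Suc k)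
  then show ?case using H_step[OF assms, of "t + int k"] by (simp add: algebra_simps)
qed simp

text \<open>Increments over \<open>R\<close> steps have size at least \<open>6 * K\<close> but
  change by at most \<open>4 * K\<close> when \<open>t\<close> changes by 1, so their sign is
  constant along a line. The sign is the same for all lines: the line of \<open>a, b\<close>
  coincides with that of \<open>a, za\<close> for large \<open>t\<close>, and the latter with that
  of \<open>za, za\<close> for very negative \<open>t\<close>.\<close>

lemma monotone_dichotomy:
  assumes cA: "2 \<le> card A" and cB: "2 \<le> card B"
  obtains R where "1 \<le> R"
    "(\<forall>a\<in>CA. \<forall>b\<in>CA. \<forall>t. H a b t + 1 \<le> H a b (t + int R)) \<or>
     (\<forall>a\<in>CA. \<forall>b\<in>CA. \<forall>t. H a b (t + int R) + 1 \<le> H a b t)"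
proof -
  obtain R where R: "1 \<le> R" and mv: "\<And>p ys. p \<in> SA \<Longrightarrow> ys \<in> words A R \<Longrightarrow>
      6 * real_of_int K \<le> \<bar>pos (f (up p ys)) - pos (f p)\<bar>"
    using heads_move[OF cA cB, of "6 * real_of_int K"] by blast
  define D where "D a b t = H a b (t + int R) - H a b t" for a b t
  have big: "6 * K \<le> \<bar>D a b t\<bar>" if ab: "a \<in> CA" "b \<in> CA" for a b t
  proof -
    have "map (\<lambda>k. a (t + int k)) [0..<R] \<in> words A R" using ab by (auto simp: words_def confs_def)
    from mv[OF line_SA[OF ab] this, of t]
    have "real_of_int (6 * K) \<le> real_of_int \<bar>D a b t\<bar>"
      by (simp add: D_def H_def line_up[symmetric])
    then show ?thesis by (simp only: of_int_le_iff)
  qed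
  have stp: "0 < D a b (t + 1) \<longleftrightarrow> 0 < D a b t" if ab: "a \<in> CA" "b \<in> CA" for a b t
    using big[OF ab, of t] big[OF ab, of "t + 1"] H_step[OF ab, of t] H_step[OF ab, of "t + int R"] K
    by (auto simp: D_def algebra_simps)
  have const: "0 < D a b t \<longleftrightarrow> 0 < D a b 0" if ab: "a \<in> CA" "b \<in> CA" for a b t
  proof (induction t rule: int_induct[where k = 0])
    case (step1 i)
    then show ?case using stp[OF ab, of i] by simp
  next
    case (step2 i)
    then show ?case using stp[OF ab, of "i - 1"] by simp
  qed simp
  have all: "0 < D a b t \<longleftrightarrow> 0 < D za za 0" if ab: "a \<in> CA" "b \<in> CA" for a b t
  proof -
    obtain m where m: "0 \<le> m" "\<And>i. \<bar>i\<bar> \<ge> m \<Longrightarrow> b i = a0" using confs_bound[OF ab(2)] by blast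
    have "D a b m = D a za m"
      unfolding D_def H_def using m by (intro arg_cong2[of _ _ _ _ "(-)"] arg_cong[of _ _ "\<lambda>x. snd (f x)"] line_cong) auto
    moreover obtain k where k: "0 \<le> k" "\<And>i. \<bar>i\<bar> \<ge> k \<Longrightarrow> a i = a0" using confs_bound[OF ab(1)] by blast
    have "D a za (- k - int R) = D za za (- k - int R)"
      unfolding D_def H_def using k by (intro arg_cong2[of _ _ _ _ "(-)"] arg_cong[of _ _ "\<lambda>x. snd (f x)"] line_cong) auto
    ultimately show ?thesis
      using const[OF ab, of t] const[OF ab, of m] const[OF ab(1) za, of m]
        const[OF ab(1) za, of "- k - int R"] const[OF za za, of "- k - int R"] by simp
  qed
  show thesis
  proof (rule that[OF R])
    show "(\<forall>a\<in>CA. \<forall>b\<in>CA. \<forall>t. H a b t + 1 \<le> H a b (t + int R)) \<or>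
     (\<forall>a\<in>CA. \<forall>b\<in>CA. \<forall>t. H a b (t + int R) + 1 \<le> H a b t)"
    proof (cases "0 < D za za 0")
      case True
      have "H a b t + 1 \<le> H a b (t + int R)" if ab: "a \<in> CA" "b \<in> CA" for a b t
        using all[OF ab, of t] True by (simp add: D_def)
      then show ?thesis by blast
    next
      case False
      have "H a b (t + int R) + 1 \<le> H a b t" if ab: "a \<in> CA" "b \<in> CA" for a b t
        using all[OF ab, of t] False big[OF ab, of t] K by (simp add: D_def)
      then show ?thesis by blast
    qed
  qed
qed

end

section \<open>The boundary map of a rising quasi-isometry\<close>

locale rising_qi = lamp_qi +
  fixes R :: nat
  assumes R: "1 \<le> R"
    and rise: "a \<in> confs A a0 \<Longrightarrow> b \<in> confs A a0 \<Longrightarrow> snd (f (line a b t)) + 1 \<le> snd (f (line a b (t + int R)))"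
begin

text \<open>The image head can fall back by at most \<open>2 * K * R\<close> along a line, and a
  single step changes image lamps only within \<open>2 * K\<close> of the head.\<close>

definition \<rho> :: int where "\<rho> = 2 * K * int R + 2 * K"

lemma \<rho>: "0 \<le> \<rho>" using K by (simp add: \<rho>_def)

lemma H_rise: "a \<in> CA \<Longrightarrow> b \<in> CA \<Longrightarrow> H a b t + int q \<le> H a b (t + int (q * R))"
proof (induction q)
  case (Suc q)
  then show ?case using rise[of a b "t + int (q * R)"] by (simp add: H_def algebra_simps)
qed simp

lemma H_ge:
  assumes ab: "a \<in> CA" "b \<in> CA" and t: "t \<le> t'"
  shows "H a b t - 2 * K * int R \<le> H a b t'"
proof -
  define n where "n = nat (t' - t)"
  have n: "t' = t + int (n div R * R) + int (n mod R)"
  proof -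
    have "int (n div R * R + n mod R) = t' - t" using t by (simp add: n_def)
    then show ?thesis by (simp only: of_nat_add)
  qed
  have "n mod R \<le> R" using R by (simp add: less_imp_le)
  then have "2 * K * int (n mod R) \<le> 2 * K * int R" using K by (intro mult_left_mono) auto
  then show ?thesis
    using H_rise[OF ab, of t "n div R"] H_lipschitz[OF ab, of "t + int (n div R * R)" "n mod R"]
    unfolding n by linarith
qed

lemma H_large:
  assumes "a \<in> CA" "b \<in> CA"
  obtains t' where "t \<le> t'" "x \<le> H a b t'"
proof (rule that[of "t + int (nat (x - H a b t) * R)"])
  show "x \<le> H a b (t + int (nat (x - H a b t) * R))"
    using H_rise[OF assms, of t "nat (x - H a b t)"] by linarith
qed simp

lemma H_small:
  assumes "a \<in> CA" "b \<in> CA"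
  obtains t' where "t' \<le> t" "H a b t' \<le> x"
proof -
  define q where "q = nat (H a b t - x)"
  have "H a b (t - int (q * R)) + int q \<le> H a b t"
    using H_rise[OF assms, of "t - int (q * R)" q] by simp
  moreover have "H a b t - x \<le> int q" by (simp add: q_def)
  ultimately have "H a b (t - int (q * R)) \<le> x" by linarith
  then show thesis by (intro that[of "t - int (q * R)"]) auto
qed

lemma left_stable:
  assumes ab: "a \<in> CA" "b \<in> CA" and t: "t \<le> t'" and i: "i < H a b t - \<rho>"
  shows "fst (f (line a b t')) i = fst (f (line a b t)) i"
  using t
proof (induction t' rule: int_ge_induct)
  case (step s)
  note fd = ffd[OF line_SA[OF ab, of s] line_SA[OF ab, of "s + 1"]]
  have "H a b s - 2 * K \<le> lo (f (line a b s)) (f (line a b (s + 1)))"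
    using line_step[OF ab, of s] hi_ge(1)[OF fd] by (simp add: wd_def H_def)
  moreover have "H a b t - 2 * K * int R \<le> H a b s" using H_ge[OF ab step(1)] .
  ultimately have "fst (f (line a b s)) i = fst (f (line a b (s + 1))) i"
    using i by (intro agree_below[OF fd]) (simp add: \<rho>_def)
  then show ?case using step by simp
qed simp

lemma right_stable:
  assumes ab: "a \<in> CA" "b \<in> CA" and t: "t' \<le> t" and i: "H a b t + \<rho> \<le> i"
  shows "fst (f (line a b t')) i = fst (f (line a b t)) i"
  using t
proof (induction t' rule: int_le_induct)
  case (step s)
  note fd = ffd[OF line_SA[OF ab, of "s - 1"] line_SA[OF ab, of s]]
  have "hi (f (line a b (s - 1))) (f (line a b s)) \<le> H a b s + 2 * K"
    using line_step[OF ab, of "s - 1"] lo_le(2)[OF fd] by (simp add: wd_def H_def)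
  moreover have "H a b s - 2 * K * int R \<le> H a b t" using H_ge[OF ab step(1)] .
  ultimately have "fst (f (line a b (s - 1))) i = fst (f (line a b s)) i"
    using i by (intro agree_above[OF fd]) (simp add: \<rho>_def)
  then show ?case using step by simp
qed simp

text \<open>By \<open>left_stable\<close>, the lamps of \<open>f (line a b t)\<close> far to the left of its head depend only on \<open>a\<close>. The
  choice of \<open>t\<close> is immaterial, and possible because the heads \<open>H a za t\<close> are unbounded.\<close>

definition T :: "(int \<Rightarrow> 'a) \<Rightarrow> int \<Rightarrow> 'b" where
  "T a i = fst (f (line a za (SOME t. i < H a za t - \<rho>))) i"

lemma left_T:
  assumes ab: "a \<in> CA" "b \<in> CA" and i: "i < H a b t - \<rho>"
  shows "fst (f (line a b t)) i = T a i"
proof -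
  define t1 where "t1 = (SOME t. i < H a za t - \<rho>)"
  obtain s where "i + \<rho> + 1 \<le> H a za s" by (rule H_large[OF ab(1) za])
  then have "i < H a za s - \<rho>" by simp
  then have t1: "i < H a za t1 - \<rho>" unfolding t1_def by (rule someI)
  obtain m where m: "0 \<le> m" "\<And>i. \<bar>i\<bar> \<ge> m \<Longrightarrow> b i = a0" using confs_bound[OF ab(2)] by blast
  define t2 where "t2 = Max {t, t1, m}"
  have t2: "t \<le> t2" "t1 \<le> t2" "m \<le> t2" by (auto simp: t2_def)
  have "line a b t2 = line a za t2" using m t2 by (intro line_cong) auto
  then have "fst (f (line a b t)) i = fst (f (line a za t2)) i"
    using left_stable[OF ab t2(1) i] by simp
  also have "\<dots> = T a i" using left_stable[OF ab(1) za t2(2) t1] by (simp add: T_def t1_def)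
  finally show ?thesis .
qed

lemma T_cong:
  assumes "a \<in> CA" "a' \<in> CA" "\<And>i. i < t \<Longrightarrow> a i = a' i" "i < H a za t - \<rho>"
  shows "T a i = T a' i"
proof -
  have "line a za t = line a' za t" using assms(3) by (intro line_cong) auto
  then show ?thesis using left_T[OF assms(1) za assms(4)] left_T[OF assms(2) za, of i t] assms(4)
    by (simp add: H_def)
qed

lemma T_in: "a \<in> CA \<Longrightarrow> T a i \<in> B"
  using f_in[OF line_SA[OF _ za]] by (auto simp: T_def states_def)

text \<open>Far enough down, all lamps of \<open>a\<close> and \<open>a'\<close> below the head are
  default, so the two lines coincide there. By \<open>right_stable\<close> the image lamps above the
  later heads are inherited from that common state.\<close>

lemma right_cong:
  assumes ab: "a \<in> CA" "a' \<in> CA" "b \<in> CA" and i: "H a b t + \<rho> \<le> i" "H a' b t' + \<rho> \<le> i"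
  shows "fst (f (line a b t)) i = fst (f (line a' b t')) i"
proof -
  obtain m where m: "0 \<le> m" "\<And>i. \<bar>i\<bar> \<ge> m \<Longrightarrow> a i = a0" using confs_bound[OF ab(1)] by blast
  obtain m' where m': "0 \<le> m'" "\<And>i. \<bar>i\<bar> \<ge> m' \<Longrightarrow> a' i = a0" using confs_bound[OF ab(2)] by blast
  define s where "s = Min {t, t', - m, - m'}"
  have s: "s \<le> t" "s \<le> t'" "s \<le> - m" "s \<le> - m'" by (auto simp: s_def)
  have "line a b s = line a' b s"
  proof (rule line_cong)
    fix i assume "i < s"
    then show "a i = a' i" using m(2)[of i] m'(2)[of i] s by simp
  qed simp
  then show ?thesis
    using right_stable[OF ab(1,3) s(1) i(1)] right_stable[OF ab(2,3) s(2) i(2)] by simp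
qed

lemma H_cross:
  assumes ab: "a \<in> CA" "b \<in> CA" and x: "H a b j < x"
  obtains t where "j < t" "x \<le> H a b t" "H a b t < x + 2 * K" "x - H a b j \<le> 2 * K * (t - j)"
proof -
  obtain t0 where t0: "j \<le> t0" "x \<le> H a b t0" by (rule H_large[OF ab])
  define P where "P n = (x \<le> H a b (j + int n))" for n
  have "P (nat (t0 - j))" using t0 by (simp add: P_def)
  then have L: "P (LEAST n. P n)" by (rule LeastI)
  define n where "n = (LEAST n. P n)"
  have n: "P n" using L by (simp add: n_def)
  have "n \<noteq> 0"
  proof
    assume "n = 0"
    with n x show False by (simp add: P_def)
  qed
  then obtain k where k: "n = Suc k" by (cases n) auto
  have "\<not> P k" using not_less_Least[of k P] k by (simp add: n_def)
  then have "H a b (j + int n) < x + 2 * K"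
    using H_step[OF ab, of "j + int k"] k by (simp add: P_def algebra_simps)
  then show thesis
    using n k H_lipschitz[OF ab, of j n] by (intro that[of "j + int n"]) (auto simp: P_def)
qed

definition \<kappa> :: int where "\<kappa> = 2 * K * (K * (2 * K + 2 * \<rho>) + K) + 1"

text \<open>Follow both lines until the image heads pass the level
  \<open>x = H a b j + \<kappa>\<close>. If \<open>T a\<close> and \<open>T a'\<close> agreed below
  \<open>x\<close>, the images would agree below by \<open>left_T\<close> and above by
  \<open>right_cong\<close>, hence be close. But the states differ at lamp \<open>j\<close>, and
  \<open>\<kappa>\<close> is chosen so large that the head is then too far above
  \<open>j\<close>.\<close>

lemma T_branch:
  assumes ab: "a \<in> CA" "a' \<in> CA" "b \<in> CA" and j: "\<And>i. i < j \<Longrightarrow> a i = a' i" "a j \<noteq> a' j"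
  shows "\<exists>i < H a b j + \<kappa>. T a i \<noteq> T a' i"
proof (rule ccontr)
  assume "\<not> ?thesis"
  then have eq: "\<And>i. i < H a b j + \<kappa> \<Longrightarrow> T a i = T a' i" by blast
  have k1: "1 \<le> \<kappa>" using K \<rho> by (simp add: \<kappa>_def)
  define x where "x = H a b j + \<kappa>"
  have "line a b j = line a' b j" using j by (intro line_cong) auto
  then have hj: "H a' b j = H a b j" by (simp add: H_def)
  obtain t where t: "j < t" "x \<le> H a b t" "H a b t < x + 2 * K" "x - H a b j \<le> 2 * K * (t - j)"
    using H_cross[OF ab(1,3), of j x] k1 by (auto simp: x_def)
  obtain t' where t': "j < t'" "x \<le> H a' b t'" "H a' b t' < x + 2 * K"
    using H_cross[OF ab(2,3), of j x] k1 hj by (auto simp: x_def)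
  let ?p = "line a b t" and ?q = "line a' b t'"
  have pq: "?p \<in> SA" "?q \<in> SA" using line_SA ab by auto
  have "wd (f ?p) (f ?q) \<le> (x + 2 * K + \<rho>) - (x - \<rho>)"
  proof (rule wd_le[OF ffd[OF pq]])
    show "x - \<rho> \<le> snd (f ?p)" "x - \<rho> \<le> snd (f ?q)" "snd (f ?p) \<le> x + 2 * K + \<rho>" "snd (f ?q) \<le> x + 2 * K + \<rho>"
      using t t' \<rho> K by (auto simp: H_def)
    fix i
    show "fst (f ?p) i = fst (f ?q) i" if "i < x - \<rho>"
      using that left_T[OF ab(1,3), of i t] left_T[OF ab(2,3), of i t'] t t' eq[of i] \<rho> by (simp add: x_def)
    show "fst (f ?p) i = fst (f ?q) i" if "x + 2 * K + \<rho> \<le> i"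
      using that t t' by (intro right_cong ab) auto
  qed
  then have "K * wd (f ?p) (f ?q) \<le> K * (2 * K + 2 * \<rho>)" using K by (intro mult_left_mono) auto
  then have w: "wd ?p ?q \<le> K * (2 * K + 2 * \<rho>) + K" using f_ge[OF pq] by linarith
  have "fst ?p j \<noteq> fst ?q j" using j t t' by simp
  then have "t - j \<le> wd ?p ?q"
    using diff_bounds(1)[OF states_fd[OF pq], of j] hi_ge(1)[OF states_fd[OF pq]] by (simp add: wd_def)
  with w have "2 * K * (t - j) \<le> 2 * K * (K * (2 * K + 2 * \<rho>) + K)" using K by (intro mult_left_mono) auto
  then show False using t(4) by (simp add: x_def \<kappa>_def)
qed

text \<open>Change \<open>a\<close> at lamp \<open>j\<close> only. Some place where
  \<open>T a\<close> and \<open>T a'\<close> differ is below \<open>H a d j + \<kappa>\<close> by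
  \<open>T_branch\<close>, but not below \<open>H a c j - \<rho>\<close>, since at time
  \<open>j\<close> the two lines with right boundary \<open>c\<close> still coincide. As
  \<open>T\<close> does not see the right boundary, \<open>c\<close> and \<open>d\<close> may
  differ.\<close>

lemma H_right_indep:
  assumes cA: "2 \<le> card A" and ab: "a \<in> CA" "b \<in> CA" "b' \<in> CA"
  shows "\<bar>H a b j - H a b' j\<bar> \<le> \<kappa> + \<rho>"
proof -
  have "\<not> A \<subseteq> {a j}" using cA card_mono[of "{a j}" A] by auto
  then obtain y where y: "y \<in> A" "y \<noteq> a j" by auto
  define a' where "a' = a(j := y)"
  have a': "a' \<in> CA" "\<And>i. i < j \<Longrightarrow> a i = a' i" "a j \<noteq> a' j"
    using confs_upd[OF ab(1) y(1)] y(2) by (auto simp: a'_def)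
  have "H a c j < H a d j + \<kappa> + \<rho>" if cd: "c \<in> CA" "d \<in> CA" for c d
  proof -
    obtain i where i: "i < H a d j + \<kappa>" "T a i \<noteq> T a' i"
      using T_branch[OF ab(1) a'(1) cd(2) a'(2,3)] by blast
    have l: "line a c j = line a' c j" using a' by (intro line_cong) auto
    have "\<not> i < H a c j - \<rho>"
    proof
      assume "i < H a c j - \<rho>"
      then have "T a i = T a' i"
        using left_T[OF ab(1) cd(1), of i j] left_T[OF a'(1) cd(1), of i j] l by (simp add: H_def)
      with i(2) show False by simp
    qed
    then show ?thesis using i(1) by linarith
  qed
  from this[OF ab(2,3)] this[OF ab(3,2)] show ?thesis by linarith
qed

lemma reverse_conf: "a \<in> CA \<Longrightarrow> (\<lambda>i. a (- 1 - i)) \<in> CA"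
  using finite_mirror[of "\<lambda>i. a i \<noteq> a0"] by (auto simp: confs_def)

lemma mirror_line: "mirror (line a b t) = line (\<lambda>i. b (- 1 - i)) (\<lambda>i. a (- 1 - i)) (- t)"
  by (intro prod_eqI ext) auto

text \<open>Reflecting domain and codomain exchanges the two boundaries but keeps the direction, so
  dependence of the height on \<open>a\<close> reduces to dependence on \<open>b\<close>.\<close>

lemma reversed_rising: "rising_qi A a0 B b0 (\<lambda>p. mirror (f (mirror p))) K R"
proof -
  interpret m: lamp_qi A a0 B b0 "\<lambda>p. mirror (f p)" K by (rule mirror_lamp_qi)
  interpret mm: lamp_qi A a0 B b0 "\<lambda>p. mirror (f (mirror p))" K by (rule m.mirror_dom_lamp_qi)
  show ?thesis
  proof
    fix a b t assume "a \<in> CA" "b \<in> CA"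
    then show "snd (mirror (f (mirror (line a b t)))) + 1 \<le> snd (mirror (f (mirror (line a b (t + int R)))))"
      using rise[OF reverse_conf reverse_conf, of b a "- t - int R"] by (simp add: mirror_line)
  qed (rule R)
qed

lemma H_left_indep:
  assumes cA: "2 \<le> card A" and ab: "a \<in> CA" "a' \<in> CA" "b \<in> CA"
  shows "\<bar>H a b j - H a' b j\<bar> \<le> \<kappa> + \<rho>"
proof -
  interpret r: rising_qi A a0 B b0 "\<lambda>p. mirror (f (mirror p))" K R by (rule reversed_rising)
  have "r.H (\<lambda>i. c (- 1 - i)) (\<lambda>i. d (- 1 - i)) (- j) = - H d c j" for c d
    by (simp add: r.H_def H_def mirror_line)
  then show ?thesis
    using r.H_right_indep[OF cA reverse_conf[OF ab(3)] reverse_conf[OF ab(1)] reverse_conf[OF ab(2)], of "- j"]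
    by (simp add: r.\<kappa>_def \<kappa>_def r.\<rho>_def \<rho>_def abs_minus_commute)
qed

end

section \<open>Counting boundary cylinders\<close>

locale nontrivial_rising_qi = rising_qi +
  assumes cA: "2 \<le> card A" and cB: "2 \<le> card B"
begin

text \<open>One summand \<open>\<kappa> + \<rho>\<close> for changing the right boundary to the
  default, one for the left.\<close>

definition c :: int where "c = 2 * (\<kappa> + \<rho>)"

abbreviation "H0 \<equiv> H za za"

lemma \<kappa>: "0 \<le> \<kappa>" using K \<rho> by (simp add: \<kappa>_def)

lemma H_near: "a \<in> CA \<Longrightarrow> b \<in> CA \<Longrightarrow> \<bar>H a b t - H0 t\<bar> \<le> c"
  using H_right_indep[OF cA, of a b za t] H_left_indep[OF cA, of a za za t] za by (simp add: c_def)

text \<open>From this time on, the image lamps below \<open>u\<close> are those of \<open>T\<close>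
  on every line, by the margin \<open>c + \<rho>\<close>. Using the default line as a clock gives
  one time for all configurations, which makes truncation uniform.\<close>

definition \<tau> :: "int \<Rightarrow> int" where
  "\<tau> u = (SOME t. u + c + \<rho> \<le> H0 t \<and> (\<forall>s<t. H0 s < u + c + \<rho>))"

lemma \<tau>_ex: "\<exists>t. x \<le> H0 t \<and> (\<forall>s<t. H0 s < x)"
proof -
  obtain t0 where "0 \<le> t0" and t0: "x \<le> H0 t0" by (rule H_large[OF za za])
  obtain t1 where t1: "t1 \<le> t0" "H0 t1 \<le> x - 2 * K * int R - 1" by (rule H_small[OF za za])
  have low: "H0 s < x" if "s \<le> t1" for s using H_ge[OF za za that] t1 by linarith
  define P where "P n = (x \<le> H0 (t1 + int n))" for n
  have "P (nat (t0 - t1))" using t0 t1 by (simp add: P_def)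
  then have L: "P (LEAST n. P n)" by (rule LeastI)
  show ?thesis
  proof (intro exI[of _ "t1 + int (LEAST n. P n)"] conjI allI impI)
    show "x \<le> H0 (t1 + int (LEAST n. P n))" using L by (simp add: P_def)
    fix s assume s: "s < t1 + int (LEAST n. P n)"
    show "H0 s < x"
    proof (cases "s \<le> t1")
      case False
      then have "nat (s - t1) < (LEAST n. P n)" using s by linarith
      from not_less_Least[OF this] False show ?thesis by (simp add: P_def)
    qed (rule low)
  qed
qed

lemma \<tau>: "u + c + \<rho> \<le> H0 (\<tau> u)" "s < \<tau> u \<Longrightarrow> H0 s < u + c + \<rho>"
  using someI_ex[OF \<tau>_ex[of "u + c + \<rho>"]] unfolding \<tau>_def by blast+

lemma \<tau>_upper: "H0 (\<tau> u) \<le> u + c + \<rho> + 2 * K"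
  using \<tau>(2)[of "\<tau> u - 1" u] H_step[OF za za, of "\<tau> u - 1"] by simp

lemma \<tau>_mono: "u \<le> u' \<Longrightarrow> \<tau> u \<le> \<tau> u'"
  using \<tau>(1)[of u'] \<tau>(2)[of "\<tau> u'" u] by (force simp: not_less[symmetric])

lemma T_\<tau>:
  assumes "a \<in> CA" "a' \<in> CA" "\<And>i. i < t \<Longrightarrow> a i = a' i" "\<tau> u \<le> t" "i < u"
  shows "T a i = T a' i"
proof (rule T_cong[OF assms(1,2), of "\<tau> u"])
  show "i < H a za (\<tau> u) - \<rho>" using H_near[OF assms(1) za, of "\<tau> u"] \<tau>(1)[of u] assms(5) by linarith
qed (use assms in auto)

definition left_confs :: "'c set \<Rightarrow> 'c \<Rightarrow> int \<Rightarrow> (int \<Rightarrow> 'c) set" where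
  "left_confs X z t = {a \<in> confs X z. \<forall>i\<ge>t. a i = z}"

text \<open>Since \<open>T\<close> below \<open>u\<close> depends only on lamps below
  \<open>\<tau> u\<close>, this is the preimage under \<open>T\<close> of a cylinder, counted by
  truncated configurations.\<close>

definition cyl :: "int \<Rightarrow> (int \<Rightarrow> 'b) \<Rightarrow> (int \<Rightarrow> 'a) set" where
  "cyl u b = {a \<in> left_confs A a0 (\<tau> u). \<forall>i<u. T a i = b i}"

definition N1 :: nat where
  "N1 = (nat (K * (2 * c + 2 * \<rho> + 2 * K) + K) + 1)^2 * card A ^ nat (K * (2 * c + 2 * \<rho> + 2 * K) + K)"

text \<open>At time \<open>\<tau> u\<close>, lines from two members have images with heads near
  \<open>u\<close> that agree below \<open>u\<close> by definition of the cylinder and higher up by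
  \<open>right_cong\<close>. So the states lie in one ball, whose radius depends neither on
  \<open>u\<close> nor on \<open>b\<close>.\<close>

lemma cyl_card: "finite (cyl u b)" "card (cyl u b) \<le> N1"
proof -
  let ?w = "2 * c + 2 * \<rho> + 2 * K"
  have "finite (cyl u b) \<and> card (cyl u b) \<le> N1"
  proof (cases "cyl u b = {}")
    case False
    then obtain a1 where a1: "a1 \<in> cyl u b" by blast
    let ?L = "\<lambda>a. line a za (\<tau> u)"
    have ca: "a \<in> CA" if "a \<in> cyl u b" for a using that by (simp add: cyl_def left_confs_def)
    have sub: "?L ` cyl u b \<subseteq> ball A a0 (?L a1) (nat (K * ?w + K))"
    proof
      fix p assume "p \<in> ?L ` cyl u b"
      then obtain a where a: "a \<in> cyl u b" "p = ?L a" by blast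
      have SA: "?L a1 \<in> SA" "p \<in> SA" using a ca[OF a1] ca[OF a(1)] line_SA za by auto
      have h: "\<bar>H a za (\<tau> u) - H0 (\<tau> u)\<bar> \<le> c" "\<bar>H a1 za (\<tau> u) - H0 (\<tau> u)\<bar> \<le> c"
        using H_near[OF ca za] a a1 by auto
      have "wd (f (?L a1)) (f p) \<le> (H0 (\<tau> u) + c + \<rho>) - u"
      proof (rule wd_le[OF ffd[OF SA]])
        show "u \<le> snd (f (?L a1))" "u \<le> snd (f p)" "snd (f (?L a1)) \<le> H0 (\<tau> u) + c + \<rho>"
          "snd (f p) \<le> H0 (\<tau> u) + c + \<rho>"
          using h \<tau>(1)[of u] \<rho> a(2) by (auto simp: H_def)
        fix i
        show "fst (f (?L a1)) i = fst (f p) i" if "i < u"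
        proof -
          have "i < H a1 za (\<tau> u) - \<rho>" "i < H a za (\<tau> u) - \<rho>" using h \<tau>(1)[of u] that by linarith+
          then show ?thesis
            using left_T[OF ca[OF a1] za] left_T[OF ca[OF a(1)] za] a a1 that by (simp add: cyl_def)
        qed
        show "fst (f (?L a1)) i = fst (f p) i" if "H0 (\<tau> u) + c + \<rho> \<le> i"
          unfolding a(2) using h that by (intro right_cong ca[OF a1] ca[OF a(1)] za) auto
      qed
      then have "wd (f (?L a1)) (f p) \<le> ?w" using \<tau>_upper[of u] by linarith
      then have "K * wd (f (?L a1)) (f p) \<le> K * ?w" using K by (intro mult_left_mono) auto
      then have "wd (?L a1) p \<le> K * ?w + K" using f_ge[OF SA] by linarith
      then show "p \<in> ball A a0 (?L a1) (nat (K * ?w + K))" using SA by (simp add: ball_def)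
    qed
    have inj: "inj_on ?L (cyl u b)"
    proof (rule inj_onI)
      fix a a' assume a: "a \<in> cyl u b" "a' \<in> cyl u b" "?L a = ?L a'"
      have "a i = a' i" for i
      proof (cases "i < \<tau> u")
        case True
        have "fst (?L a) i = fst (?L a') i" using a(3) by simp
        with True show ?thesis by simp
      next
        case False
        then show ?thesis using a by (simp add: cyl_def left_confs_def)
      qed
      then show "a = a'" by blast
    qed
    have SA: "?L a1 \<in> SA" using line_SA[OF ca[OF a1] za] .
    show ?thesis
      using ball_card[OF finA SA, of "nat (K * ?w + K)"] sub inj unfolding N1_def
      by (meson card_inj_on_le finite_imageD finite_subset le_trans)
  qed simp
  then show "finite (cyl u b)" "card (cyl u b) \<le> N1" by auto
qed

definition trunc :: "int \<Rightarrow> (int \<Rightarrow> 'a) \<Rightarrow> int \<Rightarrow> 'a" where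
  "trunc t a = (\<lambda>i. if i < t then a i else a0)"

lemma trunc: "a \<in> CA \<Longrightarrow> trunc t a \<in> left_confs A a0 t"
proof -
  assume a: "a \<in> CA"
  have "{i. trunc t a i \<noteq> a0} \<subseteq> {i. a i \<noteq> a0}" by (auto simp: trunc_def)
  then have "finite {i. trunc t a i \<noteq> a0}" by (rule finite_subset) (use a in \<open>simp add: confs_def\<close>)
  moreover have "trunc t a i \<in> A" for i using a a0 by (simp add: trunc_def confs_def)
  ultimately show ?thesis by (simp add: left_confs_def confs_def) (simp add: trunc_def)
qed

lemma T_trunc: "a \<in> CA \<Longrightarrow> \<tau> u \<le> t \<Longrightarrow> i < u \<Longrightarrow> T (trunc t a) i = T a i"
  using trunc[of a t] by (intro T_\<tau>[of _ _ t u]) (auto simp: left_confs_def trunc_def)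

text \<open>A state with lamps \<open>b\<close> and head above \<open>u\<close> is near an image
  point, and the truncated lamps of its preimage lie in the cylinder. The head is raised by
  \<open>K + \<rho>\<close>: the error \<open>K\<close> then spares the lamps below
  \<open>u\<close>, and \<open>\<rho>\<close> is the margin for \<open>left_T\<close>.\<close>

lemma cyl_ne:
  assumes b: "b \<in> left_confs B b0 u"
  shows "1 \<le> card (cyl u b)"
proof -
  let ?q = "(b, u + K + \<rho>)"
  have q: "?q \<in> SB" using b by (simp add: left_confs_def states_confs)
  obtain p where p: "p \<in> SA" "wd (f p) ?q \<le> K" using f_onto[OF q] by blast
  note fd = states_fd[OF f_in[OF p(1)] q]
  have lo: "u + \<rho> \<le> lo (f p) ?q" using p(2) hi_ge(2)[OF fd] by (simp add: wd_def)
  define a where "a = fst p"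
  have a: "a \<in> CA" "p = line a a (snd p)" using p(1) by (auto simp: a_def states_confs line_self)
  have "T (trunc (\<tau> u) a) i = b i" if i: "i < u" for i
  proof -
    have "i < lo (f p) ?q" using i lo \<rho> by linarith
    from agree_below[OF fd this] have "fst (f p) i = b i" by simp
    moreover have "i < H a a (snd p) - \<rho>" using i lo lo_le(1)[OF fd] a(2) by (simp add: H_def)
    ultimately have "T a i = b i" using left_T[OF a(1,1)] a(2) by metis
    then show ?thesis using T_trunc[OF a(1) order_refl i] by simp
  qed
  then have "trunc (\<tau> u) a \<in> cyl u b" using trunc[OF a(1)] by (simp add: cyl_def)
  then show ?thesis using cyl_card(1)[of u b] by (auto simp: Suc_le_eq card_gt_0_iff)
qed

lemma child: "b \<in> left_confs B b0 u \<Longrightarrow> y \<in> B \<Longrightarrow> b(u := y) \<in> left_confs B b0 (u + 1)"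
  using confs_upd[of b B b0 y u] by (auto simp: left_confs_def)

text \<open>Both sides count configurations truncated at \<open>\<tau> (u + 1)\<close> whose image
  begins with \<open>b\<close>: once by the next image letter, once by the lamps between
  \<open>\<tau> u\<close> and \<open>\<tau> (u + 1)\<close>, which are free because they do not
  influence \<open>T\<close> below \<open>u\<close>.\<close>

lemma cyl_children:
  assumes b: "b \<in> left_confs B b0 u"
  shows "(\<Sum>y\<in>B. card (cyl (u + 1) (b(u := y)))) = card A ^ nat (\<tau> (u + 1) - \<tau> u) * card (cyl u b)"
proof -
  define k where "k = nat (\<tau> (u + 1) - \<tau> u)"
  have k: "\<tau> (u + 1) = \<tau> u + int k" using \<tau>_mono[of u "u + 1"] by (simp add: k_def)
  define S where "S = {a \<in> left_confs A a0 (\<tau> (u + 1)). \<forall>i<u. T a i = b i}"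
  have S: "S = (\<Union>y\<in>B. cyl (u + 1) (b(u := y)))"
  proof (intro equalityI subsetI)
    fix a assume a: "a \<in> S"
    then have "T a u \<in> B" by (intro T_in) (simp add: S_def left_confs_def)
    moreover have "a \<in> cyl (u + 1) (b(u := T a u))" using a by (auto simp: S_def cyl_def)
    ultimately show "a \<in> (\<Union>y\<in>B. cyl (u + 1) (b(u := y)))" by blast
  qed (auto simp: S_def cyl_def)
  have "(\<Sum>y\<in>B. card (cyl (u + 1) (b(u := y)))) = card S"
    unfolding S
  proof (rule card_UN_disjoint[symmetric, OF finB])
    show "\<forall>y\<in>B. finite (cyl (u + 1) (b(u := y)))" using cyl_card(1) by blast
    show "\<forall>y\<in>B. \<forall>y'\<in>B. y \<noteq> y' \<longrightarrow> cyl (u + 1) (b(u := y)) \<inter> cyl (u + 1) (b(u := y')) = {}"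
      by (force simp: cyl_def)
  qed
  also have "\<dots> = card (cyl u b \<times> words A k)"
  proof -
    let ?g = "\<lambda>(a, xs). fst (up (a, \<tau> u) xs)"
    have "bij_betw ?g (cyl u b \<times> words A k) S"
      unfolding bij_betw_def
    proof (intro conjI equalityI subsetI)
      show "inj_on ?g (cyl u b \<times> words A k)"
      proof (rule inj_onI)
        fix x x' assume x: "x \<in> cyl u b \<times> words A k" "x' \<in> cyl u b \<times> words A k" "?g x = ?g x'"
        obtain a xs a' xs' where e: "x = (a, xs)" "x' = (a', xs')" by fastforce
        have l: "length xs = k" "length xs' = k" using x e by (auto simp: words_def)
        have g: "fst (up (a, \<tau> u) xs) i = fst (up (a', \<tau> u) xs') i" for i using x(3) e by simp
        have "a i = a' i" for i
          using g[of i] x(1,2) l e by (cases "\<tau> u \<le> i") (auto simp: fst_up cyl_def left_confs_def)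
        moreover have "xs = xs'"
        proof (rule nth_equalityI)
          fix j assume "j < length xs"
          then show "xs ! j = xs' ! j" using g[of "\<tau> u + int j"] l by (simp add: fst_up)
        qed (use l in simp)
        ultimately show "x = x'" using e by blast
      qed
    next
      fix a assume "a \<in> ?g ` (cyl u b \<times> words A k)"
      then obtain a' xs where a: "a' \<in> cyl u b" "xs \<in> words A k" "a = fst (up (a', \<tau> u) xs)" by auto
      have "(a', \<tau> u) \<in> SA" using a(1) by (simp add: cyl_def left_confs_def states_confs)
      then have up: "up (a', \<tau> u) xs \<in> SA" using a(2) by (auto intro: words_up)
      then have aC: "a \<in> CA" by (simp add: a(3) states_confs)
      have "a i = a0" if "\<tau> (u + 1) \<le> i" for i
        using that a k by (auto simp: fst_up words_def cyl_def left_confs_def)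
      moreover have "T a i = b i" if "i < u" for i
        using T_\<tau>[of a a' "\<tau> u" u i] aC a that by (auto simp: fst_up cyl_def left_confs_def)
      ultimately show "a \<in> S" using aC by (simp add: S_def left_confs_def)
    next
      fix a assume a: "a \<in> S"
      then have aC: "a \<in> CA" by (simp add: S_def left_confs_def)
      let ?xs = "map (\<lambda>j. a (\<tau> u + int j)) [0..<k]"
      have "trunc (\<tau> u) a \<in> cyl u b"
        using trunc[OF aC] T_trunc[OF aC order_refl] a by (auto simp: cyl_def S_def)
      moreover have "?xs \<in> words A k" using aC by (auto simp: words_def confs_def)
      moreover have "a = ?g (trunc (\<tau> u) a, ?xs)"
        using a k by (auto simp: fun_eq_iff fst_up trunc_def S_def left_confs_def)
      ultimately show "a \<in> ?g ` (cyl u b \<times> words A k)" by blast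
    qed
    then show ?thesis by (simp add: bij_betw_same_card)
  qed
  also have "\<dots> = card A ^ k * card (cyl u b)" by (simp add: card_cartesian_product words_card(1)[OF finA])
  finally show ?thesis by (simp only: k_def)
qed

end

text \<open>The numbers \<open>M u * n ^ u / m ^ s u\<close> increase, are bounded, and grow by at least \<open>1 / (n * N1)\<close>
  whenever they change. So they are eventually constant, and some value of \<open>M\<close> recurs.\<close>

lemma powers_eq_of_bounded_products:
  fixes M :: "nat \<Rightarrow> nat" and N1 n m :: nat and s :: "nat \<Rightarrow> nat"
  assumes n: "2 \<le> n" and m: "1 \<le> m" and s: "\<And>u. s u \<le> s (Suc u)"
    and M: "\<And>u. 1 \<le> M u" "\<And>u. M u \<le> N1"
    and step: "\<And>u. m ^ (s (Suc u) - s u) * M u \<le> n * M (Suc u)"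
    and bound: "\<And>u. n ^ u \<le> N1 * m ^ s u" and s0: "s 0 = 0"
  shows "\<exists>i j. 0 < i \<and> 0 < j \<and> n ^ i = m ^ j"
proof -
  define G where "G u = real (M u) * real n ^ u / real m ^ s u" for u
  have n0: "0 < real n" and m0: "0 < real m" using n m by auto
  have pw: "real m ^ s (Suc u) = real m ^ (s (Suc u) - s u) * real m ^ s u" for u
    using s[of u] by (simp flip: power_add)
  have GS: "G (Suc u) = real (n * M (Suc u)) * (real n ^ u / real m ^ s (Suc u))" for u
    by (simp add: G_def)
  have GG: "G u = real (m ^ (s (Suc u) - s u) * M u) * (real n ^ u / real m ^ s (Suc u))" for u
    unfolding pw using m0 by (simp add: G_def)
  have N1: "1 \<le> N1" using M[of 0] by linarith
  have mono: "G u \<le> G (Suc u)" for u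
    unfolding GS GG[of u] using step[of u] n0 m0
    by (intro mult_right_mono) (simp_all only: of_nat_le_iff, simp)
  have inc: "incseq G" using mono by (rule incseq_SucI)
  have up: "G u \<le> real N1 * real N1" for u
  proof -
    have "real n ^ u \<le> real N1 * real m ^ s u" using bound[of u] by (simp flip: of_nat_power of_nat_mult)
    then have "real n ^ u / real m ^ s u \<le> real N1" using m0 by (simp add: field_simps)
    then have "real (M u) * (real n ^ u / real m ^ s u) \<le> real N1 * real N1"
      using M[of u] by (intro mult_mono) auto
    then show ?thesis by (simp add: G_def)
  qed
  have low: "1 \<le> G u" for u
  proof -
    have "1 \<le> G 0" using M(1)[of 0] by (simp add: G_def s0)
    also have "G 0 \<le> G u" using incseqD[OF inc, of 0 u] by simp
    finally show ?thesis .
  qed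
  define d where "d = 1 / (real n * real N1)"
  have d: "0 < d" using n0 N1 by (simp add: d_def)
  \<comment> \<open>The difference is an integer multiple of \<open>n ^ u / m ^ s (Suc u)\<close>,
    and this unit is at least \<open>d\<close> because \<open>1 \<le> G (Suc u)\<close> while
    \<open>n * M (Suc u) \<le> n * N1\<close>.\<close>
  have jump: "G u + d \<le> G (Suc u)" if "G u \<noteq> G (Suc u)" for u
  proof -
    define x where "x = real n ^ u / real m ^ s (Suc u)"
    have x: "0 < x" using n0 m0 by (simp add: x_def)
    have "m ^ (s (Suc u) - s u) * M u \<noteq> n * M (Suc u)" using that unfolding GS GG[of u] by metis
    then have "m ^ (s (Suc u) - s u) * M u + 1 \<le> n * M (Suc u)" using step[of u] by linarith
    then have "real (m ^ (s (Suc u) - s u) * M u + 1) * x \<le> real (n * M (Suc u)) * x"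
      using x by (intro mult_right_mono of_nat_mono) auto
    then have "G u + x \<le> G (Suc u)" unfolding GS GG[of u] x_def[symmetric] by (simp add: algebra_simps)
    moreover have "d \<le> x"
    proof -
      have "1 \<le> real (n * M (Suc u)) * x" using low[of "Suc u"] by (simp only: GS x_def)
      also have "\<dots> \<le> (real n * real N1) * x"
        using M(2)[of "Suc u"] n0 x by (intro mult_right_mono) auto
      finally show ?thesis using n0 N1 by (simp add: d_def field_simps)
    qed
    ultimately show ?thesis by linarith
  qed
  obtain l where "G \<longlonglongrightarrow> l" using incseq_convergent[OF inc, of "real N1 * real N1"] up by blast
  then have "Cauchy G" by (rule LIMSEQ_imp_Cauchy)
  then obtain u0 where u0: "\<And>u v. u \<ge> u0 \<Longrightarrow> v \<ge> u0 \<Longrightarrow> dist (G u) (G v) < d"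
    using d unfolding Cauchy_def by blast
  have const: "G (Suc u) = G u" if "u \<ge> u0" for u
    using u0[OF that, of "Suc u"] jump[of u] that by (cases "G u = G (Suc u)") (auto simp: dist_real_def)
  have const': "G u = G u0" if "u \<ge> u0" for u
    using that const by (induction u rule: dec_induct) auto
  have "\<not> inj_on M {u0..u0 + N1}"
  proof
    assume "inj_on M {u0..u0 + N1}"
    then have "card {u0..u0 + N1} \<le> card {1..N1}"
      using M by (intro card_inj_on_le[of M]) auto
    then show False by simp
  qed
  then obtain u v where uv: "u0 \<le> u" "u < v" "M u = M v"
    unfolding inj_on_def by (metis atLeastAtMost_iff nat_neq_iff)
  have "G u = G v" using const'[of u] const'[of v] uv by simp
  then have *: "real (M v) * (real n ^ u / real m ^ s u) = real (M v) * (real n ^ v / real m ^ s v)"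
    using uv(3) by (simp add: G_def)
  have "real (M v) \<noteq> 0" using M(1)[of v] by linarith
  then have **: "real n ^ u / real m ^ s u = real n ^ v / real m ^ s v"
    by (rule mult_left_cancel[THEN iffD1, OF _ *])
  have "real n ^ u * real m ^ s v = real n ^ v * real m ^ s u"
    by (rule frac_eq_eq[THEN iffD1, OF _ _ **]) (use m0 in simp_all)
  then have "real (n ^ u * m ^ s v) = real (n ^ v * m ^ s u)" by simp
  then have eq: "n ^ u * m ^ s v = n ^ v * m ^ s u" by (simp only: of_nat_eq_iff)
  have suv: "s u \<le> s v" by (rule lift_Suc_mono_le[of s, OF s]) (use uv(2) in simp)
  have "n ^ v = n ^ u * n ^ (v - u)" "m ^ s v = m ^ s u * m ^ (s v - s u)"
    using uv(2) suv by (simp_all flip: power_add)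
  with eq have e: "m ^ (s v - s u) = n ^ (v - u)" using n m by simp
  have "s v - s u \<noteq> 0"
  proof
    assume "s v - s u = 0"
    then have "n ^ (v - u) = 1" using e by simp
    then show False using n uv(2) by simp
  qed
  then show ?thesis using e uv(2) by (intro exI[of _ "v - u"] exI[of _ "s v - s u"]) auto
qed

context nontrivial_rising_qi
begin

text \<open>For \<open>M\<close>, take the largest cylinder: its children are all bounded by the
  next maximum. For the bound on \<open>card B ^ u\<close>, descend instead to a child of at most
  average size each time; as cylinders are never empty, \<open>card B ^ u\<close> cannot outgrow
  \<open>card A ^ s u\<close>.\<close>

lemma dependent: "\<exists>i j. 0 < i \<and> 0 < j \<and> card B ^ i = card A ^ j"
proof -
  define s where "s u = nat (\<tau> (int u) - \<tau> 0)" for u :: nat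
  define W where "W u = (\<lambda>b. card (cyl (int u) b)) ` left_confs B b0 (int u)" for u
  define M where "M u = Max (W u)" for u
  have zb: "(\<lambda>_. b0) \<in> left_confs B b0 u" for u using b0 by (simp add: left_confs_def confs_def)
  have W: "finite (W u)" "W u \<noteq> {}" for u
    using zb finite_subset[of "W u" "{..N1}"] cyl_card(2) by (auto simp: W_def)
  have tm: "\<tau> 0 \<le> \<tau> (int u)" "\<tau> (int u) \<le> \<tau> (int u + 1)" for u by (auto intro: \<tau>_mono)
  have sS: "nat (\<tau> (int u + 1) - \<tau> (int u)) = s (Suc u) - s u" "s u \<le> s (Suc u)" for u
    using tm[of u] tm(1)[of "Suc u"] by (auto simp: s_def add.commute)
  have Mw: "card (cyl (int u) b) \<le> M u" if "b \<in> left_confs B b0 (int u)" for u b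
    unfolding M_def using W(1) that by (intro Max_ge) (auto simp: W_def)
  show ?thesis
  proof (rule powers_eq_of_bounded_products[of "card B" "card A" s M N1])
    fix u
    have "M u \<in> W u" unfolding M_def by (rule Max_in[OF W])
    then obtain b where b: "b \<in> left_confs B b0 (int u)" "M u = card (cyl (int u) b)" by (auto simp: W_def)
    show "1 \<le> M u" using cyl_ne[OF b(1)] b(2) by simp
    show "M u \<le> N1" using cyl_card(2) b(2) by simp
    have "card A ^ (s (Suc u) - s u) * M u = (\<Sum>y\<in>B. card (cyl (int u + 1) (b(int u := y))))"
      using cyl_children[OF b(1)] sS(1) b(2) by simp
    also have "\<dots> \<le> (\<Sum>y\<in>B. M (Suc u))"
      using Mw[of _ "Suc u"] child[OF b(1)] by (intro sum_mono) (simp add: add.commute)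
    finally show "card A ^ (s (Suc u) - s u) * M u \<le> card B * M (Suc u)" by simp
    have "\<exists>b\<in>left_confs B b0 (int u). card (cyl (int u) b) * card B ^ u \<le> N1 * card A ^ s u"
    proof (induction u)
      case 0
      then show ?case using zb[of 0] cyl_card(2)[of 0] by (auto simp: s_def)
    next
      case (Suc u)
      then obtain b where b: "b \<in> left_confs B b0 (int u)"
        "card (cyl (int u) b) * card B ^ u \<le> N1 * card A ^ s u" by blast
      have "\<exists>y\<in>B. card B * card (cyl (int u + 1) (b(int u := y))) \<le> card A ^ (s (Suc u) - s u) * card (cyl (int u) b)"
      proof (rule ccontr)
        assume "\<not> ?thesis"
        then have "(\<Sum>y\<in>B. card A ^ (s (Suc u) - s u) * card (cyl (int u) b)) <
            (\<Sum>y\<in>B. card B * card (cyl (int u + 1) (b(int u := y))))"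
          using finB Bne(1) by (intro sum_strict_mono) auto
        then show False using cyl_children[OF b(1)] sS(1) by (simp flip: sum_distrib_left)
      qed
      then obtain y where y: "y \<in> B" "card B * card (cyl (int u + 1) (b(int u := y))) \<le>
          card A ^ (s (Suc u) - s u) * card (cyl (int u) b)" by blast
      have "card (cyl (int u + 1) (b(int u := y))) * card B ^ Suc u =
          (card B * card (cyl (int u + 1) (b(int u := y)))) * card B ^ u" by simp
      also have "\<dots> \<le> (card A ^ (s (Suc u) - s u) * card (cyl (int u) b)) * card B ^ u"
        using y(2) by (rule mult_le_mono1)
      also have "\<dots> = card A ^ (s (Suc u) - s u) * (card (cyl (int u) b) * card B ^ u)" by simp
      also have "\<dots> \<le> card A ^ (s (Suc u) - s u) * (N1 * card A ^ s u)" using b(2) by (rule mult_le_mono2)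
      also have "\<dots> = N1 * card A ^ s (Suc u)" using sS(2)[of u] by (simp flip: power_add)
      finally have "card (cyl (int u + 1) (b(int u := y))) * card B ^ Suc u \<le> N1 * card A ^ s (Suc u)" .
      moreover have "int (Suc u) = int u + 1" by simp
      ultimately show ?case using child[OF b(1) y(1)] by metis
    qed
    then obtain b where b: "b \<in> left_confs B b0 (int u)" "card (cyl (int u) b) * card B ^ u \<le> N1 * card A ^ s u"
      by blast
    have "1 * card B ^ u \<le> card (cyl (int u) b) * card B ^ u" using cyl_ne[OF b(1)] by (rule mult_le_mono1)
    then show "card B ^ u \<le> N1 * card A ^ s u" using b(2) by linarith
  qed (use cA cB sS in \<open>auto simp: s_def\<close>)
qed

end

lemma (in lamp_qi) multiplicatively_dependent:
  assumes cA: "2 \<le> card A" and cB: "2 \<le> card B"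
  shows "\<exists>i j. 0 < i \<and> 0 < j \<and> card B ^ i = card A ^ j"
proof -
  obtain R where R: "1 \<le> R"
    "(\<forall>a\<in>CA. \<forall>b\<in>CA. \<forall>t. H a b t + 1 \<le> H a b (t + int R)) \<or>
     (\<forall>a\<in>CA. \<forall>b\<in>CA. \<forall>t. H a b (t + int R) + 1 \<le> H a b t)"
    by (rule monotone_dichotomy[OF cA cB])
  from R(2) show ?thesis
  proof
    assume r: "\<forall>a\<in>CA. \<forall>b\<in>CA. \<forall>t. H a b t + 1 \<le> H a b (t + int R)"
    interpret nontrivial_rising_qi A a0 B b0 f K R
      by unfold_locales (use R(1) r cA cB in \<open>auto simp: H_def\<close>)
    show ?thesis by (rule dependent)
  next
    assume r: "\<forall>a\<in>CA. \<forall>b\<in>CA. \<forall>t. H a b (t + int R) + 1 \<le> H a b t"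
    interpret m: lamp_qi A a0 B b0 "\<lambda>p. mirror (f p)" K by (rule mirror_lamp_qi)
    interpret nontrivial_rising_qi A a0 B b0 "\<lambda>p. mirror (f p)" K R
    proof (unfold_locales)
      fix a b t assume "a \<in> CA" "b \<in> CA"
      then show "snd (mirror (f (line a b t))) + 1 \<le> snd (mirror (f (line a b (t + int R))))"
        using r[rule_format, of a b t] by (simp add: H_def)
    qed (use R(1) cA cB in auto)
    show ?thesis by (rule dependent)
  qed
qed

text \<open>A Euclidean descent: if \<open>m < n\<close>, then \<open>i < j\<close>, so
  \<open>m\<close> divides \<open>n\<close>, and the quotient \<open>q\<close> satisfies
  \<open>q ^ i = m ^ (j - i)\<close> with a smaller sum \<open>q + m\<close>.\<close>

lemma common_base:
  fixes n m i j :: nat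
  assumes "0 < i" "0 < j" "n ^ i = m ^ j" "2 \<le> n" "2 \<le> m"
  shows "\<exists>d s r. 0 < d \<and> 0 < s \<and> 0 < r \<and> n = d ^ s \<and> m = d ^ r"
  using assms
proof (induction "n + m" arbitrary: n m i j rule: less_induct)
  case less
  have main: "\<exists>d s r. 0 < d \<and> 0 < s \<and> 0 < r \<and> n = d ^ s \<and> m = d ^ r"
    if h: "m < n" "n + m = n' + m'" "0 < i" "0 < j" "n ^ i = m ^ j" "2 \<le> n" "2 \<le> m"
      and IH: "\<And>a b i j :: nat. a + b < n' + m' \<Longrightarrow> 0 < i \<Longrightarrow> 0 < j \<Longrightarrow> a ^ i = b ^ j \<Longrightarrow> 2 \<le> a \<Longrightarrow> 2 \<le> b \<Longrightarrow>
        \<exists>d s r. 0 < d \<and> 0 < s \<and> 0 < r \<and> a = d ^ s \<and> b = d ^ r"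
    for n m i j n' m' :: nat
  proof -
    have ij: "i < j"
    proof (rule ccontr)
      assume "\<not> i < j"
      then have "m ^ j \<le> m ^ i" using h by (intro power_increasing) auto
      also have "\<dots> < n ^ i" using h by (intro power_strict_mono) auto
      finally show False using h by simp
    qed
    then have "m ^ i dvd n ^ i" using h(5) by (simp add: le_imp_power_dvd)
    then have "m dvd n" using h(3) by simp
    then obtain q where q: "n = m * q" by blast
    have "m ^ i * q ^ i = m ^ i * m ^ (j - i)"
      using h(5) q ij by (simp add: power_mult_distrib flip: power_add)
    then have e: "q ^ i = m ^ (j - i)" using h by simp
    have q2: "2 \<le> q" using q h by (cases q) (auto simp: Suc_le_eq)
    have "q + m < n' + m'" using q q2 h by (simp add: h(2)[symmetric])
    from IH[OF this h(3) _ e q2 h(7)] ij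
    obtain d s r where "0 < d" "0 < s" "0 < r" "q = d ^ s" "m = d ^ r" by auto
    then show ?thesis using q by (intro exI[of _ d] exI[of _ "r + s"] exI[of _ r]) (auto simp: power_add)
  qed
  consider "n = m" | "m < n" | "n < m" by linarith
  then show ?case
  proof cases
    case 1
    then show ?thesis using less.prems by (intro exI[of _ n] exI[of _ 1]) auto
  next
    case 2
    show ?thesis by (rule main[OF 2 refl less.prems less.hyps])
  next
    case 3
    have "\<exists>d s r. 0 < d \<and> 0 < s \<and> 0 < r \<and> m = d ^ s \<and> n = d ^ r"
      using less.prems less.hyps by (intro main[OF 3 add.commute[of m n], of j i]) auto
    then show ?thesis by blast
  qed
qed

section \<open>Trivial lamps\<close>

context lamp_qi
begin

text \<open>With one letter in the codomain \<open>ln (card B) = 0\<close>, so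
  \<open>typical_lower\<close> would allow a speed above the Lipschitz bound of
  \<open>f\<close>.\<close>

lemma cod_nontrivial:
  assumes "2 \<le> card A" shows "2 \<le> card B"
proof (rule ccontr)
  assume "\<not> 2 \<le> card B"
  then have B1: "card B = 1" using Bne(2) by linarith
  define s where "s = 2 * real_of_int K + 1"
  have "0 < ln (real (card A))" using assms by simp
  then obtain R0 where R0: "\<And>R p. R \<ge> R0 \<Longrightarrow> p \<in> SA \<Longrightarrow> frac A R (\<lambda>ys. wdf p (up p ys) < s * real R) \<le> 1 / 2"
    using typical_lower[of s "1 / 2"] K B1 by (auto simp: s_def)
  obtain p where p: "p \<in> SA" using SA_ne by auto
  define R where "R = max R0 1"
  have "1 / 2 \<le> frac A R (\<lambda>ys. \<not> wdf p (up p ys) < s * real R)"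
    using R0[of R p] p by (simp add: frac_compl[OF finA Ane(1)] R_def)
  then obtain ys where ys: "ys \<in> words A R" "s * real R \<le> wdf p (up p ys)"
    using frac_pos[of A R "\<lambda>ys. \<not> wdf p (up p ys) < s * real R"] by fastforce
  have "wd (f p) (f (up p ys)) \<le> K * wd p (up p ys) + K" using f_le[OF p words_up[OF p ys(1)]] .
  also have "\<dots> \<le> K * int R + K"
    using wd_up[of p ys] ys(1) K by (auto simp: words_def intro: mult_left_mono)
  finally have "wdf p (up p ys) \<le> real_of_int (K * int R + K)" by (simp only: of_int_le_iff)
  then have "s * real R \<le> real_of_int K * real R + real_of_int K" using ys(2) by simp
  moreover have "real_of_int K * 1 \<le> real_of_int K * real R" using K by (intro mult_left_mono) (auto simp: R_def)
  moreover have "0 < real R" by (simp add: R_def)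
  ultimately show False by (simp add: s_def algebra_simps)
qed

text \<open>With one letter in the domain, balls there grow at most quadratically, yet they would
  have to cover \<open>card B ^ R\<close> states near \<open>f z0\<close>.\<close>

lemma dom_nontrivial:
  assumes "2 \<le> card B" shows "2 \<le> card A"
proof (rule ccontr)
  assume "\<not> 2 \<le> card A"
  then have A1: "card A = 1" using Ane(2) by linarith
  obtain z0 where z0: "z0 \<in> SA" using SA_ne by auto
  have le: "real (card B) ^ R \<le> real mult_cod * (real_of_int K * real R + (real_of_int K * (real_of_int K + 1) + 1)) ^ 2" for R
  proof -
    define Z where "Z = ball A a0 z0 (nat (K * (K + int R) + K))"
    define Qs where "Qs = up (f z0) ` words B R"
    have Qin: "up (f z0) ys \<in> SB" if "ys \<in> words B R" for ys
      using that f_in[OF z0] by (auto simp: words_def intro: up_states)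
    have "finite Z" unfolding Z_def by (rule ball_card(1)[OF finA z0])
    moreover have "Z \<subseteq> SA" by (auto simp: Z_def ball_def)
    moreover have "Qs \<subseteq> SB" using Qin by (auto simp: Qs_def)
    moreover have "\<exists>z\<in>Z. wd (f z) q \<le> K" if q: "q \<in> Qs" for q
    proof -
      obtain ys where ys: "ys \<in> words B R" "q = up (f z0) ys" using q by (auto simp: Qs_def)
      then have qB: "q \<in> SB" using Qin by simp
      obtain z where z: "z \<in> SA" "wd (f z) q \<le> K" using f_onto[OF qB] by blast
      have "wd (f z0) (f z) \<le> wd (f z0) q + wd q (f z)"
        by (intro wd_triangle states_fd[OF f_in[OF z0] qB] states_fd[OF qB f_in[OF z(1)]])
      also have "\<dots> \<le> int R + K"
        using wd_up[of "f z0" ys] ys z(2) by (simp add: words_def wd_commute)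
      finally have "K * wd (f z0) (f z) \<le> K * (K + int R)" using K by (intro mult_left_mono) auto
      then have "wd z0 z \<le> K * (K + int R) + K" using f_ge[OF z0 z(1)] by linarith
      then have "z \<in> Z" using z(1) K by (simp add: Z_def ball_def)
      then show ?thesis using z(2) by blast
    qed
    ultimately have "card Qs \<le> mult_cod * card Z" by (rule card_cover)
    also have "\<dots> \<le> mult_cod * (nat (K * (K + int R) + K) + 1) ^ 2"
      using ball_card(2)[OF finA z0, of "nat (K * (K + int R) + K)"] A1 by (simp add: Z_def)
    finally have "card Qs \<le> mult_cod * (nat (K * (K + int R) + K) + 1) ^ 2" .
    moreover have "card Qs = card B ^ R"
    proof -
      have "inj_on (up (f z0)) (words B R)"
        by (rule inj_onI, rule up_inj) (auto simp: words_def)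
      then show ?thesis by (simp add: Qs_def card_image words_card(1)[OF finB])
    qed
    ultimately have "real (card B ^ R) \<le> real (mult_cod * (nat (K * (K + int R) + K) + 1) ^ 2)"
      by (simp only: of_nat_le_iff)
    also have "\<dots> = real mult_cod * (real_of_int (K * (K + int R) + K) + 1) ^ 2"
      using K by simp
    finally show ?thesis by (simp add: algebra_simps)
  qed
  have l: "0 < ln (real (card B))" using assms by simp
  have half: "0 < (1 / 2 :: real)" by simp
  obtain R0 where R0: "\<And>R. R \<ge> R0 \<Longrightarrow> real mult_cod * (real_of_int K * real R + (real_of_int K * (real_of_int K + 1) + 1)) ^ 2 *
      exp (- ln (real (card B)) * real R) \<le> 1 / 2"
    using power_exp_decay[OF l half] by blast
  have "real (card B) ^ R0 = exp (ln (real (card B)) * real R0)"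
    using Bne(2) by (simp add: mult.commute[of "ln _"] exp_of_nat_mult)
  then have "1 = real (card B) ^ R0 * exp (- ln (real (card B)) * real R0)"
    by (simp add: exp_minus)
  also have "\<dots> \<le> 1 / 2"
    by (rule order.trans[OF mult_right_mono[OF le] R0]) auto
  finally show False by simp
qed

lemma common_power:
  "\<exists>d s r. 0 < d \<and> 0 < s \<and> 0 < r \<and> card A = d ^ s \<and> card B = d ^ r"
proof (cases "2 \<le> card A")
  case True
  note cB = cod_nontrivial[OF True]
  obtain i j where "0 < i" "0 < j" "card B ^ i = card A ^ j"
    using multiplicatively_dependent[OF True cB] by blast
  from common_base[OF this cB True] show ?thesis by blast
next
  case False
  then have "card A = 1" "card B = 1" using dom_nontrivial Ane(2) Bne(2) by linarith+
  then show ?thesis by (intro exI[of _ 1]) auto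
qed

end

section \<open>Recoding blocks of lamps\<close>

definition block :: "nat \<Rightarrow> (int \<Rightarrow> 'a) \<Rightarrow> int \<Rightarrow> 'a list" where
  "block r c j = map (\<lambda>k. c (int r * j + int k)) [0..<r]"

text \<open>The head goes to the start of the block that replaces its own. Forgetting its place
  inside the block costs a bounded error and makes the map act blockwise.\<close>

definition recode :: "nat \<Rightarrow> nat \<Rightarrow> ('a list \<Rightarrow> 'b list) \<Rightarrow> 'a state \<Rightarrow> 'b state" where
  "recode r s \<phi> p = (\<lambda>i. \<phi> (block r (fst p) (i div int s)) ! nat (i mod int s), snd p div int r * int s)"

lemma block_eq_iff:
  assumes "0 < r"
  shows "block r c j = block r c' j \<longleftrightarrow> (\<forall>i. i div int r = j \<longrightarrow> c i = c' i)"
proof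
  assume e: "block r c j = block r c' j"
  show "\<forall>i. i div int r = j \<longrightarrow> c i = c' i"
  proof (intro allI impI)
    fix i assume i: "i div int r = j"
    define k where "k = nat (i mod int r)"
    have k: "k < r" "i = int r * j + int k"
      using assms mult_div_mod_eq[of "int r" i] unfolding i by (simp_all add: k_def nat_less_iff)
    have "block r c j ! k = block r c' j ! k" using e by simp
    then show "c i = c' i" using k by (simp add: block_def)
  qed
next
  assume "\<forall>i. i div int r = j \<longrightarrow> c i = c' i"
  then show "block r c j = block r c' j" by (simp add: block_def)
qed

lemma div_less_imp: "0 < k \<Longrightarrow> i div int k < l div int k \<Longrightarrow> i < l"
  using zdiv_mono1[of l i "int k"] by linarith

lemma div_bounds:
  assumes "0 < k" shows "t div int k * int k \<le> t" "t < t div int k * int k + int k"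
  using div_mult_mod_eq[of t "int k"] pos_mod_bound[of "int k" t] pos_mod_sign[of "int k" t] assms
  by linarith+

lemma less_mult_div: "0 < k \<Longrightarrow> i < j * int k \<Longrightarrow> i div int k < j"
proof (rule ccontr)
  assume h: "0 < k" "i < j * int k" "\<not> i div int k < j"
  then have "j * int k \<le> i div int k * int k" by (intro mult_right_mono) auto
  then show False using div_bounds(1)[OF h(1), of i] h(2) by linarith
qed

lemma fst_recode_block:
  assumes "0 < s" "length (\<phi> (block r (fst p) j)) = s"
  shows "block s (fst (recode r s \<phi> p)) j = \<phi> (block r (fst p) j)"
  using assms by (intro nth_equalityI) (auto simp: block_def recode_def)

text \<open>The condition \<open>\<phi>0\<close> preserves finite support, since default blocks go
  to default blocks.\<close>

locale recoding =
  fixes A :: "'a set" and a0 :: 'a and B :: "'b set" and b0 :: 'b and r s :: nat and \<phi> :: "'a list \<Rightarrow> 'b list"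
  assumes a0: "a0 \<in> A" and b0: "b0 \<in> B" and r: "0 < r" and s: "0 < s"
    and bij: "bij_betw \<phi> (words A r) (words B s)" and \<phi>0: "\<phi> (replicate r a0) = replicate s b0"
begin

lemma block_words: "p \<in> states A a0 \<Longrightarrow> block r (fst p) j \<in> words A r"
  by (auto simp: block_def words_def states_def)

lemma \<phi>_words: "xs \<in> words A r \<Longrightarrow> \<phi> xs \<in> words B s"
  using bij by (auto simp: bij_betw_def)

lemma \<phi>_eq: "xs \<in> words A r \<Longrightarrow> ys \<in> words A r \<Longrightarrow> \<phi> xs = \<phi> ys \<longleftrightarrow> xs = ys"
  using bij by (auto simp: bij_betw_def inj_on_def)

lemma recode_block: "p \<in> states A a0 \<Longrightarrow> block s (fst (recode r s \<phi> p)) j = \<phi> (block r (fst p) j)"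
  using \<phi>_words[OF block_words] by (intro fst_recode_block[OF s]) (simp add: words_def)

text \<open>Injectivity of \<open>\<phi>\<close> on words. Both distance estimates follow from it,
  as hulls matter only up to whole blocks.\<close>

lemma block_agree:
  assumes "p \<in> states A a0" "q \<in> states A a0"
  shows "(\<forall>i. i div int s = j \<longrightarrow> fst (recode r s \<phi> p) i = fst (recode r s \<phi> q) i) \<longleftrightarrow>
    (\<forall>i. i div int r = j \<longrightarrow> fst p i = fst q i)"
  unfolding block_eq_iff[OF s, symmetric] block_eq_iff[OF r, symmetric]
  using assms by (simp add: recode_block \<phi>_eq block_words)

lemma zero_state: "(\<lambda>_. a0, t) \<in> states A a0"
  using a0 by (simp add: states_def)

lemma recode_zero: "fst (recode r s \<phi> (\<lambda>_. a0, t)) i = b0"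
proof -
  have "block r (\<lambda>_. a0) j = replicate r a0" for j by (simp add: block_def map_replicate_const)
  then show ?thesis using s by (simp add: recode_def \<phi>0 nat_less_iff)
qed

lemma recode_states:
  assumes p: "p \<in> states A a0"
  shows "recode r s \<phi> p \<in> states B b0"
proof -
  have "fst (recode r s \<phi> p) i \<in> B" for i
  proof -
    have "\<phi> (block r (fst p) (i div int s)) \<in> words B s" using \<phi>_words[OF block_words[OF p]] .
    moreover have "nat (i mod int s) < s" using s by (simp add: nat_less_iff)
    ultimately show ?thesis using nth_mem by (fastforce simp: recode_def words_def)
  qed
  moreover have "finite {i. fst (recode r s \<phi> p) i \<noteq> b0}"
  proof (rule finite_subset)
    let ?J = "(\<lambda>i. i div int r) ` {i. fst p i \<noteq> a0}"
    show "{i. fst (recode r s \<phi> p) i \<noteq> b0} \<subseteq> (\<Union>j\<in>?J. {int s * j..int s * j + int s})"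
    proof
      fix i assume i: "i \<in> {i. fst (recode r s \<phi> p) i \<noteq> b0}"
      define j where "j = i div int s"
      have "\<not> (\<forall>i. i div int s = j \<longrightarrow> fst (recode r s \<phi> p) i = fst (recode r s \<phi> (\<lambda>_. a0, 0)) i)"
        using i recode_zero by (auto simp: j_def)
      then obtain k where "k div int r = j" "fst p k \<noteq> a0"
        using block_agree[OF p zero_state[of 0], of j] by auto
      then have "j \<in> ?J" by blast
      moreover have "i \<in> {int s * j..int s * j + int s}"
        using div_bounds[OF s, of i] by (simp add: j_def mult.commute)
      ultimately show "i \<in> (\<Union>j\<in>?J. {int s * j..int s * j + int s})" by blast
    qed
    show "finite (\<Union>j\<in>?J. {int s * j..int s * j + int s})" using p by (simp add: states_def)
  qed
  ultimately show ?thesis by (simp add: states_def)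
qed

lemma div_window: "0 < k \<Longrightarrow> (u div int k - l div int k + 1) * m \<le> m * (u - l) + 2 * m" if "l \<le> u" "0 \<le> m" for k l u m
proof -
  assume k: "0 < k"
  have "u div int k - l div int k \<le> u - l + 1"
  proof -
    have "u div int k \<le> (l + (u - l) * int k) div int k"
      using that k mult_left_mono[of 1 "int k" "u - l"] by (intro zdiv_mono1) auto
    also have "\<dots> = l div int k + (u - l)" using k by simp
    finally show ?thesis by simp
  qed
  then have "(u div int k - l div int k + 1) * m \<le> (u - l + 2) * m" using that by (intro mult_right_mono) auto
  then show ?thesis by (simp add: algebra_simps)
qed

lemma recode_upper:
  assumes p: "p \<in> states A a0" and q: "q \<in> states A a0"
  shows "wd (recode r s \<phi> p) (recode r s \<phi> q) \<le> int s * wd p q + 2 * int s"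
proof -
  note fd = states_fd[OF p q]
  define l where "l = lo p q" define u where "u = hi p q"
  have lu: "l \<le> snd p" "l \<le> snd q" "snd p \<le> u" "snd q \<le> u" using lo_le[OF fd] hi_ge[OF fd] by (auto simp: l_def u_def)
  have "wd (recode r s \<phi> p) (recode r s \<phi> q) \<le> (u div int r + 1) * int s - l div int r * int s"
  proof (rule wd_le[OF states_fd[OF recode_states[OF p] recode_states[OF q]]])
    show "l div int r * int s \<le> snd (recode r s \<phi> p)" "l div int r * int s \<le> snd (recode r s \<phi> q)"
      using lu r by (auto simp: recode_def intro!: mult_right_mono zdiv_mono1)
    show "snd (recode r s \<phi> p) \<le> (u div int r + 1) * int s" "snd (recode r s \<phi> q) \<le> (u div int r + 1) * int s"
      using lu r zdiv_mono1[of "snd p" u "int r"] zdiv_mono1[of "snd q" u "int r"]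
      by (auto simp: recode_def intro!: mult_right_mono)
    fix i
    show "fst (recode r s \<phi> p) i = fst (recode r s \<phi> q) i" if i: "i < l div int r * int s"
    proof -
      have "i div int s < l div int r" using less_mult_div[OF s i] .
      then have "fst p k = fst q k" if "k div int r = i div int s" for k
        using that div_less_imp[OF r, of k l] unfolding l_def by (intro agree_below[OF fd]) linarith
      then show ?thesis using block_agree[OF p q, of "i div int s"] by blast
    qed
    show "fst (recode r s \<phi> p) i = fst (recode r s \<phi> q) i" if i: "(u div int r + 1) * int s \<le> i"
    proof -
      have "u div int r < i div int s" using zdiv_mono1[OF i, of "int s"] s by simp
      then have "fst p k = fst q k" if "k div int r = i div int s" for k
        using that div_less_imp[OF r, of u k] unfolding u_def by (intro agree_above[OF fd]) linarith
      then show ?thesis using block_agree[OF p q, of "i div int s"] by blast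
    qed
  qed
  also have "\<dots> = (u div int r - l div int r + 1) * int s" by (simp add: algebra_simps)
  also have "\<dots> \<le> int s * (u - l) + 2 * int s" using div_window[of l u "int s" r] lu r by linarith
  finally show ?thesis by (simp add: wd_def l_def u_def)
qed

lemma recode_lower:
  assumes p: "p \<in> states A a0" and q: "q \<in> states A a0"
  shows "wd p q \<le> int r * wd (recode r s \<phi> p) (recode r s \<phi> q) + 2 * int r"
proof -
  let ?p = "recode r s \<phi> p" and ?q = "recode r s \<phi> q"
  note fd = states_fd[OF recode_states[OF p] recode_states[OF q]]
  define l where "l = lo ?p ?q" define u where "u = hi ?p ?q"
  have lu: "l \<le> snd ?p" "l \<le> snd ?q" "snd ?p \<le> u" "snd ?q \<le> u" using lo_le[OF fd] hi_ge[OF fd] by (auto simp: l_def u_def)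
  have hd: "l div int s \<le> t div int r" "t div int r \<le> u div int s" if "t \<in> {snd p, snd q}" for t
  proof -
    have "l \<le> t div int r * int s" "t div int r * int s \<le> u" using lu that by (auto simp: recode_def)
    from zdiv_mono1[OF this(1), of "int s"] zdiv_mono1[OF this(2), of "int s"] s
    show "l div int s \<le> t div int r" "t div int r \<le> u div int s" by simp_all
  qed
  have win: "l div int s * int r \<le> t" "t \<le> (u div int s + 1) * int r" if "t \<in> {snd p, snd q}" for t
  proof -
    note m = div_bounds[OF r, of t]
    show "l div int s * int r \<le> t" using mult_right_mono[OF hd(1)[OF that], of "int r"] m by linarith
    show "t \<le> (u div int s + 1) * int r"
    proof -
      have e: "(u div int s + 1) * int r = u div int s * int r + int r" by (simp add: algebra_simps)
      show ?thesis unfolding e using mult_right_mono[OF hd(2)[OF that], of "int r"] m by linarith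
    qed
  qed
  have "wd p q \<le> (u div int s + 1) * int r - l div int s * int r"
  proof (rule wd_le[OF states_fd[OF p q]])
    fix i
    show "fst p i = fst q i" if i: "i < l div int s * int r"
    proof -
      have "i div int r < l div int s" using less_mult_div[OF r i] .
      then have "fst ?p k = fst ?q k" if "k div int s = i div int r" for k
        using that div_less_imp[OF s, of k l] unfolding l_def by (intro agree_below[OF fd]) linarith
      then show ?thesis using block_agree[OF p q, of "i div int r"] by blast
    qed
    show "fst p i = fst q i" if i: "(u div int s + 1) * int r \<le> i"
    proof -
      have "u div int s < i div int r" using zdiv_mono1[OF i, of "int r"] r by simp
      then have "fst ?p k = fst ?q k" if "k div int s = i div int r" for k
        using that div_less_imp[OF s, of u k] unfolding u_def by (intro agree_above[OF fd]) linarith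
      then show ?thesis using block_agree[OF p q, of "i div int r"] by blast
    qed
  qed (use win in auto)
  also have "\<dots> = (u div int s - l div int s + 1) * int r" by (simp add: algebra_simps)
  also have "\<dots> \<le> int r * (u - l) + 2 * int r" using div_window[of l u "int r" s] lu s by linarith
  finally show ?thesis by (simp add: wd_def l_def u_def)
qed

lemma recoding_inverse: "recoding B b0 A a0 s r (inv_into (words A r) \<phi>)"
proof
  have "replicate r a0 \<in> words A r" using a0 by (auto simp: words_def)
  then have "inv_into (words A r) \<phi> (\<phi> (replicate r a0)) = replicate r a0"
    using bij by (simp add: bij_betw_def)
  then show "inv_into (words A r) \<phi> (replicate s b0) = replicate r a0" by (simp only: \<phi>0)
qed (use a0 b0 r s bij_betw_inv_into[OF bij] in auto)

lemma recode_onto: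
  assumes q: "q \<in> states B b0"
  shows "\<exists>p\<in>states A a0. wd (recode r s \<phi> p) q \<le> int s"
proof -
  interpret rec_inv: recoding B b0 A a0 s r "inv_into (words A r) \<phi>" by (rule recoding_inverse)
  define p where "p = recode s r (inv_into (words A r) \<phi>) q"
  have p: "p \<in> states A a0" unfolding p_def by (rule rec_inv.recode_states[OF q])
  have "block s (fst (recode r s \<phi> p)) j = block s (fst q) j" for j
  proof -
    have "\<phi> (block r (fst p) j) = \<phi> (inv_into (words A r) \<phi> (block s (fst q) j))"
      unfolding p_def rec_inv.recode_block[OF q] ..
    also have "\<dots> = block s (fst q) j"
      using bij rec_inv.block_words[OF q] by (simp add: bij_betw_def f_inv_into_f)
    finally show ?thesis unfolding recode_block[OF p] .
  qed
  then have eq: "fst (recode r s \<phi> p) i = fst q i" for i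
    using block_eq_iff[OF s] by blast
  have hd: "snd (recode r s \<phi> p) = snd q div int s * int s"
    using r by (simp add: p_def recode_def)
  have "wd (recode r s \<phi> p) q \<le> snd q - snd q div int s * int s"
    using div_bounds(1)[OF s, of "snd q"]
    by (intro wd_le[OF states_fd[OF recode_states[OF p] q]]) (simp_all add: eq hd)
  also have "\<dots> \<le> int s" using div_bounds(2)[OF s, of "snd q"] by linarith
  finally show ?thesis using p by blast
qed

lemma lamp_qi_recode:
  assumes "finite A" "finite B"
  shows "lamp_qi A a0 B b0 (recode r s \<phi>) (2 * int s + 2 * int r)"
proof
  fix p q assume p: "p \<in> states A a0" and q: "q \<in> states A a0"
  have mono: "k * w + 2 * k \<le> (2 * int s + 2 * int r) * w + (2 * int s + 2 * int r)"
    if "0 \<le> w" "k \<le> int s + int r" "0 \<le> k" for k w :: int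
  proof -
    have "k * w \<le> (2 * int s + 2 * int r) * w" using that by (intro mult_right_mono) linarith+
    then show ?thesis using that(2) by linarith
  qed
  show "wd (recode r s \<phi> p) (recode r s \<phi> q) \<le> (2 * int s + 2 * int r) * wd p q + (2 * int s + 2 * int r)"
    by (rule order.trans[OF recode_upper[OF p q] mono]) (use wd_nonneg[OF states_fd[OF p q]] in auto)
  show "wd p q \<le> (2 * int s + 2 * int r) * wd (recode r s \<phi> p) (recode r s \<phi> q) + (2 * int s + 2 * int r)"
    by (rule order.trans[OF recode_lower[OF p q] mono])
      (use wd_nonneg[OF states_fd[OF recode_states[OF p] recode_states[OF q]]] in auto)
next
  fix q assume "q \<in> states B b0"
  from recode_onto[OF this] show "\<exists>p\<in>states A a0. wd (recode r s \<phi> p) q \<le> 2 * int s + 2 * int r"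
    by (rule bexE) (rule bexI[rotated], assumption, linarith)
qed (use assms a0 b0 r recode_states in simp_all)

end

lemma lamp_qi_of_card_powers:
  assumes "finite A" "a0 \<in> A" "finite B" "b0 \<in> B" "0 < r" "0 < s" "card A ^ r = card B ^ s"
  shows "\<exists>f K. lamp_qi A a0 B b0 f K"
proof -
  let ?a = "replicate r a0" and ?b = "replicate s b0"
  have mem: "?a \<in> words A r" "?b \<in> words B s" using assms by (auto simp: words_def)
  \<comment> \<open>The default words must correspond, so they are set aside and any bijection of
    the remaining words is taken.\<close>
  have "card (words A r - {?a}) = card (words B s - {?b})"
    using mem assms by (simp add: words_card)
  then obtain h where h: "bij_betw h (words A r - {?a}) (words B s - {?b})"
    using finite_same_card_bij[of "words A r - {?a}" "words B s - {?b}"] assms by (auto simp: words_card)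
  then have "bij_betw (\<lambda>x. if x \<in> {?a} then ?b else h x) ({?a} \<union> (words A r - {?a})) ({?b} \<union> (words B s - {?b}))"
    by (intro bij_betw_disjoint_Un) (auto simp: bij_betw_def)
  moreover have "{?a} \<union> (words A r - {?a}) = words A r" "{?b} \<union> (words B s - {?b}) = words B s"
    using mem by auto
  ultimately have "bij_betw (\<lambda>x. if x \<in> {?a} then ?b else h x) (words A r) (words B s)" by simp
  then have "recoding A a0 B b0 r s (\<lambda>x. if x \<in> {?a} then ?b else h x)"
    using assms by unfold_locales auto
  from recoding.lamp_qi_recode[OF this assms(1,3)] show ?thesis by blast
qed

section \<open>Word metrics on lamplighter groups\<close>

lemma up_eqI:
  assumes "snd a \<le> snd b" "\<And>i. i < snd a \<or> snd b \<le> i \<Longrightarrow> fst a i = fst b i"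
  shows "up a (map (\<lambda>k. fst b (snd a + int k)) [0..<nat (snd b - snd a)]) = b"
  using assms by (intro prod_eqI ext) (auto simp: fst_up nth_map)

text \<open>From \<open>p\<close> walk down to the lower end of the hull, climb to the upper end
  writing the lamps of \<open>q\<close>, and walk down to \<open>q\<close>: three legs of at most
  \<open>wd p q\<close> unit steps each. Downward legs are climbs read backwards, by symmetry of
  \<open>d\<close>.\<close>

lemma dist_le_wd:
  fixes d :: "'a state \<Rightarrow> 'a state \<Rightarrow> real"
  assumes refl: "\<And>p. p \<in> states A z \<Longrightarrow> d p p = 0"
    and sym: "\<And>p q. p \<in> states A z \<Longrightarrow> q \<in> states A z \<Longrightarrow> d p q = d q p"
    and triangle: "\<And>p q r. p \<in> states A z \<Longrightarrow> q \<in> states A z \<Longrightarrow> r \<in> states A z \<Longrightarrow> d p r \<le> d p q + d q r"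
    and step: "\<And>p q. p \<in> states A z \<Longrightarrow> q \<in> states A z \<Longrightarrow> wd p q \<le> 1 \<Longrightarrow> d p q \<le> M"
    and p: "p \<in> states A z" and q: "q \<in> states A z"
  shows "d p q \<le> 3 * M * real_of_int (wd p q)"
proof -
  have M: "0 \<le> M" using step[OF p p] refl[OF p] by simp
  have walk: "d a (up a ys) \<le> M * real (length ys)" if "a \<in> states A z" "set ys \<subseteq> A" for a ys
    using that
  proof (induction ys arbitrary: a)
    case Nil
    then show ?case using refl by simp
  next
    case (Cons y ys)
    have a': "up a [y] \<in> states A z" using Cons.prems by (intro up_states) auto
    have e: "up a (y # ys) = up (up a [y]) ys" by simp
    have "d a (up a (y # ys)) \<le> d a (up a [y]) + d (up a [y]) (up (up a [y]) ys)"
      unfolding e using Cons.prems a' by (intro triangle up_states) auto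
    also have "\<dots> \<le> M + M * real (length ys)"
      using Cons.prems(2) wd_up[of a "[y]"] by (intro add_mono step Cons.IH Cons.prems(1) a') auto
    finally show ?case by (simp add: algebra_simps)
  qed
  have climb: "d a b \<le> M * real_of_int (snd b - snd a)"
    if "a \<in> states A z" "b \<in> states A z" "snd a \<le> snd b" "\<And>i. i < snd a \<or> snd b \<le> i \<Longrightarrow> fst a i = fst b i" for a b
  proof -
    define ys where "ys = map (\<lambda>k. fst b (snd a + int k)) [0..<nat (snd b - snd a)]"
    have "set ys \<subseteq> A" using that(2) by (auto simp: ys_def states_def)
    moreover have "up a ys = b" unfolding ys_def by (rule up_eqI) (use that in auto)
    ultimately show ?thesis using walk[OF that(1), of ys] that(3) by (simp add: ys_def)
  qed
  note fd = states_fd[OF p q]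
  define a where "a = (fst p, lo p q)"
  define b where "b = (fst q, hi p q)"
  have ab: "a \<in> states A z" "b \<in> states A z" using p q by (auto simp: a_def b_def states_def)
  have lu: "lo p q \<le> hi p q" using wd_nonneg[OF fd] by (simp add: wd_def)
  have 1: "d a p \<le> M * real_of_int (wd p q)"
  proof -
    have "d a p \<le> M * real_of_int (snd p - snd a)"
      using lo_le[OF fd] by (intro climb ab p) (auto simp: a_def)
    also have "\<dots> \<le> M * real_of_int (wd p q)"
      using hi_ge[OF fd] M unfolding wd_def by (intro mult_left_mono) (auto simp: a_def)
    finally show ?thesis .
  qed
  have 2: "d a b \<le> M * real_of_int (wd p q)"
  proof -
    have "d a b \<le> M * real_of_int (snd b - snd a)"
      using lu agree_below[OF fd] agree_above[OF fd] by (intro climb ab) (auto simp: a_def b_def)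
    then show ?thesis by (simp add: a_def b_def wd_def)
  qed
  have 3: "d q b \<le> M * real_of_int (wd p q)"
  proof -
    have "d q b \<le> M * real_of_int (snd b - snd q)"
      using hi_ge[OF fd] by (intro climb ab q) (auto simp: b_def)
    also have "\<dots> \<le> M * real_of_int (wd p q)"
      using lo_le[OF fd] M unfolding wd_def by (intro mult_left_mono) (auto simp: b_def)
    finally show ?thesis .
  qed
  have "d p q \<le> d p a + (d a b + d b q)"
    using triangle[OF p ab(1) q] triangle[OF ab q] by linarith
  then show ?thesis using 1 2 3 sym[OF p ab(1)] sym[OF q ab(2)] by linarith
qed

context
  fixes F :: "('a, 'c) monoid_scheme"
  assumes F: "group F" and finF: "finite (carrier F)"
begin

interpretation F: group F by (rule F)
interpretation L: group "lamplighter F" by (rule group_lamplighter[OF F])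

lemma carrier_lamplighter_states: "carrier (lamplighter F) = states (carrier F) \<one>\<^bsub>F\<^esub>"
  unfolding carrier_lamplighter[OF F] by (auto simp: states_def)

lemmas lamplighter_fd = states_fd[of _ "carrier F" "\<one>\<^bsub>F\<^esub>", folded carrier_lamplighter_states]

text \<open>Left multiplication shifts the hull by \<open>snd x\<close> and creates no new differing
  lamps. Applied to \<open>x\<close> and its inverse, it gives the invariance in
  \<open>wd_inv_mult\<close>.\<close>

lemma wd_translate:
  assumes x: "x \<in> carrier (lamplighter F)" and y: "y \<in> carrier (lamplighter F)" and z: "z \<in> carrier (lamplighter F)"
  shows "wd (x \<otimes>\<^bsub>lamplighter F\<^esub> y) (x \<otimes>\<^bsub>lamplighter F\<^esub> z) \<le> wd y z"
proof -
  have e: "x \<otimes>\<^bsub>lamplighter F\<^esub> y = (\<lambda>i. fst x i \<otimes>\<^bsub>F\<^esub> fst y (i - snd x), snd x + snd y)" for y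
    using mult_lamplighter[where f = "fst x" and m = "snd x" and F = F and g = "fst y" and n = "snd y"] by simp
  have fd: "fd y z" by (rule lamplighter_fd[OF y z])
  have "wd (x \<otimes>\<^bsub>lamplighter F\<^esub> y) (x \<otimes>\<^bsub>lamplighter F\<^esub> z) \<le> (hi y z + snd x) - (lo y z + snd x)"
    using lo_le[OF fd] hi_ge[OF fd] agree_below[OF fd] agree_above[OF fd] x y z
    by (intro wd_le lamplighter_fd L.m_closed) (auto simp: e)
  then show ?thesis by (simp add: wd_def)
qed

lemma wd_inv_mult:
  assumes x: "x \<in> carrier (lamplighter F)" and y: "y \<in> carrier (lamplighter F)"
  shows "wd \<one>\<^bsub>lamplighter F\<^esub> (inv\<^bsub>lamplighter F\<^esub> x \<otimes>\<^bsub>lamplighter F\<^esub> y) = wd x y"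
proof (rule antisym)
  show "wd \<one>\<^bsub>lamplighter F\<^esub> (inv\<^bsub>lamplighter F\<^esub> x \<otimes>\<^bsub>lamplighter F\<^esub> y) \<le> wd x y"
    using wd_translate[OF L.inv_closed[OF x] x y] x by simp
  show "wd x y \<le> wd \<one>\<^bsub>lamplighter F\<^esub> (inv\<^bsub>lamplighter F\<^esub> x \<otimes>\<^bsub>lamplighter F\<^esub> y)"
    using wd_translate[OF x L.one_closed, of "inv\<^bsub>lamplighter F\<^esub> x \<otimes>\<^bsub>lamplighter F\<^esub> y"] x y
    by (simp add: L.m_assoc[symmetric])
qed

text \<open>Each generator displaces by a bounded amount, and by left invariance the displacements
  along a word add up.\<close>

lemma wd_le_word_dist:
  assumes S: "finite_generating_set (lamplighter F) S"
  shows "\<exists>M. \<forall>x\<in>carrier (lamplighter F). \<forall>y\<in>carrier (lamplighter F).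
    real_of_int (wd x y) \<le> M * word_dist (lamplighter F) S x y"
proof -
  let ?L = "lamplighter F"
  define U where "U = L.sym_set S"
  have U: "finite U" "U \<subseteq> carrier ?L" using S by (auto simp: U_def finite_generating_set_def)
  define M where "M = (\<Sum>g\<in>U. wd \<one>\<^bsub>?L\<^esub> g)"
  have gen: "wd \<one>\<^bsub>?L\<^esub> g \<le> M" if "g \<in> U" for g
    unfolding M_def using that U wd_nonneg[OF lamplighter_fd[OF L.one_closed]]
    by (intro member_le_sum) auto
  have word: "wd \<one>\<^bsub>?L\<^esub> (L.wprod w) \<le> M * int (length w)" if "set w \<subseteq> U" for w
    using that
  proof (induction w)
    case (Cons a w)
    have a: "a \<in> carrier ?L" and w: "L.wprod w \<in> carrier ?L"
      using Cons.prems U(2) by (auto intro: L.wprod_closed)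
    have "wd \<one>\<^bsub>?L\<^esub> (L.wprod (a # w)) \<le> wd \<one>\<^bsub>?L\<^esub> a + wd a (L.wprod (a # w))"
      by (intro wd_triangle lamplighter_fd) (use a w in auto)
    moreover have "wd a (L.wprod (a # w)) \<le> wd \<one>\<^bsub>?L\<^esub> (L.wprod w)"
      using wd_translate[OF a L.one_closed w] a by simp
    ultimately have "wd \<one>\<^bsub>?L\<^esub> (L.wprod (a # w)) \<le> M + M * int (length w)"
      using gen[of a] Cons by simp
    then show ?case by (simp add: algebra_simps)
  qed simp
  have "real_of_int (wd x y) \<le> real_of_int M * word_dist ?L S x y"
    if x: "x \<in> carrier ?L" and y: "y \<in> carrier ?L" for x y
  proof -
    obtain w where w: "length w = word_length ?L S (inv\<^bsub>?L\<^esub> x \<otimes>\<^bsub>?L\<^esub> y)" "set w \<subseteq> U"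
        "L.wprod w = inv\<^bsub>?L\<^esub> x \<otimes>\<^bsub>?L\<^esub> y"
      using L.word_length_witness[OF S, of "inv\<^bsub>?L\<^esub> x \<otimes>\<^bsub>?L\<^esub> y"] x y by (auto simp: U_def)
    have "wd x y \<le> M * int (length w)" using word[OF w(2)] wd_inv_mult[OF x y] w(3) by simp
    then have "real_of_int (wd x y) \<le> real_of_int (M * int (length w))" by (simp only: of_int_le_iff)
    then show ?thesis by (simp add: word_dist_def w(1))
  qed
  then show ?thesis by blast
qed

text \<open>The unit ball of \<open>wd\<close> is finite, so word length is bounded on it, and
  \<open>dist_le_wd\<close> extends the bound linearly.\<close>

lemma word_dist_le_wd:
  assumes S: "finite_generating_set (lamplighter F) S"
  shows "\<exists>M. \<forall>x\<in>carrier (lamplighter F). \<forall>y\<in>carrier (lamplighter F).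
    word_dist (lamplighter F) S x y \<le> M * real_of_int (wd x y)"
proof -
  let ?L = "lamplighter F"
  define Z where "Z = ball (carrier F) \<one>\<^bsub>F\<^esub> \<one>\<^bsub>?L\<^esub> 1"
  have Z: "finite Z" unfolding Z_def
    using L.one_closed by (intro ball_card(1)[OF finF]) (simp only: carrier_lamplighter_states)
  define M where "M = (\<Sum>g\<in>Z. word_length ?L S g)"
  have "word_dist ?L S x y \<le> real M" if "x \<in> carrier ?L" "y \<in> carrier ?L" "wd x y \<le> 1" for x y
  proof -
    have "inv\<^bsub>?L\<^esub> x \<otimes>\<^bsub>?L\<^esub> y \<in> carrier ?L" using that by auto
    then have "inv\<^bsub>?L\<^esub> x \<otimes>\<^bsub>?L\<^esub> y \<in> Z"
      using wd_inv_mult[OF that(1,2)] that(3) by (simp add: Z_def ball_def carrier_lamplighter_states)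
    then have "word_length ?L S (inv\<^bsub>?L\<^esub> x \<otimes>\<^bsub>?L\<^esub> y) \<le> M"
      unfolding M_def using Z by (intro member_le_sum) auto
    then show ?thesis by (simp add: word_dist_def)
  qed
  then have "word_dist ?L S x y \<le> 3 * real M * real_of_int (wd x y)"
    if "x \<in> carrier ?L" "y \<in> carrier ?L" for x y
    using that L.word_dist_zero_iff[OF S] L.word_dist_commute[OF S] L.word_dist_triangle[OF S]
    by (intro dist_le_wd[of "carrier F" "\<one>\<^bsub>F\<^esub>"]) (simp_all add: carrier_lamplighter_states)
  then show ?thesis by blast
qed

end

lemma word_metric_comparison:
  assumes "group F" "finite (carrier F)" "finite_generating_set (lamplighter F) S"
  obtains M :: real where "1 \<le> M"
    "\<And>x y. x \<in> carrier (lamplighter F) \<Longrightarrow> y \<in> carrier (lamplighter F) \<Longrightarrow>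
      real_of_int (wd x y) \<le> M * word_dist (lamplighter F) S x y"
    "\<And>x y. x \<in> carrier (lamplighter F) \<Longrightarrow> y \<in> carrier (lamplighter F) \<Longrightarrow>
      word_dist (lamplighter F) S x y \<le> M * real_of_int (wd x y)"
proof -
  obtain M1 M2 where
    M1: "\<And>x y. x \<in> carrier (lamplighter F) \<Longrightarrow> y \<in> carrier (lamplighter F) \<Longrightarrow>
      real_of_int (wd x y) \<le> M1 * word_dist (lamplighter F) S x y" and
    M2: "\<And>x y. x \<in> carrier (lamplighter F) \<Longrightarrow> y \<in> carrier (lamplighter F) \<Longrightarrow>
      word_dist (lamplighter F) S x y \<le> M2 * real_of_int (wd x y)"
    using wd_le_word_dist[OF assms] word_dist_le_wd[OF assms] by blast
  define M where "M = max 1 (max M1 M2)"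
  have "M1 * word_dist (lamplighter F) S x y \<le> M * word_dist (lamplighter F) S x y" for x y
    unfolding M_def word_dist_def by (intro mult_right_mono) auto
  moreover have "M2 * real_of_int (wd x y) \<le> M * real_of_int (wd x y)"
    if "x \<in> carrier (lamplighter F)" "y \<in> carrier (lamplighter F)" for x y
    unfolding M_def using wd_nonneg[OF lamplighter_fd[OF assms(1,2) that]] by (intro mult_right_mono) auto
  moreover have "1 \<le> M" by (simp add: M_def)
  ultimately show ?thesis using M1 M2 that[of M] order.trans by blast
qed

lemma quasi_isometric_lamplighter_iff:
  fixes F :: "('a, 'c) monoid_scheme" and F' :: "('b, 'd) monoid_scheme"
  assumes F: "group F" "finite (carrier F)" and F': "group F'" "finite (carrier F')"
  shows "quasi_isometric_groups (lamplighter F) (lamplighter F') \<longleftrightarrow>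
    (\<exists>f K. lamp_qi (carrier F) \<one>\<^bsub>F\<^esub> (carrier F') \<one>\<^bsub>F'\<^esub> f K)"
proof
  let ?X = "carrier (lamplighter F)" and ?Y = "carrier (lamplighter F')"
  note X = carrier_lamplighter_states[OF F] and Y = carrier_lamplighter_states[OF F']
  assume "quasi_isometric_groups (lamplighter F) (lamplighter F')"
  then obtain S T k c f where S: "finite_generating_set (lamplighter F) S"
    and T: "finite_generating_set (lamplighter F') T"
    and qi: "quasi_isometry k c ?X (word_dist (lamplighter F) S) ?Y (word_dist (lamplighter F') T) f"
    unfolding quasi_isometric_groups_def by blast
  let ?d = "word_dist (lamplighter F) S" and ?e = "word_dist (lamplighter F') T"
  have k: "1 \<le> k" and c: "0 \<le> c" and f: "\<And>x. x \<in> ?X \<Longrightarrow> f x \<in> ?Y"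
    and lower: "\<And>x y. x \<in> ?X \<Longrightarrow> y \<in> ?X \<Longrightarrow> 1 / k * ?d x y - c \<le> ?e (f x) (f y)"
    and upper: "\<And>x y. x \<in> ?X \<Longrightarrow> y \<in> ?X \<Longrightarrow> ?e (f x) (f y) \<le> k * ?d x y + c"
    and onto: "\<And>y. y \<in> ?Y \<Longrightarrow> \<exists>x\<in>?X. ?e (f x) y \<le> c"
    using qi unfolding quasi_isometry_def by blast+
  obtain M where M: "1 \<le> M" "\<And>x y. x \<in> ?X \<Longrightarrow> y \<in> ?X \<Longrightarrow> real_of_int (wd x y) \<le> M * ?d x y"
      "\<And>x y. x \<in> ?X \<Longrightarrow> y \<in> ?X \<Longrightarrow> ?d x y \<le> M * real_of_int (wd x y)"
    by (rule word_metric_comparison[OF F S]) blast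
  obtain N where N: "1 \<le> N" "\<And>x y. x \<in> ?Y \<Longrightarrow> y \<in> ?Y \<Longrightarrow> real_of_int (wd x y) \<le> N * ?e x y"
      "\<And>x y. x \<in> ?Y \<Longrightarrow> y \<in> ?Y \<Longrightarrow> ?e x y \<le> N * real_of_int (wd x y)"
    by (rule word_metric_comparison[OF F' T]) blast
  \<comment> \<open>Passing through both metric comparisons requires \<open>M * N * k\<close>,
    \<open>M * k * c\<close> and \<open>N * c\<close>; as all factors are at least 1 or nonnegative,
    this product dominates the three.\<close>
  define K where "K = \<lceil>M * N * k * (c + 1)\<rceil>"
  have ge1: "1 \<le> a * b" if "1 \<le> a" "1 \<le> b" for a b :: real
    using mult_mono[OF that] that by simp
  have le: "a \<le> a * b" if "0 \<le> a" "1 \<le> b" for a b :: real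
    using mult_left_mono[OF that(2,1)] by simp
  have KR: "M * N * k * (c + 1) \<le> real_of_int K" unfolding K_def by simp
  have bounds: "M * N * k \<le> real_of_int K" "N * c \<le> real_of_int K" "M * k * c \<le> real_of_int K"
  proof -
    have "M * N * k \<le> M * N * k * (c + 1)" using M N k c by (intro le) auto
    then show "M * N * k \<le> real_of_int K" using KR by linarith
    have "N * c \<le> N * c * (M * k)" using M N k c by (intro le ge1) auto
    moreover have "N * c * (M * k) \<le> M * N * k * (c + 1)" using M(1) N(1) k by (simp add: algebra_simps)
    ultimately show "N * c \<le> real_of_int K" using KR by linarith
    have "M * k * c \<le> M * k * c * N" using M N k c by (intro le) auto
    moreover have "M * k * c * N \<le> M * N * k * (c + 1)" using M(1) N(1) k by (simp add: algebra_simps)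
    ultimately show "M * k * c \<le> real_of_int K" using KR by linarith
  qed
  have K1: "1 \<le> K"
  proof -
    have "1 \<le> M * N * k" using M N k by (intro ge1) auto
    then have "real_of_int 1 \<le> real_of_int K" using bounds(1) by simp
    then show ?thesis by (simp only: of_int_le_iff)
  qed
  have "lamp_qi (carrier F) \<one>\<^bsub>F\<^esub> (carrier F') \<one>\<^bsub>F'\<^esub> f K"
  proof
    show "\<one>\<^bsub>F\<^esub> \<in> carrier F" "\<one>\<^bsub>F'\<^esub> \<in> carrier F'" using F(1) F'(1) by (auto simp: group.is_monoid monoid.one_closed)
    fix p assume "p \<in> states (carrier F) \<one>\<^bsub>F\<^esub>"
    then have p: "p \<in> ?X" by (simp only: X)
    from f[OF p] show "f p \<in> states (carrier F') \<one>\<^bsub>F'\<^esub>" by (simp only: Y)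
    fix q assume "q \<in> states (carrier F) \<one>\<^bsub>F\<^esub>"
    then have q: "q \<in> ?X" by (simp only: X)
    note w = wd_nonneg[OF lamplighter_fd[OF F p q]] wd_nonneg[OF lamplighter_fd[OF F' f[OF p] f[OF q]]]
    have "real_of_int (wd (f p) (f q)) \<le> N * ?e (f p) (f q)" by (rule N(2)[OF f[OF p] f[OF q]])
    also have "\<dots> \<le> N * (k * ?d p q + c)" using N(1) by (intro mult_left_mono upper p q) auto
    also have "\<dots> \<le> N * (k * (M * real_of_int (wd p q)) + c)"
      using N(1) k by (intro mult_left_mono add_right_mono M(3) p q) auto
    also have "\<dots> = M * N * k * real_of_int (wd p q) + N * c" by (simp add: algebra_simps)
    also have "\<dots> \<le> real_of_int K * real_of_int (wd p q) + real_of_int K"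
      using w by (intro add_mono mult_right_mono bounds) auto
    finally have "real_of_int (wd (f p) (f q)) \<le> real_of_int (K * wd p q + K)" by simp
    then show "wd (f p) (f q) \<le> K * wd p q + K" by (simp only: of_int_le_iff)
    have "?d p q \<le> k * (?e (f p) (f q) + c)" using lower[OF p q] k by (simp add: field_simps)
    then have "M * ?d p q \<le> M * (k * (?e (f p) (f q) + c))" using M(1) by (intro mult_left_mono) auto
    with M(2)[OF p q] have "real_of_int (wd p q) \<le> M * (k * (?e (f p) (f q) + c))" by linarith
    also have "\<dots> \<le> M * (k * (N * real_of_int (wd (f p) (f q)) + c))"
      using M(1) k by (intro mult_left_mono add_right_mono N(3) f p q) auto
    also have "\<dots> = M * N * k * real_of_int (wd (f p) (f q)) + M * k * c" by (simp add: algebra_simps)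
    also have "\<dots> \<le> real_of_int K * real_of_int (wd (f p) (f q)) + real_of_int K"
      using w by (intro add_mono mult_right_mono bounds) auto
    finally have "real_of_int (wd p q) \<le> real_of_int (K * wd (f p) (f q) + K)" by simp
    then show "wd p q \<le> K * wd (f p) (f q) + K" by (simp only: of_int_le_iff)
  next
    fix y assume "y \<in> states (carrier F') \<one>\<^bsub>F'\<^esub>"
    then have y: "y \<in> ?Y" by (simp only: Y)
    obtain x where x: "x \<in> ?X" "?e (f x) y \<le> c" using onto[OF y] by blast
    have "N * ?e (f x) y \<le> N * c" using N(1) x(2) by (intro mult_left_mono) auto
    with N(2)[OF f[OF x(1)] y] bounds(2) have "real_of_int (wd (f x) y) \<le> real_of_int K" by linarith
    then have "wd (f x) y \<le> K" by (simp only: of_int_le_iff)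
    with x(1) show "\<exists>x\<in>states (carrier F) \<one>\<^bsub>F\<^esub>. wd (f x) y \<le> K" unfolding X by blast
  qed (use F F' K1 in auto)
  then show "\<exists>f K. lamp_qi (carrier F) \<one>\<^bsub>F\<^esub> (carrier F') \<one>\<^bsub>F'\<^esub> f K" by blast
next
  let ?X = "carrier (lamplighter F)" and ?Y = "carrier (lamplighter F')"
  note X = carrier_lamplighter_states[OF F] and Y = carrier_lamplighter_states[OF F']
  assume "\<exists>f K. lamp_qi (carrier F) \<one>\<^bsub>F\<^esub> (carrier F') \<one>\<^bsub>F'\<^esub> f K"
  then obtain f K where "lamp_qi (carrier F) \<one>\<^bsub>F\<^esub> (carrier F') \<one>\<^bsub>F'\<^esub> f K" by blast
  then interpret lamp_qi "carrier F" "\<one>\<^bsub>F\<^esub>" "carrier F'" "\<one>\<^bsub>F'\<^esub>" f K .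
  obtain S T where S: "finite_generating_set (lamplighter F) S" and T: "finite_generating_set (lamplighter F') T"
    using finitely_generated_lamplighter[OF F] finitely_generated_lamplighter[OF F'] by blast
  let ?d = "word_dist (lamplighter F) S" and ?e = "word_dist (lamplighter F') T"
  obtain M where M: "1 \<le> M" "\<And>x y. x \<in> ?X \<Longrightarrow> y \<in> ?X \<Longrightarrow> real_of_int (wd x y) \<le> M * ?d x y"
      "\<And>x y. x \<in> ?X \<Longrightarrow> y \<in> ?X \<Longrightarrow> ?d x y \<le> M * real_of_int (wd x y)"
    by (rule word_metric_comparison[OF F S]) blast
  obtain N where N: "1 \<le> N" "\<And>x y. x \<in> ?Y \<Longrightarrow> y \<in> ?Y \<Longrightarrow> real_of_int (wd x y) \<le> N * ?e x y"
      "\<And>x y. x \<in> ?Y \<Longrightarrow> y \<in> ?Y \<Longrightarrow> ?e x y \<le> N * real_of_int (wd x y)"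
    by (rule word_metric_comparison[OF F' T]) blast
  define C where "C = M * N * real_of_int K"
  have K': "1 \<le> real_of_int K" using K by simp
  have le: "a \<le> a * b" if "0 \<le> a" "1 \<le> b" for a b :: real
    using mult_left_mono[OF that(2,1)] by simp
  have MC: "M * real_of_int K \<le> C" using le[of "M * real_of_int K" N] M(1) N(1) K' by (simp add: C_def mult_ac)
  have NC: "N * real_of_int K \<le> C" using le[of "N * real_of_int K" M] M(1) N(1) K' by (simp add: C_def mult_ac)
  have C: "1 \<le> C" using MC le[of M "real_of_int K"] M(1) K' by linarith
  have fY: "f x \<in> ?Y" if "x \<in> ?X" for x using f_in[of x] that unfolding X Y .
  have "quasi_isometry C C ?X ?d ?Y ?e f"
    unfolding quasi_isometry_def
  proof (intro conjI ballI)
    show "1 \<le> C" "0 \<le> C" using C by auto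
    show "f \<in> ?X \<rightarrow> ?Y" using fY by blast
    fix p q assume p: "p \<in> ?X" and q: "q \<in> ?X"
    have pq: "p \<in> states (carrier F) \<one>\<^bsub>F\<^esub>" "q \<in> states (carrier F) \<one>\<^bsub>F\<^esub>" using p q unfolding X .
    have "real_of_int (wd p q) \<le> real_of_int (K * wd (f p) (f q) + K)"
      unfolding of_int_le_iff by (rule f_ge[OF pq])
    then have "M * real_of_int (wd p q) \<le> M * (real_of_int K * real_of_int (wd (f p) (f q)) + real_of_int K)"
      using M(1) by (intro mult_left_mono) auto
    also have "\<dots> \<le> M * (real_of_int K * (N * ?e (f p) (f q)) + real_of_int K)"
      using M(1) K' by (intro mult_left_mono add_right_mono N(2) fY p q) auto
    also have "\<dots> = C * ?e (f p) (f q) + M * real_of_int K" by (simp add: C_def algebra_simps)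
    finally have "?d p q \<le> C * ?e (f p) (f q) + C" using M(3)[OF p q] MC by linarith
    then have "1 / C * ?d p q \<le> ?e (f p) (f q) + 1" using C by (simp add: field_simps)
    then show "1 / C * ?d p q - C \<le> ?e (f p) (f q)" using C by linarith
    have "real_of_int (wd (f p) (f q)) \<le> real_of_int (K * wd p q + K)"
      unfolding of_int_le_iff by (rule f_le[OF pq])
    then have "N * real_of_int (wd (f p) (f q)) \<le> N * (real_of_int K * real_of_int (wd p q) + real_of_int K)"
      using N(1) by (intro mult_left_mono) auto
    also have "\<dots> \<le> N * (real_of_int K * (M * ?d p q) + real_of_int K)"
      using N(1) K' by (intro mult_left_mono add_right_mono M(2) p q) auto
    also have "\<dots> = C * ?d p q + N * real_of_int K" by (simp add: C_def algebra_simps)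
    finally show "?e (f p) (f q) \<le> C * ?d p q + C" using N(3)[OF fY[OF p] fY[OF q]] NC by linarith
  next
    fix y assume y: "y \<in> ?Y"
    then have "y \<in> states (carrier F') \<one>\<^bsub>F'\<^esub>" unfolding Y .
    from f_onto[OF this] obtain x where x: "x \<in> ?X" "wd (f x) y \<le> K" unfolding X by blast
    have "N * real_of_int (wd (f x) y) \<le> N * real_of_int K"
      using N(1) x(2) by (intro mult_left_mono) auto
    then have "?e (f x) y \<le> C" using N(3)[OF fY[OF x(1)] y] NC by linarith
    with x(1) show "\<exists>x\<in>?X. ?e (f x) y \<le> C" by blast
  qed
  then show "quasi_isometric_groups (lamplighter F) (lamplighter F')"
    unfolding quasi_isometric_groups_def using S T by blast
qed

theorem theorem1p7:
  fixes F :: "('a, 'c) monoid_scheme" and F' :: "('b, 'd) monoid_scheme"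
  assumes "group F" and "finite (carrier F)"
    and "group F'" and "finite (carrier F')"
  shows "quasi_isometric_groups (lamplighter F) (lamplighter F') \<longleftrightarrow>
    (\<exists>d s r :: nat. d > 0 \<and> s > 0 \<and> r > 0 \<and>
       card (carrier F) = d ^ s \<and> card (carrier F') = d ^ r)"
  unfolding quasi_isometric_lamplighter_iff[OF assms]
proof
  assume "\<exists>f K. lamp_qi (carrier F) \<one>\<^bsub>F\<^esub> (carrier F') \<one>\<^bsub>F'\<^esub> f K"
  then obtain f K where "lamp_qi (carrier F) \<one>\<^bsub>F\<^esub> (carrier F') \<one>\<^bsub>F'\<^esub> f K" by blast
  from lamp_qi.common_power[OF this]
  show "\<exists>d s r. 0 < d \<and> 0 < s \<and> 0 < r \<and> card (carrier F) = d ^ s \<and> card (carrier F') = d ^ r" .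
next
  assume "\<exists>d s r. 0 < d \<and> 0 < s \<and> 0 < r \<and> card (carrier F) = d ^ s \<and> card (carrier F') = d ^ r"
  then obtain d s r where "0 < s" "0 < r" and card: "card (carrier F) = d ^ s" "card (carrier F') = d ^ r"
    by blast
  \<comment> \<open>The exponents cross, so blocks of length \<open>r\<close> on one side match
    blocks of length \<open>s\<close> on the other: both have \<open>d ^ (s * r)\<close>
    words.\<close>
  moreover have "card (carrier F) ^ r = card (carrier F') ^ s"
    unfolding card by (simp add: power_mult[symmetric] mult.commute)
  ultimately show "\<exists>f K. lamp_qi (carrier F) \<one>\<^bsub>F\<^esub> (carrier F') \<one>\<^bsub>F'\<^esub> f K"
    using assms by (intro lamp_qi_of_card_powers) (auto simp: group.is_monoid monoid.one_closed)
qed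

end
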